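(* Let $K$ be a global function field over a finite field $k$ of characteristic $p>0$, let $\Sigma_K$ be its set of places, let $\Sigma\subset\Sigma_K$ be a cofinite subset and put $S=\Sigma_K\setminus\Sigma$. Let $\Gamma\subset K^*$ be a subgroup with $\Gamma\subset O_{S_0}^*$ for some finite $S_0\subset\Sigma_K$. Suppose that $\Gamma\cap O_S^*$ has rank at most one. Then for every natural number $M$ and every closed $K$-variety $W$ in the affine space $\mathbb{A}^M$, we have $W(\overline{\Gamma})=\overline{W(\Gamma)}$.
   Context: For a place $v$, $K_v$ is the completion of $K$ at $v$, with valuation ring $O_v$ and maximal ideal $\mathfrak m_v$. For a finite set $S'\subset\Sigma_K$, $O_{S'}$ is the ring of $S'$-integers of $K$ (elements $x\in K$ with $v(x)\ge 0$ for all $v\notin S'$), and $O_{S'}^*$ its unit group. The rank of a finitely generated abelian group is the rank of its free part. The product $\prod_{v\in\Sigma}K_v^*$ carries the product topology, and $K$ (hence $\Gamma$) is embedded diagonally in $\prod_{v\in\Sigma}K_v$. $\overline{\Gamma}$ denotes the topological closure of the diagonal image of $\Gamma$ in $\prod_{v\in\Sigma}K_v^*$. For a closed $K$-variety $W\subset\mathbb A^M$ and a subset $\Theta$ of a ring containing $K$, $W(\Theta)$ is the set of points of $W$ (i.e. common zeros of defining polynomials of $W$) all of whose coordinates lie in $\Theta$. $\overline{W(\Gamma)}$ denotes the topological closure of the diagonal image of $W(\Gamma)$ in $W(\prod_{v\in\Sigma}K_v^* )\subset(\prod_{v\in\Sigma}K_v^* )^M$. *)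

theory Defs
  imports "HOL-Analysis.Analysis"
begin

text \<open>Elements of the prime field F_p are the images of integers; a polynomial over F_p
  evaluated at t is a finite sum of (images of) integers times powers of t.\<close>

definition Fp_poly_vals :: "'k::field \<Rightarrow> 'k set" where
  "Fp_poly_vals t = {(\<Sum>i\<le>n. of_int (c i) * t ^ i) | (c :: nat \<Rightarrow> int) n. True}"

definition Fp_rat_field :: "'k::field \<Rightarrow> 'k set" where
  "Fp_rat_field t = {a / b | a b. a \<in> Fp_poly_vals t \<and> b \<in> Fp_poly_vals t \<and> b \<noteq> 0}"

text \<open>K (the whole type 'k) is a global function field of characteristic p: it has
  characteristic p, contains an element t transcendental over F_p, and is a finite
  extension (finite-dimensional vector space) of F_p(t).\<close>

definition global_function_field :: "'k::field itself \<Rightarrow> nat \<Rightarrow> bool" where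
  "global_function_field _ p \<longleftrightarrow> prime p \<and> of_nat p = (0::'k) \<and>
     (\<exists>t::'k.
        (\<forall>(c :: nat \<Rightarrow> int) n. (\<Sum>i\<le>n. of_int (c i) * t ^ i) = 0 \<longrightarrow> (\<forall>i\<le>n. int p dvd c i)) \<and>
        (\<exists>B. finite B \<and> (\<forall>x. \<exists>l. (\<forall>b\<in>B. l b \<in> Fp_rat_field t) \<and> x = (\<Sum>b\<in>B. l b * b))))"

text \<open>A place of K is represented by its normalized discrete valuation
  v : K^* \<rightarrow> Z (surjective; all places of a function field are non-archimedean).
  By convention v 0 = 0 so that each place has a unique representative.\<close>

definition is_place :: "('k::field \<Rightarrow> int) \<Rightarrow> bool" where
  "is_place v \<longleftrightarrow> v 0 = 0 \<and>
     (\<forall>x y. x \<noteq> 0 \<longrightarrow> y \<noteq> 0 \<longrightarrow> v (x * y) = v x + v y) \<and>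
     (\<forall>x y. x \<noteq> 0 \<longrightarrow> y \<noteq> 0 \<longrightarrow> x + y \<noteq> 0 \<longrightarrow> min (v x) (v y) \<le> v (x + y)) \<and>
     (\<exists>x. x \<noteq> 0 \<and> v x = 1)"

definition places :: "('k::field \<Rightarrow> int) set" where
  "places = {v. is_place v}"

text \<open>"v(x) \<ge> N", with v(0) = +\<infinity>.\<close>
definition vge :: "('k::field \<Rightarrow> int) \<Rightarrow> 'k \<Rightarrow> int \<Rightarrow> bool" where
  "vge v x N \<longleftrightarrow> x = 0 \<or> N \<le> v x"

definition S_units :: "('k::field \<Rightarrow> int) set \<Rightarrow> 'k set" where
  "S_units S = {x. x \<noteq> 0 \<and> (\<forall>v\<in>places. v \<notin> S \<longrightarrow> v x = 0)}"

definition mult_independent :: "'k::field set \<Rightarrow> bool" where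
  "mult_independent A \<longleftrightarrow>
     (\<forall>e :: 'k \<Rightarrow> int. (\<Prod>a\<in>A. a powi e a) = 1 \<longrightarrow> (\<forall>a\<in>A. e a = 0))"

text \<open>rank G \<le> n: every finite multiplicatively (Z-)independent subset has at most n
  elements (for finitely generated abelian groups this is the rank of the free part).\<close>
definition rank_le :: "'k::field set \<Rightarrow> nat \<Rightarrow> bool" where
  "rank_le G n \<longleftrightarrow> (\<forall>A. A \<subseteq> G \<and> finite A \<and> mult_independent A \<longrightarrow> card A \<le> n)"

definition mult_subgroup :: "'k::field set \<Rightarrow> bool" where
  "mult_subgroup G \<longleftrightarrow> G \<subseteq> - {0} \<and> 1 \<in> G \<and>
     (\<forall>x\<in>G. \<forall>y\<in>G. x * y \<in> G) \<and> (\<forall>x\<in>G. inverse x \<in> G)"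

definition vcauchy :: "('k::field \<Rightarrow> int) \<Rightarrow> (nat \<Rightarrow> 'k) \<Rightarrow> bool" where
  "vcauchy v X \<longleftrightarrow> (\<forall>N. \<exists>n0. \<forall>m\<ge>n0. \<forall>n\<ge>n0. vge v (X m - X n) N)"

definition vnull :: "('k::field \<Rightarrow> int) \<Rightarrow> (nat \<Rightarrow> 'k) \<Rightarrow> bool" where
  "vnull v X \<longleftrightarrow> (\<forall>N. \<exists>n0. \<forall>n\<ge>n0. vge v (X n) N)"

text \<open>The class of a Cauchy sequence, i.e. the corresponding element of K_v.\<close>
definition vclass :: "('k::field \<Rightarrow> int) \<Rightarrow> (nat \<Rightarrow> 'k) \<Rightarrow> (nat \<Rightarrow> 'k) set" where
  "vclass v X = {Y. vcauchy v Y \<and> vnull v (\<lambda>n. X n - Y n)}"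

definition compl :: "('k::field \<Rightarrow> int) \<Rightarrow> (nat \<Rightarrow> 'k) set set" where
  "compl v = {vclass v X | X. vcauchy v X}"

definition compl_units :: "('k::field \<Rightarrow> int) \<Rightarrow> (nat \<Rightarrow> 'k) set set" where
  "compl_units v = {vclass v X | X. vcauchy v X \<and> \<not> vnull v X}"

definition vemb :: "('k::field \<Rightarrow> int) \<Rightarrow> 'k \<Rightarrow> (nat \<Rightarrow> 'k) set" where
  "vemb v a = vclass v (\<lambda>_. a)"

definition vball :: "('k::field \<Rightarrow> int) \<Rightarrow> int \<Rightarrow> (nat \<Rightarrow> 'k) set \<Rightarrow> (nat \<Rightarrow> 'k) set set" where
  "vball v N \<xi> = {\<eta> \<in> compl v. \<exists>X\<in>\<xi>. \<exists>Y\<in>\<eta>. \<exists>n0. \<forall>n\<ge>n0. vge v (X n - Y n) N}"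

definition Kv_star_top :: "('k::field \<Rightarrow> int) \<Rightarrow> (nat \<Rightarrow> 'k) set topology" where
  "Kv_star_top v = topology_generated_by {vball v N \<xi> \<inter> compl_units v | N \<xi>. \<xi> \<in> compl_units v}"

definition ideles_top :: "('k::field \<Rightarrow> int) set \<Rightarrow> (('k \<Rightarrow> int) \<Rightarrow> (nat \<Rightarrow> 'k) set) topology" where
  "ideles_top \<Sigma> = product_topology Kv_star_top \<Sigma>"

definition ideles_pow_top :: "('k::field \<Rightarrow> int) set \<Rightarrow> nat
     \<Rightarrow> (nat \<Rightarrow> ('k \<Rightarrow> int) \<Rightarrow> (nat \<Rightarrow> 'k) set) topology" where
  "ideles_pow_top \<Sigma> M = product_topology (\<lambda>_. ideles_top \<Sigma>) {..<M}"

definition diag :: "('k::field \<Rightarrow> int) set \<Rightarrow> 'k \<Rightarrow> ('k \<Rightarrow> int) \<Rightarrow> (nat \<Rightarrow> 'k) set" where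
  "diag \<Sigma> a = (\<lambda>v\<in>\<Sigma>. vemb v a)"

definition diag_pt :: "('k::field \<Rightarrow> int) set \<Rightarrow> nat \<Rightarrow> (nat \<Rightarrow> 'k)
     \<Rightarrow> nat \<Rightarrow> ('k \<Rightarrow> int) \<Rightarrow> (nat \<Rightarrow> 'k) set" where
  "diag_pt \<Sigma> M a = (\<lambda>i\<in>{..<M}. diag \<Sigma> (a i))"

text \<open>A polynomial in the variables X_0,...,X_{M-1} over K: a finitely supported map
  from exponent vectors (supported in {..<M}) to coefficients.\<close>
definition is_poly :: "nat \<Rightarrow> ((nat \<Rightarrow> nat) \<Rightarrow> 'k::field) \<Rightarrow> bool" where
  "is_poly M f \<longleftrightarrow> finite {m. f m \<noteq> 0} \<and> (\<forall>m. f m \<noteq> 0 \<longrightarrow> (\<forall>i\<ge>M. m i = 0))"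

definition peval :: "nat \<Rightarrow> ((nat \<Rightarrow> nat) \<Rightarrow> 'k::field) \<Rightarrow> (nat \<Rightarrow> 'k) \<Rightarrow> 'k" where
  "peval M f x = (\<Sum>m\<in>{m. f m \<noteq> 0}. f m * (\<Prod>i<M. x i ^ m i))"

definition var_points_K :: "nat \<Rightarrow> ((nat \<Rightarrow> nat) \<Rightarrow> 'k::field) set \<Rightarrow> 'k set \<Rightarrow> (nat \<Rightarrow> 'k) set" where
  "var_points_K M F \<Theta> = {a \<in> {..<M} \<rightarrow>\<^sub>E \<Theta>. \<forall>f\<in>F. peval M f a = 0}"

text \<open>f vanishes at a point (\<xi>_0,...,\<xi>_{M-1}) of K_v^M: evaluating f on
  representing Cauchy sequences gives a null sequence.\<close>
definition vzero :: "('k::field \<Rightarrow> int) \<Rightarrow> nat \<Rightarrow> ((nat \<Rightarrow> nat) \<Rightarrow> 'k)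
     \<Rightarrow> (nat \<Rightarrow> (nat \<Rightarrow> 'k) set) \<Rightarrow> bool" where
  "vzero v M f \<xi> \<longleftrightarrow> (\<forall>X. (\<forall>i<M. X i \<in> \<xi> i) \<longrightarrow> vnull v (\<lambda>n. peval M f (\<lambda>i. X i n)))"

definition var_points_ad :: "('k::field \<Rightarrow> int) set \<Rightarrow> nat \<Rightarrow> ((nat \<Rightarrow> nat) \<Rightarrow> 'k) set
     \<Rightarrow> (('k \<Rightarrow> int) \<Rightarrow> (nat \<Rightarrow> 'k) set) set
     \<Rightarrow> (nat \<Rightarrow> ('k \<Rightarrow> int) \<Rightarrow> (nat \<Rightarrow> 'k) set) set" where
  "var_points_ad \<Sigma> M F \<Theta> = {P \<in> {..<M} \<rightarrow>\<^sub>E \<Theta>. \<forall>f\<in>F. \<forall>v\<in>\<Sigma>. vzero v M f (\<lambda>i. P i v)}"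

end

theory Submission
  imports Defs
begin

text \<open>
  Dividing by a nearby point of \<open>\<Gamma>\<close> reduces everything to the group \<open>\<Gamma> \<inter> O_S\<^sup>*\<close>, which modulo constants
  is generated by a single element \<open>g\<close>. A point of the closure is then a tuple \<open>\<alpha>_i g^{n_i}\<close>
  whose exponents \<open>n_i\<close> are profinite integers, and a polynomial equation becomes \<open>\<Sum> c_m g^{h_m(n)} = 0\<close>
  for integral linear forms \<open>h_m\<close>. Reducing the exponents modulo a suitable \<open>L\<close> changes the sum by a
  multiple of \<open>g^L - 1\<close>; as there are few terms, a cyclic shift brings all exponents well below \<open>L\<close>,
  and then the quotient by \<open>g^L - 1\<close> (cleared of its bounded poles at \<open>S\<close>) has no pole but vanishes
  where \<open>g\<close> has one, so the reduced sum is exactly zero. The same argument splits it into vanishing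
  subsums with bounded exponent differences; these differences are integral affine relations
  satisfied by the profinite \<open>n_i\<close>. Ordinary integers congruent to the \<open>n_i\<close> modulo a prescribed number
  and satisfying all those relations yield an exact solution close to the given point.

  Instead of a degree or product formula the proof only uses that a function without poles is
  constant, which follows from the existence of places extending a given subring (Chevalley).
\<close>

section \<open>Subrings and linear dependence over subfields\<close>

text \<open>The quotient by g^L - 1 is manageable because its poles over S do not grow with L. At a
  place where g is a unit, raising a power of g that is already close to 1 to an exponent prime to p
  leaves the order of contact with 1 unchanged, so only the p-part of L counts. Hence L has the form
  Q u with u = 1 mod p, and one fixed factor g^(k p^r) - 1 clears these poles; its own pole order is
  charged to the gap between the exponents and L. Since L must be known before the approximating
  point is chosen, the constants may depend on the number and the weights of the terms but not on
  the exponents of that point. The coefficients are arbitrary functions; multiplication by a common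
  q leaves poles only at the poles of g, of order at most E times that of g, and E is all that the
  estimates see of them. Relations among the n_i hold at every finite level while only one L is
  available: for each candidate difference d that is not a relation, a level refuting it is built
  into Q, and only finitely many d are at stake. The generator g is read off from one valuation that
  detects the non-constant units on \<Sigma>.\<close>

definition subring_set :: "'k::field set \<Rightarrow> bool" where
  "subring_set A \<longleftrightarrow> 1 \<in> A \<and> (\<forall>x\<in>A. \<forall>y\<in>A. x - y \<in> A \<and> x * y \<in> A)"

definition subfield_set :: "'k::field set \<Rightarrow> bool" where
  "subfield_set A \<longleftrightarrow> subring_set A \<and> (\<forall>x\<in>A. inverse x \<in> A)"

lemma subring_set_closed:
  assumes "subring_set A"
  shows "0 \<in> A" "1 \<in> A" "x \<in> A \<Longrightarrow> y \<in> A \<Longrightarrow> x - y \<in> A" "x \<in> A \<Longrightarrow> y \<in> A \<Longrightarrow> x * y \<in> A"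
    "x \<in> A \<Longrightarrow> - x \<in> A" "x \<in> A \<Longrightarrow> y \<in> A \<Longrightarrow> x + y \<in> A" "x \<in> A \<Longrightarrow> x ^ n \<in> A"
proof -
  show 1: "1 \<in> A" using assms by (auto simp: subring_set_def)
  have d: "x - y \<in> A" if "x \<in> A" "y \<in> A" for x y
    using assms that by (auto simp: subring_set_def)
  have m: "x * y \<in> A" if "x \<in> A" "y \<in> A" for x y
    using assms that by (auto simp: subring_set_def)
  show 0: "0 \<in> A" using d[OF 1 1] by simp
  have n: "- x \<in> A" if "x \<in> A" for x using d[OF 0 that] by simp
  show "x \<in> A \<Longrightarrow> y \<in> A \<Longrightarrow> x - y \<in> A" by (rule d)
  show "x \<in> A \<Longrightarrow> y \<in> A \<Longrightarrow> x * y \<in> A" by (rule m)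
  show "x \<in> A \<Longrightarrow> - x \<in> A" by (rule n)
  show "x \<in> A \<Longrightarrow> y \<in> A \<Longrightarrow> x + y \<in> A" using d[of x "- y"] n[of y] by simp
  show "x \<in> A \<Longrightarrow> x ^ n \<in> A" by (induction n) (auto intro: 1 m)
qed

lemma subring_set_sum:
  assumes "subring_set A" "\<And>i. i \<in> I \<Longrightarrow> f i \<in> A"
  shows "sum f I \<in> A"
  using assms(2) by (induction I rule: infinite_finite_induct)
    (auto intro: subring_set_closed[OF assms(1)])

lemma subfield_set_divide:
  assumes "subfield_set A" "x \<in> A" "y \<in> A"
  shows "x / y \<in> A"
  using assms subring_set_closed(4)[of A x "inverse y"]
  by (auto simp: subfield_set_def field_simps)

definition adjoin :: "'k::field set \<Rightarrow> 'k \<Rightarrow> 'k set" where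
  "adjoin A x = {(\<Sum>i\<le>n. b i * x ^ i) | b n. \<forall>i. b i \<in> A}"

definition fracs :: "'k::field set \<Rightarrow> 'k set" where
  "fracs A = {a / b | a b. a \<in> A \<and> b \<in> A \<and> b \<noteq> 0}"

lemma adjoinI:
  assumes "subring_set A" "\<And>i. i \<le> n \<Longrightarrow> b i \<in> A"
  shows "(\<Sum>i\<le>n. b i * x ^ i) \<in> adjoin A x"
proof -
  have "(\<Sum>i\<le>n. b i * x ^ i) = (\<Sum>i\<le>n. (if i \<le> n then b i else 0) * x ^ i)"
    by (rule sum.cong) auto
  then show ?thesis
    using assms subring_set_closed(1)[OF assms(1)] unfolding adjoin_def
    by (intro CollectI exI[of _ "\<lambda>i. if i \<le> n then b i else 0"] exI[of _ n]) auto
qed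

text \<open>A uniform degree turns a finite family of polynomial expressions into a rectangular
  array of coefficients, so that double sums can be swapped and coefficients compared power by
  power.\<close>

lemma adjoin_common_degree:
  fixes n :: nat
  assumes A: "subring_set A" and c: "\<forall>i\<le>n. c i \<in> adjoin A x"
  shows "\<exists>b m. \<forall>i\<le>n. c i = (\<Sum>j\<le>m. b i j * x ^ j) \<and> (\<forall>j. b i j \<in> A)"
proof -
  have "\<forall>i. \<exists>b m. i \<le> n \<longrightarrow> c i = (\<Sum>j\<le>m. b j * x ^ j) \<and> (\<forall>j. b j \<in> A)"
    using c unfolding adjoin_def by blast
  then obtain b m where bm: "\<And>i. i \<le> n \<Longrightarrow> c i = (\<Sum>j\<le>m i. b i j * x ^ j) \<and> (\<forall>j. b i j \<in> A)"
    by metis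
  define M where "M = Max (m ` {..n})"
  have mM: "m i \<le> M" if "i \<le> n" for i using that by (auto simp: M_def)
  have "c i = (\<Sum>j\<le>M. (if j \<le> m i then b i j else 0) * x ^ j)" if i: "i \<le> n" for i
  proof -
    have "(\<Sum>j\<le>m i. b i j * x ^ j) = (\<Sum>j\<le>M. (if j \<le> m i then b i j else 0) * x ^ j)"
      using mM[OF i] by (intro sum.mono_neutral_cong_left) auto
    then show ?thesis using bm[OF i] by simp
  qed
  moreover have "(if j \<le> m i then b i j else 0) \<in> A" if "i \<le> n" for i j
    using bm[OF that] subring_set_closed(1)[OF A] by auto
  ultimately show ?thesis by (intro exI[of _ "\<lambda>i j. if j \<le> m i then b i j else 0"] exI[of _ M]) blast
qed

lemma adjoin_extends:
  assumes "subring_set A" "a \<in> A"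
  shows "a \<in> adjoin A x"
  using adjoinI[OF assms(1), of 0 "\<lambda>_. a" x] assms(2) by simp

lemma adjoin_generator:
  assumes "subring_set A"
  shows "x \<in> adjoin A x"
proof -
  have "(\<Sum>i\<le>1. of_nat i * x ^ i) \<in> adjoin A x"
    by (rule adjoinI[OF assms]) (use subring_set_closed[OF assms] in \<open>auto simp: le_Suc_eq\<close>)
  then show ?thesis by simp
qed

lemma adjoin_subset:
  assumes "subring_set B" "A \<subseteq> B" "x \<in> B"
  shows "adjoin A x \<subseteq> B"
  using assms(2,3) unfolding adjoin_def
  by (auto intro!: subring_set_sum[OF assms(1)] subring_set_closed[OF assms(1)])

lemma subring_adjoin:
  assumes A: "subring_set A"
  shows "subring_set (adjoin A x)"
proof -
  note cl = subring_set_closed[OF A]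
  have diff: "u - w \<in> adjoin A x" if u: "u \<in> adjoin A x" and w: "w \<in> adjoin A x" for u w
  proof -
    obtain b n where b: "u = (\<Sum>i\<le>n. b i * x ^ i)" "\<forall>i. b i \<in> A" using u by (auto simp: adjoin_def)
    obtain c m where c: "w = (\<Sum>i\<le>m. c i * x ^ i)" "\<forall>i. c i \<in> A" using w by (auto simp: adjoin_def)
    have "u = (\<Sum>i\<le>max n m. (if i \<le> n then b i else 0) * x ^ i)"
      unfolding b by (rule sum.mono_neutral_cong_left) auto
    moreover have "w = (\<Sum>i\<le>max n m. (if i \<le> m then c i else 0) * x ^ i)"
      unfolding c by (rule sum.mono_neutral_cong_left) auto
    ultimately have "u - w =
        (\<Sum>i\<le>max n m. ((if i \<le> n then b i else 0) - (if i \<le> m then c i else 0)) * x ^ i)"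
      by (simp add: sum_subtractf left_diff_distrib)
    also have "\<dots> \<in> adjoin A x"
      by (rule adjoinI[OF A]) (use b c cl in auto)
    finally show ?thesis .
  qed
  have zero: "0 \<in> adjoin A x" and one: "1 \<in> adjoin A x" using cl by (auto intro: adjoin_extends[OF A])
  have add: "u + w \<in> adjoin A x" if u: "u \<in> adjoin A x" and w: "w \<in> adjoin A x" for u w
    using diff[OF u diff[OF zero w]] by simp
  have shift: "b * x ^ j * u \<in> adjoin A x" if b: "b \<in> A" and u: "u \<in> adjoin A x" for b j u
  proof -
    obtain c m where c: "u = (\<Sum>i\<le>m. c i * x ^ i)" "\<forall>i. c i \<in> A" using u by (auto simp: adjoin_def)
    have "b * x ^ j * u = (\<Sum>i\<le>m. b * c i * x ^ (i + j))"
      by (simp add: c sum_distrib_left power_add algebra_simps)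
    also have "\<dots> = (\<Sum>i\<in>{j..m+j}. b * c (i - j) * x ^ i)"
      by (rule sum.reindex_bij_witness[of _ "\<lambda>i. i - j" "\<lambda>i. i + j"]) auto
    also have "\<dots> = (\<Sum>i\<le>m+j. (if j \<le> i then b * c (i - j) else 0) * x ^ i)"
      by (rule sum.mono_neutral_cong_left) auto
    also have "\<dots> \<in> adjoin A x"
      by (rule adjoinI[OF A]) (use b c cl in auto)
    finally show ?thesis .
  qed
  have mult: "u * w \<in> adjoin A x" if u: "u \<in> adjoin A x" and w: "w \<in> adjoin A x" for u w
  proof -
    obtain b n where b: "u = (\<Sum>i\<le>n. b i * x ^ i)" "\<forall>i. b i \<in> A" using u by (auto simp: adjoin_def)
    have "(\<Sum>i\<in>I. b i * x ^ i * w) \<in> adjoin A x" for I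
      by (induction I rule: infinite_finite_induct) (use b w shift zero add in auto)
    then show ?thesis by (simp add: b sum_distrib_right)
  qed
  show ?thesis using one diff mult by (auto simp: subring_set_def)
qed

lemma subfield_fracs:
  assumes A: "subring_set A"
  shows "subfield_set (fracs A)"
proof -
  note cl = subring_set_closed[OF A]
  have one: "1 \<in> fracs A" using cl unfolding fracs_def by (force intro: exI[of _ 1])
  have closed: "x - y \<in> fracs A \<and> x * y \<in> fracs A" if x: "x \<in> fracs A" and y: "y \<in> fracs A" for x y
  proof -
    obtain a b where ab: "x = a / b" "a \<in> A" "b \<in> A" "b \<noteq> 0" using x by (auto simp: fracs_def)
    obtain c d where cd: "y = c / d" "c \<in> A" "d \<in> A" "d \<noteq> 0" using y by (auto simp: fracs_def)
    have "x - y = (a * d - c * b) / (b * d)" "x * y = (a * c) / (b * d)"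
      using ab cd by (auto simp: field_simps)
    moreover have "b * d \<noteq> 0" "b * d \<in> A" "a * c \<in> A" "a * d - c * b \<in> A" using ab cd cl by auto
    ultimately show ?thesis unfolding fracs_def by blast
  qed
  have inv: "inverse x \<in> fracs A" if x: "x \<in> fracs A" for x
  proof -
    obtain a b where ab: "x = a / b" "a \<in> A" "b \<in> A" "b \<noteq> 0" using x by (auto simp: fracs_def)
    show ?thesis
    proof (cases "a = 0")
      case True
      then show ?thesis using ab x by simp
    next
      case False
      then have "inverse x = b / a" using ab by simp
      then show ?thesis using ab False unfolding fracs_def by blast
    qed
  qed
  show ?thesis using one closed inv by (auto simp: subfield_set_def subring_set_def)
qed

lemma fracs_extends:
  assumes "subring_set A" "a \<in> A"
  shows "a \<in> fracs A"
  using assms subring_set_closed(2)[OF assms(1)] unfolding fracs_def by (force intro: exI[of _ 1])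

lemma fracs_common_denominator:
  assumes A: "subring_set A" and "finite I" "\<And>i. i \<in> I \<Longrightarrow> c i \<in> fracs A"
  shows "\<exists>D\<in>A. D \<noteq> 0 \<and> (\<forall>i\<in>I. D * c i \<in> A)"
  using assms(2,3)
proof (induction I)
  case empty
  then show ?case using subring_set_closed(2)[OF A] by (intro bexI[of _ 1]) auto
next
  case (insert j I)
  then obtain D where D: "D \<in> A" "D \<noteq> 0" "\<forall>i\<in>I. D * c i \<in> A" by auto
  obtain a b where ab: "c j = a / b" "a \<in> A" "b \<in> A" "b \<noteq> 0"
    using insert.prems[of j] by (auto simp: fracs_def)
  have "D * b * c i \<in> A" if "i \<in> insert j I" for i
  proof (cases "i = j")
    case True
    then show ?thesis using ab D subring_set_closed(4)[OF A, of D a] by simp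
  next
    case False
    then show ?thesis
      using that D ab subring_set_closed(4)[OF A, of b "D * c i"] by (simp add: ac_simps)
  qed
  moreover have "D * b \<in> A" "D * b \<noteq> 0" using D ab subring_set_closed(4)[OF A] by auto
  ultimately show ?case by blast
qed

text \<open>Gaussian elimination by induction on the equations, arranged so that every pivot
  quotient stays inside the subfield \<open>F\<close>.\<close>

lemma homogeneous_system_solution:
  fixes a :: "'i \<Rightarrow> 'b \<Rightarrow> 'k::field"
  assumes F: "subfield_set F" and "finite B" "finite I" "card B < card I"
    "\<And>i b. i \<in> I \<Longrightarrow> b \<in> B \<Longrightarrow> a i b \<in> F"
  shows "\<exists>c. (\<forall>i\<in>I. c i \<in> F) \<and> (\<exists>i\<in>I. c i \<noteq> 0) \<and> (\<forall>b\<in>B. (\<Sum>i\<in>I. c i * a i b) = 0)"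
  using assms(2-5)
proof (induction B arbitrary: I a)
  case empty
  have "1 \<in> F" using F by (simp add: subfield_set_def subring_set_def)
  moreover obtain i where "i \<in> I" using empty by fastforce
  ultimately show ?case by (intro exI[of _ "\<lambda>_. 1"]) auto
next
  case (insert b0 B)
  have A: "subring_set F" using F by (simp add: subfield_set_def)
  note cl = subring_set_closed[OF A]
  show ?case
  proof (cases "\<forall>i\<in>I. a i b0 = 0")
    case True
    have "\<exists>c. (\<forall>i\<in>I. c i \<in> F) \<and> (\<exists>i\<in>I. c i \<noteq> 0) \<and> (\<forall>b\<in>B. (\<Sum>i\<in>I. c i * a i b) = 0)"
      using insert.prems insert.hyps by (intro insert.IH) auto
    then show ?thesis using True by auto
  next
    case False
    then obtain i0 where i0: "i0 \<in> I" "a i0 b0 \<noteq> 0" by auto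
    define I' where "I' = I - {i0}"
    \<comment> \<open>\<open>i0\<close> is the pivot of equation \<open>b0\<close>: subtracting
      \<open>r i\<close> times its column clears that equation and leaves a system with one unknown
      and one equation fewer.\<close>
    define r where "r i = a i b0 / a i0 b0" for i
    have r: "r i \<in> F" if "i \<in> I" for i
      unfolding r_def using that i0 insert.prems(3) by (intro subfield_set_divide[OF F]) auto
    have "\<exists>c. (\<forall>i\<in>I'. c i \<in> F) \<and> (\<exists>i\<in>I'. c i \<noteq> 0)
        \<and> (\<forall>b\<in>B. (\<Sum>i\<in>I'. c i * (a i b - r i * a i0 b)) = 0)"
      using insert.prems insert.hyps i0 r
      by (intro insert.IH) (auto simp: I'_def intro!: cl)
    then obtain c where c: "\<forall>i\<in>I'. c i \<in> F" "\<exists>i\<in>I'. c i \<noteq> 0"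
      "\<forall>b\<in>B. (\<Sum>i\<in>I'. c i * (a i b - r i * a i0 b)) = 0" by blast
    \<comment> \<open>Back substitution: equation \<open>b0\<close> forces the value of the pivot
      unknown.\<close>
    define d where "d i = (if i = i0 then - (\<Sum>i\<in>I'. c i * r i) else c i)" for i
    have sum_d: "(\<Sum>i\<in>I. d i * a i b) = (\<Sum>i\<in>I'. c i * (a i b - r i * a i0 b))" for b
    proof -
      have "(\<Sum>i\<in>I. d i * a i b) = d i0 * a i0 b + (\<Sum>i\<in>I'. d i * a i b)"
        unfolding I'_def using i0 insert.prems(1) by (simp add: sum.remove)
      also have "(\<Sum>i\<in>I'. d i * a i b) = (\<Sum>i\<in>I'. c i * a i b)"
        by (rule sum.cong) (auto simp: d_def I'_def)
      finally show ?thesis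
        by (simp add: d_def sum_subtractf right_diff_distrib sum_distrib_right mult.assoc)
    qed
    have "(\<Sum>i\<in>I. d i * a i b) = 0" if "b \<in> insert b0 B" for b
    proof (cases "b = b0")
      case True
      then show ?thesis using i0 by (simp add: sum_d r_def)
    qed (use that c sum_d in auto)
    moreover have "\<forall>i\<in>I. d i \<in> F"
      using c r by (auto simp: d_def I'_def intro!: cl subring_set_sum[OF A])
    moreover have "\<exists>i\<in>I. d i \<noteq> 0" using c(2) by (auto simp: d_def I'_def)
    ultimately show ?thesis by blast
  qed
qed

lemma spanned_dependent:
  assumes F: "subfield_set F" and B: "finite B" "card B \<le> n"
    and span: "\<And>i. i \<le> n \<Longrightarrow> \<exists>l. (\<forall>b\<in>B. l b \<in> F) \<and> x i = (\<Sum>b\<in>B. l b * w b)"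
  shows "\<exists>c. (\<forall>i\<le>n. c i \<in> F) \<and> (\<exists>i\<le>n. c i \<noteq> 0) \<and> (\<Sum>i\<le>n. c i * x i) = 0"
proof -
  obtain l where l: "\<And>i. i \<le> n \<Longrightarrow> (\<forall>b\<in>B. l i b \<in> F) \<and> x i = (\<Sum>b\<in>B. l i b * w b)"
    using span by metis
  have "\<exists>c. (\<forall>i\<in>{..n}. c i \<in> F) \<and> (\<exists>i\<in>{..n}. c i \<noteq> 0) \<and> (\<forall>b\<in>B. (\<Sum>i\<in>{..n}. c i * l i b) = 0)"
    using B l by (intro homogeneous_system_solution[OF F]) auto
  then obtain c where c: "\<forall>i\<le>n. c i \<in> F" "\<exists>i\<le>n. c i \<noteq> 0" "\<forall>b\<in>B. (\<Sum>i\<le>n. c i * l i b) = 0" by auto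
  have "(\<Sum>i\<le>n. c i * x i) = (\<Sum>i\<le>n. \<Sum>b\<in>B. c i * l i b * w b)"
    by (rule sum.cong) (auto simp: l sum_distrib_left mult.assoc)
  also have "\<dots> = (\<Sum>b\<in>B. (\<Sum>i\<le>n. c i * l i b) * w b)"
    by (subst sum.swap) (simp add: sum_distrib_right)
  also have "\<dots> = 0" using c by simp
  finally show ?thesis using c by blast
qed

section \<open>Finiteness over rational subfields\<close>

definition Fp :: "'k::field set" where
  "Fp = range of_int"

definition transc :: "'k::field \<Rightarrow> bool" where
  "transc s \<longleftrightarrow> (\<forall>b n. (\<forall>i. b i \<in> Fp) \<longrightarrow> (\<Sum>i\<le>n. b i * s ^ i) = 0 \<longrightarrow> (\<forall>i\<le>n. b i = 0))"

lemma transcD: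
  assumes "transc s" "\<And>i. i \<le> n \<Longrightarrow> b i \<in> Fp" "(\<Sum>i\<le>n. b i * s ^ i) = 0" "i \<le> n"
  shows "b i = 0"
proof -
  define b' where "b' i = (if i \<le> n then b i else 0)" for i
  have "(\<Sum>i\<le>n. b' i * s ^ i) = (\<Sum>i\<le>n. b i * s ^ i)"
    by (rule sum.cong) (auto simp: b'_def)
  moreover have "b' i \<in> Fp" for i
    using assms(2)[of i] by (auto simp: b'_def Fp_def intro: range_eqI[of _ _ 0])
  ultimately have "b' i = 0"
    using assms(1)[unfolded transc_def, rule_format, of b' n i] assms(3,4) by simp
  then show ?thesis using assms(4) by (simp add: b'_def)
qed

lemma Fp_sequence:
  assumes "\<forall>i. b i \<in> (Fp :: 'k::field set)"
  shows "\<exists>c. \<forall>i. b i = of_int (c i)"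
  by (rule choice) (use assms in \<open>auto simp: Fp_def\<close>)

lemma subring_Fp: "subring_set (Fp :: 'k::field set)"
  unfolding subring_set_def Fp_def
  by (auto simp flip: of_int_diff of_int_mult intro: range_eqI[of _ _ 1])

text \<open>The span \<open>U\<close> of the powers of t below the degree of the relation is stable
  under multiplication by t, hence contains F[t]. Finite dimension makes the powers of each x
  dependent, and a dependence divided by its lowest power of x exhibits the inverse of x.\<close>

lemma algebraic_adjoin:
  fixes F :: "'k::field set"
  assumes F: "subfield_set F"
    and rel: "\<forall>j\<le>m. a j \<in> F" "\<exists>j\<le>m. a j \<noteq> 0" "(\<Sum>j\<le>m. a j * t ^ j) = 0"
  shows "subfield_set (adjoin F t)"
    and "\<exists>d. \<forall>x\<in>adjoin F t. \<exists>u. (\<forall>j<d. u j \<in> F) \<and> x = (\<Sum>j<d. u j * t ^ j)"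
proof -
  have A: "subring_set F" using F by (simp add: subfield_set_def)
  note cl = subring_set_closed[OF A]
  have inv: "inverse x \<in> F" if "x \<in> F" for x using F that by (simp add: subfield_set_def)
  \<comment> \<open>Top coefficients of the relation may vanish; the true degree is needed in order
    to solve for t^d.\<close>
  define d where "d = (GREATEST j. j \<le> m \<and> a j \<noteq> 0)"
  have d: "d \<le> m" "a d \<noteq> 0"
    using GreatestI_ex_nat[of "\<lambda>j. j \<le> m \<and> a j \<noteq> 0" m] rel(2) by (auto simp: d_def)
  have top: "a j = 0" if "d < j" "j \<le> m" for j
    using Greatest_le_nat[of "\<lambda>j. j \<le> m \<and> a j \<noteq> 0" j m] that by (auto simp: d_def)
  have "(\<Sum>j\<le>m. a j * t ^ j) = (\<Sum>j\<le>d. a j * t ^ j)"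
    using d top by (intro sum.mono_neutral_right) auto
  then have "(\<Sum>j<d. a j * t ^ j) + a d * t ^ d = 0"
    using rel(3) by (simp add: lessThan_Suc_atMost[symmetric])
  then have "inverse (a d) * (a d * t ^ d) = inverse (a d) * - (\<Sum>j<d. a j * t ^ j)"
    by (simp add: add_eq_0_iff2)
  then have td: "t ^ d = (\<Sum>j<d. (- (inverse (a d) * a j)) * t ^ j)"
    using d(2) by (simp add: sum_negf sum_distrib_left mult.assoc[symmetric])
  define U where "U = {(\<Sum>j<d. u j * t ^ j) | u. \<forall>j<d. u j \<in> F}"
  have U_add: "x + y \<in> U" if "x \<in> U" "y \<in> U" for x y
  proof -
    obtain u w where "x = (\<Sum>j<d. u j * t ^ j)" "\<forall>j<d. u j \<in> F" "y = (\<Sum>j<d. w j * t ^ j)" "\<forall>j<d. w j \<in> F"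
      using \<open>x \<in> U\<close> \<open>y \<in> U\<close> unfolding U_def by blast
    then show ?thesis unfolding U_def
      by (intro CollectI exI[of _ "\<lambda>j. u j + w j"]) (auto simp: sum.distrib distrib_right intro: cl)
  qed
  have U_smult: "c * x \<in> U" if "c \<in> F" "x \<in> U" for c x
  proof -
    obtain u where "x = (\<Sum>j<d. u j * t ^ j)" "\<forall>j<d. u j \<in> F" using \<open>x \<in> U\<close> unfolding U_def by blast
    then show ?thesis unfolding U_def
      using that by (intro CollectI exI[of _ "\<lambda>j. c * u j"]) (auto simp: sum_distrib_left mult.assoc intro: cl)
  qed
  have U_0: "0 \<in> U" unfolding U_def by (intro CollectI exI[of _ "\<lambda>_. 0"]) (auto intro: cl)
  have td_U: "t ^ d \<in> U"
    unfolding U_def td using rel(1) d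
    by (intro CollectI exI[of _ "\<lambda>j. - (inverse (a d) * a j)"]) (auto intro!: cl inv)
  have U_t: "t * x \<in> U" if "x \<in> U" for x
  proof (cases d)
    case 0
    then have "x = 0" using that by (auto simp: U_def)
    then show ?thesis using U_0 by simp
  next
    case (Suc d')
    obtain u where u: "x = (\<Sum>j<d. u j * t ^ j)" "\<forall>j<d. u j \<in> F" using \<open>x \<in> U\<close> unfolding U_def by blast
    have "t * x = (\<Sum>j<d'. u j * t ^ Suc j) + u d' * t ^ d"
      by (simp add: u Suc sum_distrib_left algebra_simps)
    also have "(\<Sum>j<d'. u j * t ^ Suc j) = (\<Sum>j<d. (case j of 0 \<Rightarrow> 0 | Suc i \<Rightarrow> u i) * t ^ j)"
      unfolding Suc by (subst sum.lessThan_Suc_shift) simp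
    finally have "t * x = (\<Sum>j<d. (case j of 0 \<Rightarrow> 0 | Suc i \<Rightarrow> u i) * t ^ j) + u d' * t ^ d" .
    moreover have "(\<Sum>j<d. (case j of 0 \<Rightarrow> 0 | Suc i \<Rightarrow> u i) * t ^ j) \<in> U"
      unfolding U_def by (rule CollectI, rule exI, rule conjI[OF refl]) (use u in \<open>auto intro: cl split: nat.split\<close>)
    moreover have "u d' * t ^ d \<in> U" using u Suc by (intro U_smult td_U) auto
    ultimately show ?thesis using U_add by simp
  qed
  have one_U: "1 \<in> U"
  proof (cases d)
    case 0
    then show ?thesis using td_U by simp
  next
    case (Suc d')
    have "1 = (\<Sum>j<d. (if j = 0 then 1 else 0) * t ^ j)"
      unfolding Suc by (subst sum.lessThan_Suc_shift) simp
    then show ?thesis unfolding U_def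
      by (intro CollectI exI[of _ "\<lambda>j. if j = 0 then 1 else 0"]) (auto intro: cl)
  qed
  have pow_U: "t ^ k \<in> U" for k by (induction k) (auto intro: one_U U_t)
  have adj_U: "adjoin F t \<subseteq> U"
  proof
    fix x assume "x \<in> adjoin F t"
    then obtain b n where b: "x = (\<Sum>i\<le>n. b i * t ^ i)" "\<forall>i. b i \<in> F" by (auto simp: adjoin_def)
    have "(\<Sum>i\<in>I. b i * t ^ i) \<in> U" for I
      by (induction I rule: infinite_finite_induct) (use b in \<open>auto intro: U_0 U_add U_smult pow_U\<close>)
    then show "x \<in> U" using b by simp
  qed
  then show "\<exists>d. \<forall>x\<in>adjoin F t. \<exists>u. (\<forall>j<d. u j \<in> F) \<and> x = (\<Sum>j<d. u j * t ^ j)"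
    by (intro exI[of _ d]) (auto simp: U_def)
  have "inverse x \<in> adjoin F t" if x: "x \<in> adjoin F t" for x
  proof (cases "x = 0")
    case True
    then show ?thesis using x by simp
  next
    case False
    have xi: "x ^ i \<in> U" for i
      using x adj_U subring_set_closed(7)[OF subring_adjoin[OF A]] by blast
    have "\<exists>c. (\<forall>i\<le>d. c i \<in> F) \<and> (\<exists>i\<le>d. c i \<noteq> 0) \<and> (\<Sum>i\<le>d. c i * x ^ i) = 0"
    proof (rule spanned_dependent[OF F, of "{..<d}" d _ "\<lambda>j. t ^ j"])
      fix i
      show "\<exists>l. (\<forall>b\<in>{..<d}. l b \<in> F) \<and> x ^ i = (\<Sum>b<d. l b * t ^ b)"
        using xi[of i] by (auto simp: U_def)
    qed auto
    then obtain c where c: "\<forall>i\<le>d. c i \<in> F" "\<exists>i\<le>d. c i \<noteq> 0" "(\<Sum>i\<le>d. c i * x ^ i) = 0" by blast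
    \<comment> \<open>After cancellation of x^k the dependence has an invertible constant term, so x
      times an element of F[t] equals a nonzero constant of F.\<close>
    define k where "k = (LEAST i. i \<le> d \<and> c i \<noteq> 0)"
    have k: "k \<le> d" "c k \<noteq> 0" using LeastI_ex[OF c(2)] by (auto simp: k_def)
    have low: "c i = 0" if "i < k" for i using not_less_Least[of i "\<lambda>i. i \<le> d \<and> c i \<noteq> 0"] that k by (auto simp: k_def)
    have "(\<Sum>i\<le>d. c i * x ^ i) = (\<Sum>i\<in>{k..d}. c i * x ^ i)"
      using low by (intro sum.mono_neutral_right) auto
    also have "\<dots> = c k * x ^ k + (\<Sum>i\<in>{Suc k..d}. c i * x ^ i)"
      using k by (simp add: sum.atLeast_Suc_atMost)
    also have "(\<Sum>i\<in>{Suc k..d}. c i * x ^ i) = x ^ k * (x * (\<Sum>i\<in>{Suc k..d}. c i * x ^ (i - Suc k)))"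
      unfolding sum_distrib_left
    proof (rule sum.cong[OF refl])
      fix i assume "i \<in> {Suc k..d}"
      then have "x ^ i = x ^ (k + (1 + (i - Suc k)))" by simp
      also have "\<dots> = x ^ k * (x * x ^ (i - Suc k))" by (simp only: power_add power_one_right)
      finally show "c i * x ^ i = x ^ k * (x * (c i * x ^ (i - Suc k)))" by simp
    qed
    finally have "x ^ k * (c k + x * (\<Sum>i\<in>{Suc k..d}. c i * x ^ (i - Suc k))) = 0"
      using c(3) by (simp add: algebra_simps)
    then have "c k + x * (\<Sum>i\<in>{Suc k..d}. c i * x ^ (i - Suc k)) = 0" using False by simp
    then have "x * (- (inverse (c k) * (\<Sum>i\<in>{Suc k..d}. c i * x ^ (i - Suc k)))) = 1"
      using k(2) by (simp add: field_simps add_eq_0_iff2)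
    then have "inverse x = - (inverse (c k) * (\<Sum>i\<in>{Suc k..d}. c i * x ^ (i - Suc k)))"
      by (metis inverse_unique)
    also have "\<dots> \<in> adjoin F t"
    proof -
      note cl' = subring_set_closed[OF subring_adjoin[OF A]]
      have *: "(\<Sum>i\<in>{Suc k..d}. c i * x ^ (i - Suc k)) \<in> adjoin F t"
        by (rule subring_set_sum[OF subring_adjoin[OF A]])
          (use c x in \<open>auto intro!: cl' intro: adjoin_extends[OF A]\<close>)
      have "inverse (c k) \<in> adjoin F t" using c k by (auto intro!: adjoin_extends[OF A] inv)
      then show ?thesis using * by (intro cl'(5) cl'(4))
    qed
    finally show ?thesis .
  qed
  then show "subfield_set (adjoin F t)" using subring_adjoin[OF A] by (auto simp: subfield_set_def)
qed

locale global_field =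
  fixes K :: "'k::field itself" and p :: nat
  assumes gff: "global_function_field K p"
begin

lemma prime_p: "prime p"
  using gff unfolding global_function_field_def by (rule conjunct1)

lemma char_p [simp]: "of_nat p = (0::'k)"
  using gff unfolding global_function_field_def by (elim conjE)

lemma subfield_Fp: "subfield_set (Fp :: 'k set)"
proof -
  have "inverse x \<in> Fp" if x: "x \<in> Fp" for x :: 'k
  proof (cases "x = 0")
    case False
    obtain c where c: "x = of_int c" using x by (auto simp: Fp_def)
    have "\<not> int p dvd c" using False c by (auto simp: dvd_def)
    then have "coprime (int p) c" using prime_p by (intro prime_imp_coprime) auto
    then obtain u w where "u * int p + w * c = 1" using bezout_int[of "int p" c] by auto
    then have "of_int (u * int p + w * c) = (1::'k)" by simp
    then have "of_int w * x = 1" using c by simp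
    then have "inverse x = of_int w" using inverse_unique[of x "of_int w"] by (simp add: mult.commute)
    then show ?thesis by (auto simp: Fp_def)
  qed (use x in auto)
  then show ?thesis using subring_Fp by (auto simp: subfield_set_def)
qed

lemma finite_Fp: "finite (Fp :: 'k set)"
proof -
  have "Fp \<subseteq> (of_int ` {0..<int p} :: 'k set)"
  proof
    fix x :: 'k assume "x \<in> Fp"
    then obtain c where c: "x = of_int c" by (auto simp: Fp_def)
    have "(of_int c :: 'k) = of_int (int p * (c div int p) + c mod int p)" by simp
    also have "\<dots> = of_int (c mod int p)" by (simp only: of_int_add of_int_mult) simp
    finally have "x = of_int (c mod int p)" using c by simp
    then show "x \<in> of_int ` {0..<int p}"
      using prime_gt_0_nat[OF prime_p] by (intro image_eqI[of _ _ "c mod int p"]) auto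
  qed
  then show ?thesis by (rule finite_subset) simp
qed

lemma Fp_poly_vals_eq: "Fp_poly_vals t = adjoin Fp (t::'k)"
proof
  show "Fp_poly_vals t \<subseteq> adjoin Fp t" 
  proof
    fix x assume "x \<in> Fp_poly_vals t"
    then obtain c n where "x = (\<Sum>i\<le>n. of_int (c i) * t ^ i)" by (auto simp: Fp_poly_vals_def)
    moreover have "(\<Sum>i\<le>n. of_int (c i) * t ^ i) \<in> adjoin Fp t"
      by (rule adjoinI[OF subring_Fp]) (simp add: Fp_def)
    ultimately show "x \<in> adjoin Fp t" by simp
  qed
  show "adjoin Fp t \<subseteq> Fp_poly_vals t"
  proof
    fix x assume "x \<in> adjoin Fp t"
    then obtain b n where b: "x = (\<Sum>i\<le>n. b i * t ^ i)" "\<forall>i. b i \<in> Fp" by (auto simp: adjoin_def)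
    obtain c where "\<forall>i. b i = of_int (c i)" using Fp_sequence[OF b(2)] by (rule exE)
    then show "x \<in> Fp_poly_vals t" using b by (auto simp: Fp_poly_vals_def)
  qed
qed

lemma transc_basis_ex:
  "\<exists>t::'k. \<exists>B. transc t \<and> finite B \<and>
     (\<forall>x. \<exists>l. (\<forall>b\<in>B. l b \<in> fracs (adjoin Fp t)) \<and> x = (\<Sum>b\<in>B. l b * b))"
proof -
  have "\<exists>t::'k. (\<forall>(c :: nat \<Rightarrow> int) n. (\<Sum>i\<le>n. of_int (c i) * t ^ i) = 0 \<longrightarrow> (\<forall>i\<le>n. int p dvd c i)) \<and>
      (\<exists>B. finite B \<and> (\<forall>x. \<exists>l. (\<forall>b\<in>B. l b \<in> Fp_rat_field t) \<and> x = (\<Sum>b\<in>B. l b * b)))"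
    by (rule conjunct2[OF conjunct2[OF gff[unfolded global_function_field_def]]])
  then obtain t :: 'k where
    *: "(\<forall>(c :: nat \<Rightarrow> int) n. (\<Sum>i\<le>n. of_int (c i) * t ^ i) = 0 \<longrightarrow> (\<forall>i\<le>n. int p dvd c i)) \<and>
      (\<exists>B. finite B \<and> (\<forall>x. \<exists>l. (\<forall>b\<in>B. l b \<in> Fp_rat_field t) \<and> x = (\<Sum>b\<in>B. l b * b)))"
    by (rule exE)
  note t = conjunct1[OF *]
  from conjunct2[OF *] obtain B where B: "finite B" "\<forall>x. \<exists>l. (\<forall>b\<in>B. l b \<in> Fp_rat_field t) \<and> x = (\<Sum>b\<in>B. l b * b)"
    by (elim conjE exE)
  have "transc t"
    unfolding transc_def
  proof (intro allI impI)
    fix b :: "nat \<Rightarrow> 'k" and n i assume b: "\<forall>i. b i \<in> Fp" and z: "(\<Sum>i\<le>n. b i * t ^ i) = 0" and i: "i \<le> n"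
    obtain c where c: "\<forall>i. b i = of_int (c i)" using Fp_sequence[OF b] by (rule exE)
    then have "int p dvd c i" using t[rule_format, of c n i] z i by simp
    then obtain k where "c i = int p * k" by (auto simp: dvd_def)
    then show "b i = 0" using c by simp
  qed
  moreover have "Fp_rat_field t = fracs (adjoin Fp t)"
    by (simp add: Fp_rat_field_def fracs_def Fp_poly_vals_eq)
  ultimately show ?thesis using B by auto
qed

text \<open>An exchange argument: K is finite over F_p(s) for every transcendental s, not only for
  the t of the definition, because s algebraic over F_p(t) makes t algebraic over F_p(s). The
  coefficients are taken in the ring F_p[s] rather than in its fraction field since their poles can
  then be controlled.\<close>

lemma transc_finite_degree:
  fixes s :: 'k
  assumes s: "transc s"
  shows "\<exists>n. \<forall>x :: nat \<Rightarrow> 'k. \<exists>c. (\<forall>i\<le>n. c i \<in> adjoin Fp s) \<and> (\<exists>i\<le>n. c i \<noteq> 0) \<and> (\<Sum>i\<le>n. c i * x i) = 0"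
proof -
  obtain t :: 'k and B where "transc t \<and> finite B \<and>
     (\<forall>x. \<exists>l. (\<forall>b\<in>B. l b \<in> fracs (adjoin Fp t)) \<and> x = (\<Sum>b\<in>B. l b * b))"
    using transc_basis_ex by (elim exE)
  then have tr: "transc t" and B: "finite B"
    and span: "\<And>x. \<exists>l. (\<forall>b\<in>B. l b \<in> fracs (adjoin Fp t)) \<and> x = (\<Sum>b\<in>B. l b * b)"
    by simp_all
  have At: "subring_set (adjoin Fp t)" and As: "subring_set (adjoin Fp s)"
    by (simp_all add: subring_adjoin subring_Fp)
  have clear: "\<exists>c'. (\<forall>i\<le>n. c' i \<in> A) \<and> (\<exists>i\<le>n. c' i \<noteq> 0) \<and> (\<Sum>i\<le>n. c' i * x i) = 0"
    if A: "subring_set A" and c: "\<forall>i\<le>n. c i \<in> fracs A" "\<exists>i\<le>n. c i \<noteq> 0" "(\<Sum>i\<le>n. c i * x i) = 0"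
    for A and c x :: "nat \<Rightarrow> 'k" and n
  proof -
    obtain D where D: "D \<in> A" "D \<noteq> 0" "\<forall>i\<in>{..n}. D * c i \<in> A"
      using fracs_common_denominator[OF A, of "{..n}" c] c by auto
    have "(\<Sum>i\<le>n. (D * c i) * x i) = D * (\<Sum>i\<le>n. c i * x i)"
      by (simp add: sum_distrib_left mult.assoc)
    then show ?thesis using D c by (intro exI[of _ "\<lambda>i. D * c i"]) auto
  qed
  define n where "n = card B"
  have "\<exists>c. (\<forall>i\<le>n. c i \<in> fracs (adjoin Fp t)) \<and> (\<exists>i\<le>n. c i \<noteq> 0) \<and> (\<Sum>i\<le>n. c i * s ^ i) = 0"
    by (rule spanned_dependent[OF subfield_fracs[OF At] B, of n _ id]) (use span in \<open>auto simp: n_def\<close>)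
  then obtain c0 where c0: "\<forall>i\<le>n. c0 i \<in> fracs (adjoin Fp t)" "\<exists>i\<le>n. c0 i \<noteq> 0" "(\<Sum>i\<le>n. c0 i * s ^ i) = 0"
    by blast
  obtain c where c: "\<forall>i\<le>n. c i \<in> adjoin Fp t" "\<exists>i\<le>n. c i \<noteq> 0" "(\<Sum>i\<le>n. c i * s ^ i) = 0"
    using clear[OF At c0] by blast
  obtain b' M where "\<forall>i\<le>n. c i = (\<Sum>j\<le>M. b' i j * t ^ j) \<and> (\<forall>j. b' i j \<in> Fp)"
    using adjoin_common_degree[OF subring_Fp c(1)] by (elim exE)
  then have cb: "\<And>i. i \<le> n \<Longrightarrow> c i = (\<Sum>j\<le>M. b' i j * t ^ j)" and b'F: "\<And>i j. i \<le> n \<Longrightarrow> b' i j \<in> Fp"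
    by blast+
  \<comment> \<open>The relation of s over F_p[t], regrouped by powers of t, is a relation of t over
    F_p[s].\<close>
  define a where "a j = (\<Sum>i\<le>n. b' i j * s ^ i)" for j
  have "(\<Sum>j\<le>M. a j * t ^ j) = (\<Sum>j\<le>M. \<Sum>i\<le>n. b' i j * t ^ j * s ^ i)"
    by (simp add: a_def sum_distrib_right mult.assoc mult.commute[of "s ^ _"])
  also have "\<dots> = (\<Sum>i\<le>n. \<Sum>j\<le>M. b' i j * t ^ j * s ^ i)" by (rule sum.swap)
  also have "\<dots> = (\<Sum>i\<le>n. c i * s ^ i)" by (rule sum.cong) (auto simp: cb sum_distrib_right)
  finally have a0: "(\<Sum>j\<le>M. a j * t ^ j) = 0" using c by simp
  have aF: "a j \<in> adjoin Fp s" for j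
    unfolding a_def using b'F by (intro adjoinI[OF subring_Fp]) auto
  \<comment> \<open>If every regrouped coefficient were zero, transcendence of s would kill all
    \<open>b' i j\<close> and with them the original relation.\<close>
  have anz: "\<exists>j\<le>M. a j \<noteq> 0"
  proof (rule ccontr)
    assume H: "\<not> ?thesis"
    have "b' i j = 0" if "i \<le> n" "j \<le> M" for i j
      using transcD[OF s, of n "\<lambda>i. b' i j" i] b'F that H by (auto simp: a_def)
    then have "c i = 0" if "i \<le> n" for i using that by (simp add: cb)
    then show False using c(2) by auto
  qed
  define F where "F = fracs (adjoin Fp s)"
  have F: "subfield_set F" and FA: "subring_set F" using subfield_fracs[OF As] by (auto simp: F_def subfield_set_def)
  have AF: "adjoin Fp s \<subseteq> F" unfolding F_def using fracs_extends[OF As] by blast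
  have E: "subfield_set (adjoin F t)"
    and "\<exists>d. \<forall>x\<in>adjoin F t. \<exists>u. (\<forall>j<d. u j \<in> F) \<and> x = (\<Sum>j<d. u j * t ^ j)"
    using algebraic_adjoin[OF F _ anz a0] aF AF by blast+
  then obtain d where d: "\<And>x. x \<in> adjoin F t \<Longrightarrow> \<exists>u. (\<forall>j<d. u j \<in> F) \<and> x = (\<Sum>j<d. u j * t ^ j)"
    by blast
  have ER: "subring_set (adjoin F t)" using E by (simp add: subfield_set_def)
  have "Fp \<subseteq> adjoin F t"
    using AF adjoin_extends[OF subring_Fp] adjoin_extends[OF FA] by blast
  then have "adjoin Fp t \<subseteq> adjoin F t"
    using adjoin_subset[OF ER _ adjoin_generator[OF FA]] by blast
  then have FtE: "fracs (adjoin Fp t) \<subseteq> adjoin F t"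
    using subfield_set_divide[OF E] by (auto simp: fracs_def)
  \<comment> \<open>Generators of K over F_p(t) times powers of t below its degree over F span K
    over F.\<close>
  define N where "N = card (B \<times> {..<d})"
  have spanF: "\<exists>l. (\<forall>z\<in>B\<times>{..<d}. l z \<in> F) \<and> x = (\<Sum>z\<in>B\<times>{..<d}. l z * (t ^ snd z * fst z))" for x
  proof -
    obtain l where l: "\<forall>b\<in>B. l b \<in> fracs (adjoin Fp t)" "x = (\<Sum>b\<in>B. l b * b)" using span by blast
    have "\<forall>b\<in>B. \<exists>u. (\<forall>j<d. u j \<in> F) \<and> l b = (\<Sum>j<d. u j * t ^ j)" using l(1) FtE d by blast
    then obtain u where u: "\<And>b. b \<in> B \<Longrightarrow> (\<forall>j<d. u b j \<in> F) \<and> l b = (\<Sum>j<d. u b j * t ^ j)" by metis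
    have "x = (\<Sum>b\<in>B. \<Sum>j<d. u b j * (t ^ j * b))"
      unfolding l(2) by (rule sum.cong) (auto simp: u sum_distrib_right mult.assoc)
    also have "\<dots> = (\<Sum>z\<in>B\<times>{..<d}. u (fst z) (snd z) * (t ^ snd z * fst z))"
      by (simp add: sum.cartesian_product case_prod_beta)
    finally show ?thesis using u by (intro exI[of _ "\<lambda>z. u (fst z) (snd z)"]) auto
  qed
  have "\<exists>c. (\<forall>i\<le>N. c i \<in> adjoin Fp s) \<and> (\<exists>i\<le>N. c i \<noteq> 0) \<and> (\<Sum>i\<le>N. c i * x i) = 0" for x :: "nat \<Rightarrow> 'k"
  proof -
    have "\<exists>c. (\<forall>i\<le>N. c i \<in> F) \<and> (\<exists>i\<le>N. c i \<noteq> 0) \<and> (\<Sum>i\<le>N. c i * x i) = 0"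
      by (rule spanned_dependent[OF F, of "B \<times> {..<d}" N x "\<lambda>z. t ^ snd z * fst z"]) (use B spanF in \<open>auto simp: N_def\<close>)
    then obtain c where "\<forall>i\<le>N. c i \<in> fracs (adjoin Fp s)" "\<exists>i\<le>N. c i \<noteq> 0" "(\<Sum>i\<le>N. c i * x i) = 0"
      unfolding F_def by blast
    then show ?thesis by (rule clear[OF As])
  qed
  then show ?thesis by blast
qed

end

section \<open>Valuations and maximal subrings\<close>

lemma place_mult: "is_place v \<Longrightarrow> x \<noteq> 0 \<Longrightarrow> y \<noteq> 0 \<Longrightarrow> v (x * y) = v x + v y"
  by (simp add: is_place_def)

lemma place_0: "is_place v \<Longrightarrow> v 0 = 0"
  by (simp add: is_place_def)

lemma place_uniformizer: "is_place v \<Longrightarrow> \<exists>x. x \<noteq> 0 \<and> v x = 1"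
  unfolding is_place_def by blast

lemma place_add: "is_place v \<Longrightarrow> x \<noteq> 0 \<Longrightarrow> y \<noteq> 0 \<Longrightarrow> x + y \<noteq> 0 \<Longrightarrow> min (v x) (v y) \<le> v (x + y)"
  unfolding is_place_def by blast

lemma place_1: "is_place v \<Longrightarrow> v 1 = 0"
  using place_mult[of v 1 1] by simp

lemma place_inverse: "is_place v \<Longrightarrow> v (inverse x) = - v x"
  using place_mult[of v x "inverse x"] by (cases "x = 0") (auto simp: place_1 place_0)

lemma place_divide: "is_place v \<Longrightarrow> x \<noteq> 0 \<Longrightarrow> y \<noteq> 0 \<Longrightarrow> v (x / y) = v x - v y"
  using place_mult[of v x "inverse y"] by (simp add: place_inverse divide_inverse)

lemma place_power: "is_place v \<Longrightarrow> v (x ^ n) = int n * v x"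
  by (cases "x = 0"; induction n) (auto simp: place_1 place_mult place_0 algebra_simps)

lemma place_powi: "is_place v \<Longrightarrow> v (x powi n) = n * v x"
  by (cases "n \<ge> 0") (auto simp: power_int_def place_power place_inverse)

lemma place_minus: "is_place v \<Longrightarrow> v (- x) = v x"
proof -
  assume v: "is_place v"
  have "2 * v (- 1) = 0" using place_mult[OF v, of "-1" "-1"] place_1[OF v] by simp
  then show ?thesis using place_mult[OF v, of "-1" x] by (cases "x = 0") auto
qed

lemma vge_0 [simp]: "vge v 0 N"
  by (simp add: vge_def)

lemma vge_mono: "vge v x N \<Longrightarrow> M \<le> N \<Longrightarrow> vge v x M"
  by (auto simp: vge_def)

lemma vge_self [simp]: "vge v x (v x)"
  by (simp add: vge_def)

lemma vge_1: "is_place v \<Longrightarrow> vge v 1 0"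
  by (simp add: vge_def place_1)

lemma vge_add: "is_place v \<Longrightarrow> vge v x N \<Longrightarrow> vge v y N \<Longrightarrow> vge v (x + y) N"
  using place_add[of v x y] unfolding vge_def
  by (cases "x = 0"; cases "y = 0"; cases "x + y = 0") auto

lemma vge_minus: "is_place v \<Longrightarrow> vge v (- x) N \<longleftrightarrow> vge v x N"
  by (simp add: vge_def place_minus)

lemma vge_diff: "is_place v \<Longrightarrow> vge v x N \<Longrightarrow> vge v y N \<Longrightarrow> vge v (x - y) N"
  using vge_add[of v x N "- y"] by (simp add: vge_minus)

lemma vge_commute: "is_place v \<Longrightarrow> vge v (x - y) N \<longleftrightarrow> vge v (y - x) N"
  using vge_minus[of v "x - y" N] by simp

lemma vge_mult: "is_place v \<Longrightarrow> vge v x M \<Longrightarrow> vge v y N \<Longrightarrow> vge v (x * y) (M + N)"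
  by (cases "x = 0"; cases "y = 0") (auto simp: vge_def place_mult)

lemma vge_mult_iff: "is_place v \<Longrightarrow> x \<noteq> 0 \<Longrightarrow> vge v (x * y) N \<longleftrightarrow> vge v y (N - v x)"
  by (cases "y = 0") (auto simp: vge_def place_mult)

lemma vge_sum:
  assumes v: "is_place v" and "\<And>i. i \<in> I \<Longrightarrow> vge v (f i) N"
  shows "vge v (sum f I) N"
  using assms(2) by (induction I rule: infinite_finite_induct) (auto intro: vge_add[OF v])

lemma vge_power:
  assumes v: "is_place v" and "vge v x 0"
  shows "vge v (x ^ n) 0"
  using assms(2) by (auto simp: vge_def place_power[OF v] place_0[OF v])

text \<open>The strict triangle inequality. Most non-vanishing arguments below single out one term
  of strictly least value.\<close>

lemma place_add_dominant:
  assumes v: "is_place v" and x: "x \<noteq> 0" and y: "vge v y (v x + 1)"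
  shows "x + y \<noteq> 0" "v (x + y) = v x"
proof -
  show nz: "x + y \<noteq> 0"
  proof
    assume "x + y = 0"
    then have "y = - x" by (simp add: add_eq_0_iff2)
    then show False using y x by (simp add: vge_def place_minus[OF v])
  qed
  have "vge v (x + y) (v x)" using y vge_mono[OF y, of "v x"] by (intro vge_add[OF v]) auto
  then have 1: "v x \<le> v (x + y)" using nz by (simp add: vge_def)
  have "\<not> vge v (x + y) (v x + 1)"
    using vge_diff[OF v, of "x + y" "v x + 1" y] y x by (auto simp: vge_def)
  then show "v (x + y) = v x" using 1 nz by (auto simp: vge_def)
qed

lemma place_sum_dominant:
  assumes v: "is_place v" and I: "finite I" "i \<in> I" and x: "f i \<noteq> 0"
    and y: "\<And>j. j \<in> I \<Longrightarrow> j \<noteq> i \<Longrightarrow> vge v (f j) (v (f i) + 1)"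
  shows "sum f I \<noteq> 0"
proof -
  have "sum f I = f i + sum f (I - {i})" using I by (simp add: sum.remove)
  moreover have "vge v (sum f (I - {i})) (v (f i) + 1)" using y by (intro vge_sum[OF v]) auto
  ultimately show ?thesis using place_add_dominant(1)[OF v x] by simp
qed

context global_field
begin

text \<open>A nonzero constant and its inverse are both images of integers, and these have
  non-negative value.\<close>

lemma place_Fp:
  fixes c :: 'k
  assumes v: "is_place v" and c: "c \<in> Fp"
  shows "v c = 0"
proof (cases "c = 0")
  case False
  have nonneg: "vge v (of_int m :: 'k) 0" for m
  proof -
    have n: "vge v (of_nat n :: 'k) 0" for n
      by (induction n) (auto intro: vge_add[OF v] vge_1[OF v])
    show ?thesis
      using n[of "nat m"] n[of "nat (- m)"] vge_minus[OF v, of "of_int m" 0]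
      by (cases "m \<ge> 0") auto
  qed
  have "vge v c 0" using nonneg c by (auto simp: Fp_def)
  moreover have "inverse c \<in> Fp" using c subfield_Fp by (auto simp: subfield_set_def)
  then have "vge v (inverse c) 0" using nonneg by (auto simp: Fp_def)
  ultimately show ?thesis using False by (auto simp: vge_def place_inverse[OF v])
qed (simp add: place_0[OF v])

lemma vge_Fp: "is_place v \<Longrightarrow> (c::'k) \<in> Fp \<Longrightarrow> vge v c 0"
  by (simp add: vge_def place_Fp)

text \<open>The nonzero terms of a polynomial in s over F_p have the pairwise distinct values j
  v(s), so one of them dominates the sum.\<close>

lemma transc_if_place:
  fixes s :: 'k
  assumes v: "is_place v" and s: "v s \<noteq> 0"
  shows "transc s"
  unfolding transc_def
proof (intro allI impI)
  fix b :: "nat \<Rightarrow> 'k" and n i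
  assume b: "\<forall>i. b i \<in> Fp" and z: "(\<Sum>i\<le>n. b i * s ^ i) = 0" and i: "i \<le> n"
  have s0: "s \<noteq> 0" using s place_0[OF v] by auto
  have val: "v (b j * s ^ j) = int j * v s" if "b j \<noteq> 0" for j
    using that s0 b by (simp add: place_mult[OF v] place_power[OF v] place_Fp[OF v])
  show "b i = 0"
  proof (rule ccontr)
    assume nz: "b i \<noteq> 0"
    define J where "J = {j. j \<le> n \<and> b j \<noteq> 0}"
    have J: "finite J" "J \<noteq> {}" using i nz by (auto simp: J_def)
    \<comment> \<open>Least value means the lowest index if v(s) > 0 and the highest if v(s) < 0;
      choosing by value treats both signs at once.\<close>
    obtain j where j: "j \<in> J" "\<And>l. l \<in> J \<Longrightarrow> int j * v s \<le> int l * v s"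
      using J by (meson arg_min_least arg_min_if_finite(1) finite_imageI)
    have "(\<Sum>i\<le>n. b i * s ^ i) \<noteq> 0"
    proof (rule place_sum_dominant[OF v, of _ j])
      fix l assume l: "l \<in> {..n}" "l \<noteq> j"
      show "vge v (b l * s ^ l) (v (b j * s ^ j) + 1)"
      proof (cases "b l = 0")
        case False
        then have lJ: "l \<in> J" using l by (auto simp: J_def)
        have "int j * v s \<noteq> int l * v s" using l s by auto
        then have "int j * v s < int l * v s" using j(2)[OF lJ] by (rule le_neq_trans[rotated])
        moreover have "b j \<noteq> 0" using j(1) by (simp add: J_def)
        ultimately show ?thesis using val[OF False] val[of j] by (simp add: vge_def)
      qed simp
    qed (use j s0 in \<open>auto simp: J_def\<close>)
    then show False using z by simp
  qed
qed

end

section \<open>Chevalley's construction of valuation rings\<close>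

text \<open>Omitting \<open>z\<close> passes to unions of chains, so Zorn's lemma applies. Keeping
  1/z inside and z outside replaces the choice of a maximal ideal: it keeps 1/z a non-unit.\<close>

lemma Chevalley_maximal:
  fixes A :: "'k::field set"
  assumes A: "subring_set A" and u: "inverse z \<in> A" and z: "z \<notin> A"
  shows "\<exists>B. subring_set B \<and> A \<subseteq> B \<and> z \<notin> B \<and> (\<forall>C. subring_set C \<longrightarrow> B \<subseteq> C \<longrightarrow> z \<notin> C \<longrightarrow> C = B)"
proof -
  define P where "P = {C. subring_set C \<and> A \<subseteq> C \<and> z \<notin> C}"
  have "\<exists>M\<in>P. \<forall>X\<in>P. M \<subseteq> X \<longrightarrow> X = M"
  proof (rule subset_Zorn_nonempty)
    show "P \<noteq> {}" using A z by (auto simp: P_def)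
    fix CC assume CC: "CC \<noteq> {}" "subset.chain P CC"
    have sub: "CC \<subseteq> P" using CC by (auto simp: subset.chain_def)
    have "subring_set (\<Union>CC)"
      unfolding subring_set_def
    proof (intro conjI ballI)
      show "1 \<in> \<Union>CC" using CC sub by (auto simp: P_def subring_set_def)
      fix x y assume "x \<in> \<Union>CC" "y \<in> \<Union>CC"
      then obtain X Y where XY: "X \<in> CC" "x \<in> X" "Y \<in> CC" "y \<in> Y" by auto
      then have "X \<subseteq> Y \<or> Y \<subseteq> X" using CC(2) by (auto simp: subset.chain_def)
      then obtain Z where Z: "Z \<in> CC" "x \<in> Z" "y \<in> Z" using XY by auto
      then have "subring_set Z" using sub by (auto simp: P_def)
      then show "x - y \<in> \<Union>CC" "x * y \<in> \<Union>CC" using Z by (auto simp: subring_set_def)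
    qed
    then show "\<Union>CC \<in> P" using CC(1) sub by (auto simp: P_def)
  qed
  then obtain B where B: "B \<in> P" "\<And>X. X \<in> P \<Longrightarrow> B \<subseteq> X \<Longrightarrow> X = B" by blast
  show ?thesis
  proof (intro exI conjI allI impI)
    show "subring_set B" "A \<subseteq> B" "z \<notin> B" using B(1) by (auto simp: P_def)
    fix C assume "subring_set C" "B \<subseteq> C" "z \<notin> C"
    then show "C = B" using B by (intro B(2)) (auto simp: P_def)
  qed
qed

text \<open>Put w = 1 - b/z. If z were in B[1/w], then z w^n would be in \<open>B\<close> for some
  n; but z w = z - b, so z w^n is congruent to z modulo \<open>B\<close>, which is impossible. Hence
  B[1/w] still omits z, and maximality gives B[1/w] = B.\<close>

lemma maximal_subring_unit:
  fixes B :: "'k::field set"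
  assumes B: "subring_set B" and u: "inverse z \<in> B" and z: "z \<notin> B"
    and max: "\<And>C. subring_set C \<Longrightarrow> B \<subseteq> C \<Longrightarrow> z \<notin> C \<Longrightarrow> C = B"
    and b: "b \<in> B"
  shows "inverse (1 - inverse z * b) \<in> B"
proof -
  note cl = subring_set_closed[OF B]
  have z0: "z \<noteq> 0" using z cl by auto
  define w where "w = 1 - inverse z * b"
  have w: "w \<in> B" using cl u b by (auto simp: w_def)
  have w0: "w \<noteq> 0"
  proof
    assume "w = 0"
    then have "z = b" using z0 by (simp add: w_def field_simps)
    then show False using b z by simp
  qed
  have "z \<notin> adjoin B (inverse w)"
  proof
    assume "z \<in> adjoin B (inverse w)"
    then obtain c n where c: "z = (\<Sum>i\<le>n. c i * inverse w ^ i)" "\<forall>i. c i \<in> B" by (auto simp: adjoin_def)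
    have "z * w ^ n = (\<Sum>i\<le>n. c i * w ^ (n - i))"
      unfolding c(1) sum_distrib_right
      using w0 by (intro sum.cong) (auto simp: power_diff field_simps)
    also have "\<dots> \<in> B" using c w by (intro subring_set_sum[OF B] cl) auto
    finally have zw: "z * w ^ n \<in> B" .
    have "\<exists>d\<in>B. z * w ^ k = z - d" for k
    proof (induction k)
      case 0
      then show ?case using cl by (intro bexI[of _ 0]) auto
    next
      case (Suc k)
      then obtain d where d: "d \<in> B" "z * w ^ k = z - d" by blast
      have "z * w ^ Suc k = (z - d) * w" unfolding d(2)[symmetric] by simp
      also have "\<dots> = z - (b + d * w)" using z0 by (simp add: w_def algebra_simps)
      finally show ?case using d b w by (intro bexI[of _ "b + d * w"]) (auto intro: cl)
    qed
    then obtain d where "d \<in> B" "z * w ^ n = z - d" by blast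
    then have "z = z * w ^ n + d" by simp
    then have "z \<in> B" using zw \<open>d \<in> B\<close> cl by metis
    then show False using z by simp
  qed
  then have "adjoin B (inverse w) = B"
    using adjoin_extends[OF B] by (intro max subring_adjoin[OF B]) auto
  then show ?thesis using adjoin_generator[OF B, of "inverse w"] by (simp add: w_def)
qed

text \<open>If neither x nor 1/x belonged to \<open>B\<close>, adjoining either of them would
  capture z. Of the two resulting polynomial expressions of z the one of larger degree can be
  shortened with the help of the other, against the minimality of both degrees.\<close>

lemma maximal_subring_valuation_ring:
  fixes B :: "'k::field set"
  assumes B: "subring_set B" and u: "inverse z \<in> B" and z: "z \<notin> B"
    and max: "\<And>C. subring_set C \<Longrightarrow> B \<subseteq> C \<Longrightarrow> z \<notin> C \<Longrightarrow> C = B"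
  shows "x \<in> B \<or> inverse x \<in> B"
proof -
  note cl = subring_set_closed[OF B]
  have z0: "z \<noteq> 0" using z cl by auto
  define rep where "rep y n \<longleftrightarrow> (\<exists>b. (\<forall>i. b i \<in> B) \<and> z = (\<Sum>i\<le>n. b i * y ^ i))" for y and n :: nat
  have rep_ex: "\<exists>n. rep y n" if "y \<notin> B" for y
  proof -
    have "adjoin B y \<noteq> B" using adjoin_generator[OF B, of y] that by auto
    then have "z \<in> adjoin B y" using max[OF subring_adjoin[OF B]] adjoin_extends[OF B] by blast
    then show ?thesis by (auto simp: adjoin_def rep_def)
  qed
  have reduce: "\<exists>k<n. rep y k"
    if n: "rep y n" and m: "rep (inverse y) m" and mn: "m \<le> n" and y0: "y \<noteq> 0" for y n m
  proof -
    obtain b where b: "\<forall>i. b i \<in> B" "z = (\<Sum>i\<le>n. b i * y ^ i)" using n by (auto simp: rep_def)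
    obtain c where c: "\<forall>i. c i \<in> B" "z = (\<Sum>i\<le>m. c i * inverse y ^ i)" using m by (auto simp: rep_def)
    have n0: "n \<noteq> 0"
    proof
      assume "n = 0"
      then show False using b z by auto
    qed
    then obtain n' where n': "n = Suc n'" using not0_implies_Suc by blast
    \<comment> \<open>By \<open>maximal_subring_unit\<close> the constant term can be absorbed: the
      expression of z in 1/y, divided by z, becomes 1 = d (1/z) times the terms with i >= 1, and
      multiplication by y^n writes y^n through lower powers of y.\<close>
    define d where "d = inverse (1 - inverse z * c 0)"
    have d: "d \<in> B" unfolding d_def using c by (intro maximal_subring_unit[OF B u z max]) auto
    have d0: "1 - inverse z * c 0 \<noteq> 0"
    proof
      assume "1 - inverse z * c 0 = 0"
      then have "z = c 0" using z0 by (simp add: field_simps)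
      then show False using c z by auto
    qed
    have "z = c 0 + (\<Sum>i=1..m. c i * inverse y ^ i)"
      unfolding c(2) by (simp add: sum.atLeast_Suc_atMost atMost_atLeast0)
    then have "inverse z * z = inverse z * c 0 + inverse z * (\<Sum>i=1..m. c i * inverse y ^ i)"
      by (metis distrib_left)
    then have "1 - inverse z * c 0 = inverse z * (\<Sum>i=1..m. c i * inverse y ^ i)"
      using z0 by (simp add: algebra_simps)
    then have d1: "1 = d * (inverse z * (\<Sum>i=1..m. c i * inverse y ^ i))"
      using d0 unfolding d_def by (metis left_inverse)
    have "y ^ n = d * (inverse z * (\<Sum>i=1..m. c i * inverse y ^ i)) * y ^ n"
      unfolding d1[symmetric] by simp
    also have "\<dots> = (\<Sum>i=1..m. d * inverse z * c i * (inverse y ^ i * y ^ n))"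
      by (simp add: sum_distrib_left sum_distrib_right mult_ac)
    also have "\<dots> = (\<Sum>i=1..m. d * inverse z * c i * y ^ (n - i))"
      using y0 mn by (intro sum.cong) (auto simp: power_diff field_simps)
    also have "\<dots> = (\<Sum>j\<in>{n-m..<n}. d * inverse z * c (n - j) * y ^ j)"
      by (rule sum.reindex_bij_witness[of _ "\<lambda>j. n - j" "\<lambda>i. n - i"]) (use mn in auto)
    also have "\<dots> = (\<Sum>j\<le>n'. (if n - m \<le> j then d * inverse z * c (n - j) else 0) * y ^ j)"
      by (rule sum.mono_neutral_cong_left) (auto simp: n')
    finally have yn: "y ^ n = (\<Sum>j\<le>n'. (if n - m \<le> j then d * inverse z * c (n - j) else 0) * y ^ j)" .
    define e where "e j = b j + b n * (if n - m \<le> j then d * inverse z * c (n - j) else 0)" for j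
    have "z = (\<Sum>j\<le>n'. b j * y ^ j) + b n * y ^ n" unfolding b(2) n' by simp
    also have "\<dots> = (\<Sum>j\<le>n'. e j * y ^ j)"
      unfolding yn by (simp add: e_def sum.distrib sum_distrib_left distrib_right mult.assoc)
    finally have ze: "z = (\<Sum>j\<le>n'. e j * y ^ j)" .
    have "b n * (d * inverse z * c (n - j)) \<in> B" for j
      using b(1) c(1) d u by (intro cl(4)) blast+
    then have "\<forall>j. e j \<in> B" using b(1) cl(1,6) by (simp add: e_def)
    then have "rep y n'" unfolding rep_def using ze by blast
    then show ?thesis using n' by blast
  qed
  show ?thesis
  proof (rule ccontr)
    assume H: "\<not> ?thesis"
    then have x0: "x \<noteq> 0" using cl by auto
    define n where "n = (LEAST n. rep x n)"
    define m where "m = (LEAST m. rep (inverse x) m)"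
    have n: "rep x n" unfolding n_def by (rule LeastI_ex, rule rep_ex) (use H in blast)
    have m: "rep (inverse x) m" unfolding m_def by (rule LeastI_ex, rule rep_ex) (use H in blast)
    show False
    proof (cases "m \<le> n")
      case True
      then obtain k where "k < n" "rep x k" using reduce[OF n m True x0] by blast
      then show False using not_less_Least[of k "rep x"] by (simp add: n_def)
    next
      case False
      then obtain k where "k < m" "rep (inverse x) k" using reduce[of "inverse x" m n] m n x0 by auto
      then show False using not_less_Least[of k "rep (inverse x)"] by (simp add: m_def)
    qed
  qed
qed

section \<open>Places from valuation rings\<close>

lemma subring_of_int: "subring_set B \<Longrightarrow> of_int m \<in> (B :: 'k::field set)"
proof -
  assume B: "subring_set B"
  note cl = subring_set_closed[OF B]
  have n: "of_nat n \<in> B" for n by (induction n) (auto intro: cl)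
  show ?thesis using n[of "nat m"] cl(5)[OF n[of "nat (- m)"]] by (cases "m \<ge> 0") auto
qed

lemma subring_Fp_subset: "subring_set B \<Longrightarrow> Fp \<subseteq> (B :: 'k::field set)"
  using subring_of_int by (auto simp: Fp_def)

definition unit_set :: "'k::field set \<Rightarrow> 'k set" where
  "unit_set B = {x. x \<noteq> 0 \<and> x \<in> B \<and> inverse x \<in> B}"

lemma quotient_eq_if_cross_eq:
  fixes a :: "'a::field"
  assumes "d * a = e * b" "d \<noteq> 0" "b \<noteq> 0"
  shows "a / b = e * inverse d"
  using assms by (simp add: field_simps)

lemma unit_set_closed:
  assumes B: "subring_set B"
  shows "1 \<in> unit_set B" "x \<in> unit_set B \<Longrightarrow> y \<in> unit_set B \<Longrightarrow> x * y \<in> unit_set B"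
    "x \<in> unit_set B \<Longrightarrow> inverse x \<in> unit_set B" "x \<in> unit_set B \<Longrightarrow> x ^ n \<in> unit_set B"
proof -
  note cl = subring_set_closed[OF B]
  show one: "1 \<in> unit_set B" using cl by (simp add: unit_set_def)
  show mult: "x \<in> unit_set B \<Longrightarrow> y \<in> unit_set B \<Longrightarrow> x * y \<in> unit_set B" for x y
    using cl(4) by (simp add: unit_set_def)
  show "x \<in> unit_set B \<Longrightarrow> inverse x \<in> unit_set B" by (simp add: unit_set_def)
  show "x \<in> unit_set B \<Longrightarrow> x ^ n \<in> unit_set B" by (induction n) (auto intro: one mult)
qed

text \<open>\<open>z\<close> witnesses that the ring is proper; its inverse is the scale against
  which all other elements are measured.\<close>

locale valuation_ring =
  fixes B :: "'k::field set" and z :: 'k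
  assumes subring: "subring_set B"
    and total: "\<And>x. x \<in> B \<or> inverse x \<in> B"
    and z: "z \<notin> B"
begin

lemmas cl = subring_set_closed[OF subring]

lemma z_nonzero: "z \<noteq> 0" using z cl by auto

lemma inverse_z: "inverse z \<in> B" using total z by blast

lemma z_power: "0 < k \<Longrightarrow> z ^ k \<notin> B"
proof
  assume k: "0 < k" and "z ^ k \<in> B"
  then have "z ^ k * inverse z ^ (k - 1) \<in> B" by (intro cl(4) cl(7)[OF inverse_z])
  moreover have "z ^ k * inverse z ^ (k - 1) = z"
    using k z_nonzero by (cases k) (auto simp: field_simps)
  ultimately show False using z by simp
qed

text \<open>With x = 1 + c/z, the product z x = z + c stays outside \<open>B\<close>, so 1/(z x)
  lies in \<open>B\<close>, and 1/x = 1 - c/(z x).\<close>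

lemma one_plus_unit:
  assumes c: "c \<in> B"
  shows "1 + inverse z * c \<in> unit_set B"
proof -
  define x where "x = 1 + inverse z * c"
  have xB: "x \<in> B" unfolding x_def using c inverse_z by (intro cl)
  have zx: "z * x \<notin> B"
  proof
    assume "z * x \<in> B"
    then have "z * x - c \<in> B" using c by (rule cl(3))
    moreover have "z * x - c = z" using z_nonzero by (simp add: x_def algebra_simps)
    ultimately show False using z by simp
  qed
  then have x0: "x \<noteq> 0" using cl by auto
  have "inverse (z * x) \<in> B" using total zx by blast
  then have "1 - c * inverse (z * x) \<in> B" using c by (intro cl)
  moreover have "1 - c * inverse (z * x) = inverse x"
  proof -
    have "1 = (inverse z * c + 1) * inverse x" using x0 by (simp add: x_def add.commute)
    then show ?thesis by (simp add: algebra_simps)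
  qed
  ultimately show ?thesis using xB x0 by (simp add: unit_set_def x_def)
qed

text \<open>A term of least value, found before any valuation exists: divisibility in
  \<open>B\<close> is a total preorder on the nonzero elements.\<close>

lemma minimal_term:
  assumes "finite J" "J \<noteq> {}" "\<And>j. j \<in> J \<Longrightarrow> T j \<noteq> 0"
  shows "\<exists>i\<in>J. \<forall>j\<in>J. T j / T i \<in> B"
  using assms
proof (induction J rule: finite_ne_induct)
  case (singleton x)
  then show ?case using cl by auto
next
  case (insert x J)
  then obtain i where i: "i \<in> J" "\<forall>j\<in>J. T j / T i \<in> B" by auto
  have nz: "T i \<noteq> 0" "T x \<noteq> 0" using i insert.prems by auto
  show ?case
  proof (cases "T x / T i \<in> B")
    case True
    then show ?thesis using i by auto
  next
    case False
    then have ix: "T i / T x \<in> B" using total[of "T x / T i"] by simp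
    have "T j / T x \<in> B" if "j \<in> J" for j
      using cl(4)[OF _ ix, of "T j / T i"] i that nz by simp
    then show ?thesis using cl nz by auto
  qed
qed

end

locale valuation_ring_global = global_field K p + valuation_ring B z
  for K :: "'k::field itself" and p :: nat and B :: "'k set" and z :: 'k
begin

text \<open>Pulling out the lowest power of 1/z leaves a nonzero constant times an element of the
  form 1 + c/z, which is a unit. So on F_p[1/z] the ring \<open>B\<close> already measures orders by
  integers.\<close>

lemma Fp_sum_order:
  assumes b: "\<And>i. i \<le> n \<Longrightarrow> b i \<in> Fp" and nz: "\<exists>i\<le>n. b i \<noteq> 0"
  shows "\<exists>k. \<exists>e\<in>unit_set B. (\<Sum>i\<le>n. b i * inverse z ^ i) = e * inverse z ^ k"
proof -
  define k where "k = (LEAST i. i \<le> n \<and> b i \<noteq> 0)"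
  have k: "k \<le> n" "b k \<noteq> 0" using LeastI_ex[OF nz] by (auto simp: k_def)
  have low: "b i = 0" if "i < k" for i
    using not_less_Least[of i "\<lambda>i. i \<le> n \<and> b i \<noteq> 0"] that k by (auto simp: k_def)
  define w where "w = (\<Sum>i\<in>{Suc k..n}. b i * inverse z ^ (i - Suc k))"
  have "(\<Sum>i\<le>n. b i * inverse z ^ i) = (\<Sum>i\<in>{k..n}. b i * inverse z ^ i)"
    using low by (intro sum.mono_neutral_right) auto
  also have "\<dots> = b k * inverse z ^ k + (\<Sum>i\<in>{Suc k..n}. b i * inverse z ^ i)"
    using k by (simp add: sum.atLeast_Suc_atMost)
  also have "(\<Sum>i\<in>{Suc k..n}. b i * inverse z ^ i) = inverse z ^ k * (inverse z * w)"
    unfolding w_def sum_distrib_left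
  proof (rule sum.cong[OF refl])
    fix i assume "i \<in> {Suc k..n}"
    then have "inverse z ^ i = inverse z ^ (k + (1 + (i - Suc k)))" by simp
    also have "\<dots> = inverse z ^ k * (inverse z * inverse z ^ (i - Suc k))" by (simp only: power_add power_one_right)
    finally show "b i * inverse z ^ i = inverse z ^ k * (inverse z * (b i * inverse z ^ (i - Suc k)))" by simp
  qed
  also have "b k * inverse z ^ k + inverse z ^ k * (inverse z * w)
      = (b k * (1 + inverse z * (inverse (b k) * w))) * inverse z ^ k"
    using k(2) by (simp add: algebra_simps)
  finally have eq: "(\<Sum>i\<le>n. b i * inverse z ^ i) = (b k * (1 + inverse z * (inverse (b k) * w))) * inverse z ^ k" .
  have FpB: "c \<in> B" if "c \<in> Fp" for c using that subring_Fp_subset[OF subring] by blast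
  have invk: "inverse (b k) \<in> Fp" using b k subfield_Fp by (auto simp: subfield_set_def)
  have "w \<in> B" unfolding w_def using b FpB inverse_z by (intro subring_set_sum[OF subring] cl) auto
  then have "1 + inverse z * (inverse (b k) * w) \<in> unit_set B"
    using FpB invk by (intro one_plus_unit cl) auto
  moreover have "b k \<in> unit_set B" using k b FpB invk by (auto simp: unit_set_def)
  ultimately show ?thesis using eq unit_set_closed(2)[OF subring] by blast
qed

lemma adjoin_order:
  assumes "a \<in> adjoin Fp (inverse z)" "a \<noteq> 0"
  shows "\<exists>k. \<exists>e\<in>unit_set B. a = e * inverse z ^ k"
proof -
  obtain b n where b: "a = (\<Sum>i\<le>n. b i * inverse z ^ i)" "\<forall>i. b i \<in> Fp"
    using assms by (auto simp: adjoin_def)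
  have "\<exists>i\<le>n. b i \<noteq> 0"
  proof (rule ccontr)
    assume "\<not> ?thesis"
    then have "a = 0" unfolding b(1) by (intro sum.neutral) auto
    then show False using assms by simp
  qed
  then show ?thesis using Fp_sum_order[of n b] b by auto
qed

lemma transc_inverse_z: "transc (inverse z)"
  unfolding transc_def
proof (intro allI impI, rule ccontr)
  fix b n i assume b: "\<forall>i. b i \<in> Fp" "(\<Sum>i\<le>n. b i * inverse z ^ i) = 0" and i: "i \<le> n" "b i \<noteq> 0"
  obtain k e where "e \<in> unit_set B" "(\<Sum>i\<le>n. b i * inverse z ^ i) = e * inverse z ^ k"
    using Fp_sum_order[of n b] b(1) i by blast
  then show False using b(2) z_nonzero by (auto simp: unit_set_def)
qed

text \<open>In a relation of x over F_p[1/z] the two terms of least value have a unit as quotient,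
  which makes some x^m with 0 < m <= n a unit times a power of 1/z. This is finiteness of the
  ramification over F_p(1/z), and it is what makes the valuation discrete.\<close>

lemma exponent_ex:
  "\<exists>N>0. \<forall>x. x \<noteq> 0 \<longrightarrow> (\<exists>k. \<exists>e\<in>unit_set B. x ^ N = e * inverse z powi k)"
proof -
  note un = unit_set_closed[OF subring]
  obtain n where n: "\<And>x :: nat \<Rightarrow> 'k. \<exists>c. (\<forall>i\<le>n. c i \<in> adjoin Fp (inverse z)) \<and> (\<exists>i\<le>n. c i \<noteq> 0) \<and> (\<Sum>i\<le>n. c i * x i) = 0"
    using transc_finite_degree[OF transc_inverse_z] by blast
  have step: "\<exists>k. \<exists>e\<in>unit_set B. x ^ (j - i) = e * inverse z powi k"
    if x: "x \<noteq> 0" and ij: "i < j" and e: "e \<in> unit_set B" "e' \<in> unit_set B" and d: "d \<in> unit_set B"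
      and eq: "e * inverse z ^ a * x ^ i = d * (e' * inverse z ^ b * x ^ j)" for x e e' d :: 'k and i j a b :: nat
  proof -
    have nz: "e \<noteq> 0" "e' \<noteq> 0" "d \<noteq> 0" "inverse z \<noteq> 0" using e d z_nonzero by (auto simp: unit_set_def)
    have "x ^ j = x ^ i * x ^ (j - i)" using ij by (simp flip: power_add)
    then have "x ^ i * (e * inverse z ^ a) = x ^ i * (d * e' * inverse z ^ b * x ^ (j - i))"
      using eq by (simp add: ac_simps)
    then have eq': "e * inverse z ^ a = d * e' * inverse z ^ b * x ^ (j - i)"
      using x by (simp only: mult_cancel_left power_eq_0_iff) auto
    have "inverse z powi (int a - int b) = inverse z ^ a / inverse z ^ b"
      using power_int_diff[of "inverse z" "int a" "int b"] nz(4) by (simp only: power_int_of_nat) blast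
    moreover have "inverse z ^ a / (inverse z ^ b * x ^ (j - i)) = (d * e') * inverse e"
    proof (rule quotient_eq_if_cross_eq)
      show "e * inverse z ^ a = d * e' * (inverse z ^ b * x ^ (j - i))" using eq' by (simp only: mult.assoc)
    qed (use nz x in auto)
    ultimately have "inverse z powi (int a - int b) / x ^ (j - i) = (d * e') * inverse e"
      by (simp only: divide_divide_eq_left)
    then have "x ^ (j - i) = (e * inverse (d * e')) * inverse z powi (int a - int b)"
      using nz x by (simp add: field_simps)
    moreover have "e * inverse (d * e') \<in> unit_set B" using e d by (intro un)
    ultimately show ?thesis by blast
  qed
  have main: "\<exists>m. 0 < m \<and> m \<le> n \<and> (\<exists>k. \<exists>e\<in>unit_set B. x ^ m = e * inverse z powi k)" if x: "x \<noteq> 0" for x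
  proof -
    obtain c where c: "\<forall>i\<le>n. c i \<in> adjoin Fp (inverse z)" "\<exists>i\<le>n. c i \<noteq> 0" "(\<Sum>i\<le>n. c i * x ^ i) = 0"
      using n[of "\<lambda>i. x ^ i"] by blast
    define J where "J = {i. i \<le> n \<and> c i \<noteq> 0}"
    define T where "T i = c i * x ^ i" for i
    have J: "finite J" "J \<noteq> {}" using c(2) by (auto simp: J_def)
    have T: "T j \<noteq> 0" if "j \<in> J" for j using that x by (auto simp: J_def T_def)
    have "\<exists>i\<in>J. \<forall>j\<in>J. T j / T i \<in> B" by (rule minimal_term[OF J T])
    then obtain i where i: "i \<in> J" "\<And>j. j \<in> J \<Longrightarrow> T j / T i \<in> B" by blast
    have "(\<Sum>i\<le>n. c i * x ^ i) = sum T J"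
      unfolding T_def J_def by (rule sum.mono_neutral_right) auto
    also have "\<dots> = T i + sum T (J - {i})" using i J by (simp add: sum.remove)
    finally have Ti: "T i = - sum T (J - {i})" using c(3) by (simp add: eq_neg_iff_add_eq_0)
    have "J - {i} \<noteq> {}" using Ti T[OF i(1)] by force
    then have "\<exists>j\<in>J - {i}. \<forall>l\<in>J - {i}. T l / T j \<in> B"
      using J T by (intro minimal_term) auto
    then obtain j where j: "j \<in> J - {i}" "\<And>l. l \<in> J - {i} \<Longrightarrow> T l / T j \<in> B" by blast
    \<comment> \<open>\<open>T i\<close> divides every term; being minus the sum of the others, it
      is itself divisible by \<open>T j\<close>. So the two divide each other.\<close>
    have "T i / T j = - (\<Sum>l\<in>J - {i}. T l / T j)"
      by (simp add: Ti sum_divide_distrib)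
    also have "\<dots> \<in> B" using j by (intro cl subring_set_sum[OF subring])
    finally have "T i / T j \<in> B" .
    then have d: "T i / T j \<in> unit_set B" using i j T by (auto simp: unit_set_def)
    obtain a e where ae: "e \<in> unit_set B" "c i = e * inverse z ^ a"
      using adjoin_order[of "c i"] i c by (auto simp: J_def)
    obtain b e' where be: "e' \<in> unit_set B" "c j = e' * inverse z ^ b"
      using adjoin_order[of "c j"] j c by (auto simp: J_def)
    have eq: "T i = T i / T j * T j" using T j by simp
    have eq1: "e * inverse z ^ a * x ^ i = (T i / T j) * (e' * inverse z ^ b * x ^ j)"
      using eq by (simp add: T_def ae be)
    have "T j = inverse (T i / T j) * T i" using T i j by simp
    then have eq2: "e' * inverse z ^ b * x ^ j = inverse (T i / T j) * (e * inverse z ^ a * x ^ i)"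
      by (simp add: T_def ae be)
    have ij: "i \<noteq> j" "i \<le> n" "j \<le> n" using i j by (auto simp: J_def)
    show ?thesis
    proof (cases "i < j")
      case True
      then show ?thesis using step[OF x True ae(1) be(1) d eq1] ij by (intro exI[of _ "j - i"]) auto
    next
      case False
      then have ji: "j < i" using ij by simp
      then show ?thesis using step[OF x ji be(1) ae(1) un(3)[OF d] eq2] ij by (intro exI[of _ "i - j"]) auto
    qed
  qed
  \<comment> \<open>One exponent for all x: every \<open>m\<close> found above lies between 1 and n
    and so divides n!.\<close>
  have "\<exists>k. \<exists>e\<in>unit_set B. x ^ fact n = e * inverse z powi k" if x: "x \<noteq> 0" for x
  proof -
    obtain m k e where m: "0 < m" "m \<le> n" "e \<in> unit_set B" "x ^ m = e * inverse z powi k"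
      using main[OF x] by blast
    have "m dvd fact n" using m by (intro dvd_fact) auto
    then obtain q where q: "fact n = m * q" by (auto simp: dvd_def)
    have "x ^ fact n = e ^ q * (inverse z powi k) ^ q"
      unfolding q power_mult m(4) by (simp add: power_mult_distrib)
    also have "(inverse z powi k) ^ q = inverse z powi (k * int q)"
      by (simp only: power_int_mult power_int_of_nat)
    finally show ?thesis using un(4)[OF m(3)] by blast
  qed
  then show ?thesis by (intro exI[of _ "fact n"]) auto
qed

text \<open>\<open>\<kappa> x\<close> is the exponent of 1/z in x^N up to units, a homomorphism to
  the integers whose sign decides membership in \<open>B\<close>. Dividing it by its least positive
  value normalizes it.\<close>

lemma place_of_valuation_ring: "\<exists>v. is_place v \<and> (\<forall>x. x \<in> B \<longleftrightarrow> vge v x 0)"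
proof -
  note un = unit_set_closed[OF subring]
  let ?u = "inverse z"
  have u0: "?u \<noteq> 0" using z_nonzero by simp
  obtain N where N: "N > 0" "\<And>x. x \<noteq> 0 \<Longrightarrow> \<exists>k. \<exists>e\<in>unit_set B. x ^ N = e * ?u powi k"
    using exponent_ex by blast
  then obtain \<kappa> where \<kappa>: "\<And>x. x \<noteq> 0 \<Longrightarrow> \<exists>e\<in>unit_set B. x ^ N = e * ?u powi (\<kappa> x)"
    by metis
  have neg: "?u powi k \<notin> B" if "k < 0" for k
  proof -
    have "?u powi k = z ^ nat (- k)" using that by (simp add: power_int_def)
    then show ?thesis using z_power[of "nat (- k)"] that by simp
  qed
  have nonneg: "?u powi k \<in> B" if "k \<ge> 0" for k
    using that inverse_z cl(7)[of ?u "nat k"] by (simp add: power_int_def)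
  have unitk: "k = 0" if "?u powi k \<in> unit_set B" for k
  proof (rule ccontr)
    assume "k \<noteq> 0"
    then have "k < 0 \<or> - k < 0" by auto
    moreover have "?u powi k \<in> B" "?u powi (- k) \<in> B"
      using that by (auto simp: unit_set_def power_int_minus)
    ultimately show False using neg by blast
  qed
  have \<kappa>_unique: "\<kappa> x = k" if x: "x \<noteq> 0" and e: "e \<in> unit_set B" and eq: "x ^ N = e * ?u powi k" for x e k
  proof -
    obtain e' where e': "e' \<in> unit_set B" "x ^ N = e' * ?u powi (\<kappa> x)" using \<kappa>[OF x] by blast
    have nz: "e \<noteq> 0" "e' \<noteq> 0" using e e' by (auto simp: unit_set_def)
    have "?u powi (\<kappa> x - k) = ?u powi \<kappa> x / ?u powi k" using u0 by (intro power_int_diff) blast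
    also have "\<dots> = e * inverse e'"
    proof -
      have "e' * ?u powi \<kappa> x = e * ?u powi k" using eq e' by simp
      moreover have "?u powi k \<noteq> 0" using u0 by simp
      ultimately show ?thesis using quotient_eq_if_cross_eq nz(2) by blast
    qed
    finally have "?u powi (\<kappa> x - k) = e * inverse e'" .
    then have "?u powi (\<kappa> x - k) \<in> unit_set B" using e e' un by simp
    then show ?thesis using unitk by force
  qed
  have \<kappa>_mult: "\<kappa> (x * y) = \<kappa> x + \<kappa> y" if x: "x \<noteq> 0" and y: "y \<noteq> 0" for x y
  proof -
    obtain e where e: "e \<in> unit_set B" "x ^ N = e * ?u powi (\<kappa> x)" using \<kappa>[OF x] by blast
    obtain e' where e': "e' \<in> unit_set B" "y ^ N = e' * ?u powi (\<kappa> y)" using \<kappa>[OF y] by blast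
    have "(x * y) ^ N = (e * e') * ?u powi (\<kappa> x + \<kappa> y)"
      using e e' u0 by (simp add: power_mult_distrib power_int_add mult_ac)
    then show ?thesis using x y un(2)[OF e(1) e'(1)] by (intro \<kappa>_unique) auto
  qed
  have \<kappa>_B: "x \<in> B \<longleftrightarrow> \<kappa> x \<ge> 0" if x: "x \<noteq> 0" for x
  proof -
    obtain e where e: "e \<in> unit_set B" "x ^ N = e * ?u powi (\<kappa> x)" using \<kappa>[OF x] by blast
    show ?thesis
    proof
      assume xB: "x \<in> B"
      have "inverse e * x ^ N \<in> B" using e xB by (intro cl) (auto simp: unit_set_def)
      moreover have "inverse e * x ^ N = ?u powi (\<kappa> x)" using e by (simp add: unit_set_def)
      ultimately show "\<kappa> x \<ge> 0" using neg by force
    next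
      assume "\<kappa> x \<ge> 0"
      then have xN: "x ^ N \<in> B" using e nonneg cl(4) by (simp add: unit_set_def)
      \<comment> \<open>\<open>B\<close> is closed under N-th roots: if x were outside, 1/x would be
        inside, and so would x = x^N (1/x)^(N-1).\<close>
      show "x \<in> B"
      proof (rule ccontr)
        assume nB: "x \<notin> B"
        then have "inverse x \<in> B" using total by blast
        then have "x ^ N * inverse x ^ (N - 1) \<in> B" by (intro cl(4)[OF xN] cl(7))
        moreover have "x ^ N * inverse x ^ (N - 1) = x"
          using N(1) x by (cases N) (auto simp: field_simps)
        ultimately show False using nB by simp
      qed
    qed
  qed
  have \<kappa>_1: "\<kappa> 1 = 0" using \<kappa>_mult[of 1 1] by simp
  have \<kappa>_inverse: "\<kappa> (inverse x) = - \<kappa> x" if "x \<noteq> 0" for x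
    using \<kappa>_mult[of x "inverse x"] that \<kappa>_1 by simp
  have \<kappa>_powi: "\<kappa> (x powi k) = k * \<kappa> x" if x: "x \<noteq> 0" for x k
  proof -
    have pw: "\<kappa> (x ^ n) = int n * \<kappa> x" for n
      by (induction n) (auto simp: \<kappa>_1 \<kappa>_mult x algebra_simps)
    have "\<kappa> (inverse x ^ n) = - (int n * \<kappa> x)" for n
      using \<kappa>_inverse[of "x ^ n"] x pw by (simp add: power_inverse)
    then show ?thesis using pw by (auto simp: power_int_def)
  qed
  have \<kappa>_u: "\<kappa> ?u = int N"
    using u0 un(1) by (intro \<kappa>_unique[of _ 1]) (auto simp: power_int_of_nat)
  define P where "P d \<longleftrightarrow> d > 0 \<and> (\<exists>x. x \<noteq> 0 \<and> \<kappa> x = int d)" for d :: nat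
  define d where "d = (LEAST d. P d)"
  have "P N" using N(1) \<kappa>_u u0 unfolding P_def by blast
  then have "P d" unfolding d_def by (rule LeastI)
  then obtain w where w: "d > 0" "w \<noteq> 0" "\<kappa> w = int d" by (auto simp: P_def)
  have dvd: "int d dvd \<kappa> x" if x: "x \<noteq> 0" for x
  proof -
    \<comment> \<open>The remainder of \<open>\<kappa> x\<close> modulo \<open>d\<close> is attained
      by \<open>y\<close>, so minimality of \<open>d\<close> makes it zero.\<close>
    define y where "y = x * w powi (- (\<kappa> x div int d))"
    have y0: "y \<noteq> 0" using x w by (simp add: y_def)
    have "\<kappa> y = \<kappa> x - (\<kappa> x div int d) * int d"
      using x w by (simp add: y_def \<kappa>_mult \<kappa>_powi)
    then have "\<kappa> y = \<kappa> x mod int d" by (simp add: minus_div_mult_eq_mod)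
    moreover have "\<not> P (nat (\<kappa> x mod int d))"
      using not_less_Least[of "nat (\<kappa> x mod int d)" P] w(1) unfolding d_def[symmetric] by (simp add: nat_less_iff)
    ultimately have "\<not> nat (\<kappa> x mod int d) > 0" using y0 w(1) unfolding P_def by auto
    moreover have "0 \<le> \<kappa> x mod int d" using w(1) by simp
    ultimately have "\<kappa> x mod int d = 0" by simp
    then show ?thesis by (simp add: dvd_eq_mod_eq_0)
  qed
  define v where "v x = (if x = 0 then 0 else \<kappa> x div int d)" for x
  have \<kappa>v: "\<kappa> x = int d * v x" if "x \<noteq> 0" for x
    using dvd[OF that] that by (simp add: v_def)
  have v_mult: "v (x * y) = v x + v y" if "x \<noteq> 0" "y \<noteq> 0" for x y
  proof -
    have "int d * v (x * y) = int d * (v x + v y)"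
      using that \<kappa>v[of "x * y"] \<kappa>v[of x] \<kappa>v[of y] \<kappa>_mult[of x y] by (simp add: distrib_left)
    then show ?thesis using w(1) by simp
  qed
  have v_B: "x \<in> B \<longleftrightarrow> v x \<ge> 0" if "x \<noteq> 0" for x
    using \<kappa>_B[OF that] \<kappa>v[OF that] w(1) by (simp add: zero_le_mult_iff)
  have v_inv: "v (inverse x) = - v x" if "x \<noteq> 0" for x
    using v_mult[of x "inverse x"] v_mult[of 1 1] that by simp
  have add_aux: "v x \<le> v (x + y)" if xy: "x \<noteq> 0" "y \<noteq> 0" "x + y \<noteq> 0" and le: "v x \<le> v y" for x y
  proof -
    have "v (y * inverse x) = v y - v x" using xy by (simp add: v_mult v_inv)
    then have "y * inverse x \<in> B" using xy le v_B[of "y * inverse x"] by simp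
    then have "1 + y * inverse x \<in> B" by (rule cl(6)[OF cl(2)])
    moreover have "1 + y * inverse x = (x + y) * inverse x" using xy by (simp add: field_simps)
    ultimately have "v ((x + y) * inverse x) \<ge> 0" using v_B[of "(x + y) * inverse x"] xy by simp
    then show ?thesis using xy by (simp add: v_mult v_inv)
  qed
  have "is_place v"
    unfolding is_place_def
  proof (intro conjI allI impI)
    show "v 0 = 0" by (simp add: v_def)
    show "v (x * y) = v x + v y" if "x \<noteq> 0" "y \<noteq> 0" for x y using that by (rule v_mult)
    show "min (v x) (v y) \<le> v (x + y)" if "x \<noteq> 0" "y \<noteq> 0" "x + y \<noteq> 0" for x y
      using add_aux[of x y] add_aux[of y x] that by (cases "v x \<le> v y") (auto simp: add.commute)
    have "int d * v w = int d" using \<kappa>v[OF w(2)] w by simp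
    then show "\<exists>x. x \<noteq> 0 \<and> v x = 1" using w by (intro exI[of _ w]) auto
  qed
  moreover have "x \<in> B \<longleftrightarrow> vge v x 0" for x
    using v_B[of x] cl(1) by (cases "x = 0") (auto simp: vge_def)
  ultimately show ?thesis by blast
qed

end

context global_field
begin

text \<open>The hypothesis says that z is not integral over \<open>A\<close>: an expression of z in
  A[1/z], multiplied by a power of z, is a monic equation. A maximal ring omitting z then provides
  the place.\<close>

theorem place_extension:
  fixes A :: "'k set"
  assumes A: "subring_set A" and z: "z \<notin> adjoin A (inverse z)"
  shows "\<exists>v. is_place v \<and> (\<forall>x\<in>A. vge v x 0) \<and> v z < 0"
proof -
  obtain B where B: "subring_set B" "adjoin A (inverse z) \<subseteq> B" "z \<notin> B"
    "\<And>C. subring_set C \<Longrightarrow> B \<subseteq> C \<Longrightarrow> z \<notin> C \<Longrightarrow> C = B"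
    using Chevalley_maximal[OF subring_adjoin[OF A] adjoin_generator[OF A] z] by metis
  have u: "inverse z \<in> B" using B(2) adjoin_generator[OF A] by blast
  interpret valuation_ring_global K p B z
    using B maximal_subring_valuation_ring[OF B(1) u B(3) B(4)] by unfold_locales auto
  obtain v where v: "is_place v" "\<And>x. x \<in> B \<longleftrightarrow> vge v x 0" using place_of_valuation_ring by blast
  show ?thesis
    using v B(2,3) adjoin_extends[OF A] by (intro exI[of _ v]) (auto simp: vge_def)
qed

text \<open>An integral equation of s over F_p would be a nontrivial polynomial relation, so s has a
  pole somewhere.\<close>

lemma transc_negative_place:
  fixes s :: 'k
  assumes s: "transc s"
  shows "\<exists>v. is_place v \<and> v s < 0"
proof -
  have "s \<notin> adjoin Fp (inverse s)"
  proof
    assume "s \<in> adjoin Fp (inverse s)"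
    then obtain b n where b: "s = (\<Sum>i\<le>n. b i * inverse s ^ i)" "\<forall>i. b i \<in> Fp" by (auto simp: adjoin_def)
    \<comment> \<open>Coefficients of the monic relation of degree n + 1 that arises on multiplying
      by s^n.\<close>
    define c where "c j = (if j = Suc n then 1 else - b (n - j))" for j
    have s0: "s \<noteq> 0"
    proof
      assume "s = 0"
      then have "(\<Sum>i\<le>1. of_nat i * s ^ i) = 0" by simp
      then have "of_nat 1 = (0::'k)"
        by (rule transcD[OF s, of 1 of_nat, rotated]) (auto simp: Fp_def intro: range_eqI[of _ _ "int _"])
      then show False by simp
    qed
    have "s ^ Suc n = s * s ^ n" by simp
    also have "\<dots> = (\<Sum>i\<le>n. b i * inverse s ^ i) * s ^ n" using b(1) by simp
    also have "\<dots> = (\<Sum>i\<le>n. b i * s ^ (n - i))"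
      unfolding sum_distrib_right using s0 by (intro sum.cong) (auto simp: power_diff field_simps)
    also have "\<dots> = (\<Sum>j\<le>n. b (n - j) * s ^ j)"
      by (rule sum.reindex_bij_witness[of _ "\<lambda>j. n - j" "\<lambda>i. n - i"]) auto
    finally have "(\<Sum>j\<le>Suc n. c j * s ^ j) = 0"
      by (simp add: c_def sum_negf)
    then have "c (Suc n) = 0"
      using b(2) subring_set_closed(2,5)[OF subring_Fp] by (intro transcD[OF s, of "Suc n" c]) (auto simp: c_def)
    then show False by (simp add: c_def)
  qed
  then show ?thesis using place_extension[OF subring_Fp] by blast
qed

text \<open>A nonzero value would make z transcendental and hence give it a pole. Being constant is
  expressed as having value 0 at all places; the field of constants itself does not appear.\<close>

theorem nonneg_everywhere_imp_constant:
  fixes z :: 'k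
  assumes "\<And>v. is_place v \<Longrightarrow> vge v z 0" and v: "is_place v"
  shows "v z = 0"
proof (rule ccontr)
  assume "v z \<noteq> 0"
  then obtain w where "is_place w" "w z < 0" using transc_negative_place[OF transc_if_place[OF v]] by blast
  then show False using assms(1)[of w] by (auto simp: vge_def place_0)
qed

end

section \<open>Finiteness of zeros, residual orders and denominators\<close>

text \<open>Inclusion of the valuation rings already forces proportionality: x divided by a suitable
  power of a uniformizer t of \<open>v\<close> is a unit for both places, so w = w(t) v, and
  normalization of \<open>w\<close> leaves w(t) = 1.\<close>

lemma place_eq_if_le:
  fixes v w :: "'k::field \<Rightarrow> int"
  assumes v: "is_place v" and w: "is_place w" and le: "\<And>x. x \<noteq> 0 \<Longrightarrow> v x \<ge> 0 \<Longrightarrow> w x \<ge> 0"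
  shows "v = w"
proof -
  have unit: "w x = 0" if "x \<noteq> 0" "v x = 0" for x
    using le[of x] le[of "inverse x"] that by (simp add: place_inverse[OF v] place_inverse[OF w])
  obtain t where t: "t \<noteq> 0" "v t = 1" using place_uniformizer[OF v] by blast
  have eq: "w x = w t * v x" if x: "x \<noteq> 0" for x
  proof -
    have "v (x / t powi v x) = 0"
      using x t by (simp add: place_divide[OF v] place_powi[OF v])
    then have "w (x / t powi v x) = 0" using x t by (intro unit) auto
    then show ?thesis using x t by (simp add: place_divide[OF w] place_powi[OF w] mult.commute)
  qed
  have "w t \<ge> 0" using le[of t] t by simp
  obtain s where s: "s \<noteq> 0" "w s = 1" using place_uniformizer[OF w] by blast
  then have "w t * v s = 1" using eq by simp
  then have "w t = 1" using \<open>w t \<ge> 0\<close> by (auto simp: zmult_eq_1_iff)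
  show ?thesis
  proof
    fix x show "v x = w x" using eq[of x] \<open>w t = 1\<close> place_0[OF v] place_0[OF w] by (cases "x = 0") auto
  qed
qed

lemma place_separating_pair:
  fixes v w :: "'k::field \<Rightarrow> int"
  assumes v: "is_place v" and w: "is_place w" and ne: "v \<noteq> w"
  shows "\<exists>x. x \<noteq> 0 \<and> w x < 0 \<and> v x > 0"
proof -
  obtain a where a: "a \<noteq> 0" "w a \<ge> 0" "v a < 0" using place_eq_if_le[OF w v] ne by (metis not_le)
  obtain b where b: "b \<noteq> 0" "v b \<ge> 0" "w b < 0" using place_eq_if_le[OF v w] ne by (metis not_le)
  show ?thesis using a b by (intro exI[of _ "b / a"]) (simp add: place_divide[OF v] place_divide[OF w])
qed

text \<open>The Artin-Whaples induction: x works for the old places, y separates \<open>w\<close>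
  from the new place v'. Depending on the sign of v'(x), one takes x, x^m y, or x^m y / (1 +
  x^m).\<close>

lemma place_separating:
  fixes w :: "'k::field \<Rightarrow> int"
  assumes "finite V" and w: "is_place w" and "\<And>v. v \<in> V \<Longrightarrow> is_place v" and "w \<notin> V"
  shows "\<exists>x. x \<noteq> 0 \<and> w x < 0 \<and> (\<forall>v\<in>V. v x > 0)"
  using assms(1,3,4)
proof (induction V)
  case empty
  obtain t where "t \<noteq> 0" "w t = 1" using place_uniformizer[OF w] by blast
  then show ?case by (intro exI[of _ "inverse t"]) (simp add: place_inverse[OF w])
next
  case (insert v' V)
  obtain x where x: "x \<noteq> 0" "w x < 0" "\<And>v. v \<in> V \<Longrightarrow> v x > 0" using insert by auto
  have v': "is_place v'" using insert by auto
  obtain y where y: "y \<noteq> 0" "w y < 0" "v' y > 0" using place_separating_pair[OF v' w] insert by auto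
  have vV: "is_place v" if "v \<in> V" for v using that insert by auto
  \<comment> \<open>Large enough for x^m to outweigh y at every place of \<open>V\<close>.\<close>
  define m where "m = Suc (\<Sum>v\<in>V. nat \<bar>v y\<bar>)"
  have big: "int m * v x + v y > 0" if v: "v \<in> V" for v
  proof -
    have "nat \<bar>v y\<bar> \<le> (\<Sum>v\<in>V. nat \<bar>v y\<bar>)" using v insert.hyps(1) by (intro member_le_sum) auto
    then have "nat \<bar>v y\<bar> < m" unfolding m_def by (rule le_imp_less_Suc)
    then have "int m > - v y" by linarith
    moreover have "int m * v x \<ge> int m * 1" using x(3)[OF v] by (intro mult_left_mono) auto
    ultimately show ?thesis by simp
  qed
  have m: "m > 0" by (simp add: m_def)
  consider "v' x > 0" | "v' x = 0" | "v' x < 0" by linarith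
  then show ?case
  proof cases
    case 1
    then show ?thesis using x by blast
  next
    case 2
    have val: "u (x ^ m * y) = int m * u x + u y" if "is_place u" for u
      using x y by (simp add: place_mult[OF that] place_power[OF that])
    have "int m * w x < 0" using x m by (simp add: mult_less_0_iff)
    then show ?thesis
      using x y 2 big val[OF w] val[OF v'] val[OF vV] by (intro exI[of _ "x ^ m * y"]) auto
  next
    case 3
    have neg: "1 + x ^ m \<noteq> 0 \<and> u (1 + x ^ m) = int m * u x" if u: "is_place u" and "u x < 0" for u
    proof -
      have lt: "int m * u x < 0" using that m by (simp add: mult_less_0_iff)
      have "vge u 1 (u (x ^ m) + 1)" using lt by (simp add: vge_def place_1[OF u] place_power[OF u])
      then have "x ^ m + 1 \<noteq> 0 \<and> u (x ^ m + 1) = u (x ^ m)"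
        using place_add_dominant[OF u, of "x ^ m" 1] x by auto
      then show ?thesis by (simp add: place_power[OF u] add.commute)
    qed
    have pos: "u (1 + x ^ m) = 0" if u: "is_place u" and "u x > 0" for u
    proof -
      have "int m * u x > 0" using that m by simp
      then have "vge u (x ^ m) (u 1 + 1)" by (simp add: vge_def place_1[OF u] place_power[OF u])
      then show ?thesis using place_add_dominant[OF u, of 1 "x ^ m"] by (simp add: place_1[OF u])
    qed
    have nz: "1 + x ^ m \<noteq> 0" using neg[OF w] x by blast
    \<comment> \<open>x^m / (1 + x^m) has value 0 at \<open>w\<close> and v', where x has a pole,
      and value m v(x) on \<open>V\<close>. So y keeps its sign at \<open>w\<close> and v' and is
      outweighed on \<open>V\<close>.\<close>
    define s where "s = x ^ m * y / (1 + x ^ m)"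
    have s: "s \<noteq> 0" using x y nz by (simp add: s_def)
    have val: "u s = int m * u x + u y - u (1 + x ^ m)" if "is_place u" for u
      using x y nz by (simp add: s_def place_divide[OF that] place_mult[OF that] place_power[OF that])
    have "w s < 0" using val[OF w] neg[OF w] x y by simp
    moreover have "v' s > 0" using val[OF v'] neg[OF v'] 3 y by simp
    moreover have "v s > 0" if "v \<in> V" for v
      using val[OF vV[OF that]] pos[OF vV[OF that]] x(3)[OF that] big[OF that] by simp
    ultimately show ?thesis using s by auto
  qed
qed

context global_field
begin

lemma adjoin_Fp_nonneg:
  fixes g :: 'k
  assumes v: "is_place v" and g: "vge v g 0" and a: "a \<in> adjoin Fp g"
  shows "vge v a 0"
proof -
  obtain b n where b: "a = (\<Sum>i\<le>n. b i * g ^ i)" "\<forall>i. b i \<in> Fp" using a by (auto simp: adjoin_def)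
  have "vge v (b i * g ^ i) 0" for i
    using vge_mult[OF v vge_Fp[OF v] vge_power[OF v g], of "b i" i] b by simp
  then show ?thesis unfolding b(1) by (intro vge_sum[OF v])
qed

text \<open>The degree over F_p(y) bounds the number of zeros of y: given n + 1 of them, functions
  with a pole at one and zeros at the others satisfy a relation over F_p[y]. Look at a coefficient
  containing the lowest power of y that occurs; at the corresponding zero of y its term strictly
  dominates.\<close>

lemma finite_positive_places:
  fixes y :: 'k
  shows "finite {v. is_place v \<and> v y > 0}"
proof (rule ccontr)
  assume inf: "infinite {v. is_place v \<and> v y > 0}"
  then obtain v0 where "is_place v0" "v0 y > 0" using not_finite_existsD by blast
  then have tr: "transc y" using transc_if_place[of v0 y] by simp
  obtain n where n: "\<And>x :: nat \<Rightarrow> 'k. \<exists>c. (\<forall>i\<le>n. c i \<in> adjoin Fp y) \<and> (\<exists>i\<le>n. c i \<noteq> 0) \<and> (\<Sum>i\<le>n. c i * x i) = 0"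
    using transc_finite_degree[OF tr] by blast
  have y0: "y \<noteq> 0" using \<open>is_place v0\<close> \<open>v0 y > 0\<close> place_0 by fastforce
  obtain V where V: "V \<subseteq> {v. is_place v \<and> v y > 0}" "finite V" "card V = Suc n"
    using infinite_arbitrarily_large[OF inf] by blast
  then obtain f where f: "bij_betw f {..n} V"
    using ex_bij_betw_nat_finite[OF V(2)] by (auto simp: atLeast0LessThan lessThan_Suc_atMost)
  have fV: "f i \<in> V" if "i \<le> n" for i using bij_betwE[OF f] that by auto
  have fp: "is_place (f i)" "f i y > 0" if "i \<le> n" for i using fV[OF that] V by auto
  have "\<exists>x. x \<noteq> 0 \<and> f i x < 0 \<and> (\<forall>v\<in>V - {f i}. v x > 0)" if "i \<le> n" for i
    using fV[OF that] V fp[OF that] by (intro place_separating) auto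
  then obtain x where x: "\<And>i. i \<le> n \<Longrightarrow> x i \<noteq> 0 \<and> f i (x i) < 0 \<and> (\<forall>v\<in>V - {f i}. v (x i) > 0)"
    by metis
  have fx: "f i (x j) > 0" if "i \<le> n" "j \<le> n" "i \<noteq> j" for i j
  proof -
    have "f i \<noteq> f j" using that f by (auto simp: bij_betw_def inj_on_def)
    then show ?thesis using x[OF that(2)] fV[OF that(1)] by auto
  qed
  obtain c where c: "\<forall>i\<le>n. c i \<in> adjoin Fp y" "\<exists>i\<le>n. c i \<noteq> 0" "(\<Sum>i\<le>n. c i * x i) = 0"
    using n[of x] by blast
  obtain b m where b: "\<And>i. i \<le> n \<Longrightarrow> c i = (\<Sum>j\<le>m. b i j * y ^ j)" "\<And>i j. i \<le> n \<Longrightarrow> b i j \<in> Fp"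
    using adjoin_common_degree[OF subring_Fp c(1)] by blast
  define P where "P j \<longleftrightarrow> j \<le> m \<and> (\<exists>i\<le>n. b i j \<noteq> 0)" for j
  have "\<exists>j. P j"
  proof (rule ccontr)
    assume "\<not> ?thesis"
    then have "c i = 0" if "i \<le> n" for i using that b(1)[OF that] by (auto simp: P_def intro!: sum.neutral)
    then show False using c(2) by auto
  qed
  \<comment> \<open>y^k is the lowest power in any of the coefficients. At a zero of y all of them
    have value at least k v(y), with equality for a coefficient in which y^k occurs.\<close>
  define k where "k = (LEAST j. P j)"
  have "P k" unfolding k_def by (rule LeastI_ex) fact
  then obtain i0 where i0: "i0 \<le> n" "b i0 k \<noteq> 0" "k \<le> m" by (auto simp: P_def)
  have low: "b i j = 0" if "i \<le> n" "j < k" for i j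
  proof -
    have "\<not> P j" using not_less_Least[of j P] that(2) by (simp add: k_def)
    then show ?thesis using that i0(3) by (auto simp: P_def)
  qed
  define v where "v = f i0"
  have v: "is_place v" "v y > 0" using fp i0 by (auto simp: v_def)
  have ky: "int j * v y \<ge> int k * v y" if "j \<ge> k" for j using that v by (intro mult_right_mono) auto
  have cge: "vge v (c i) (int k * v y)" if i: "i \<le> n" for i
    unfolding b(1)[OF i]
  proof (rule vge_sum[OF v(1)])
    fix j
    show "vge v (b i j * y ^ j) (int k * v y)"
    proof (cases "j < k")
      case False
      then have "vge v (y ^ j) (int k * v y)" using ky[of j] by (simp add: vge_def place_power[OF v(1)])
      then show ?thesis using vge_mult[OF v(1) vge_Fp[OF v(1) b(2)[OF i]]] by fastforce
    qed (simp add: low[OF i])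
  qed
  have ck: "c i0 \<noteq> 0 \<and> v (c i0) = int k * v y"
  proof -
    have bk: "v (b i0 k * y ^ k) = int k * v y"
      using i0 b(2) y0 by (simp add: place_mult[OF v(1)] place_power[OF v(1)] place_Fp[OF v(1)])
    have "c i0 = b i0 k * y ^ k + (\<Sum>j\<in>{..m} - {k}. b i0 j * y ^ j)"
      using b(1)[OF i0(1)] i0(3) by (simp add: sum.remove)
    moreover have "vge v (\<Sum>j\<in>{..m} - {k}. b i0 j * y ^ j) (v (b i0 k * y ^ k) + 1)"
    proof (rule vge_sum[OF v(1)])
      fix j assume j: "j \<in> {..m} - {k}"
      show "vge v (b i0 j * y ^ j) (v (b i0 k * y ^ k) + 1)"
      proof (cases "j < k")
        case False
        then have "j > k" using j by auto
        then have "int j * v y \<ge> (int k + 1) * v y" using v by (intro mult_right_mono) auto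
        then have "vge v (y ^ j) (v (b i0 k * y ^ k) + 1)"
          unfolding bk using v(2) by (simp add: vge_def place_power[OF v(1)] distrib_right)
        then show ?thesis using vge_mult[OF v(1) vge_Fp[OF v(1) b(2)[OF i0(1)]]] by fastforce
      qed (simp add: low[OF i0(1)])
    qed
    ultimately show ?thesis
      using place_add_dominant[OF v(1), of "b i0 k * y ^ k"] i0 y0 bk by simp
  qed
  have "(\<Sum>i\<le>n. c i * x i) \<noteq> 0"
  proof (rule place_sum_dominant[OF v(1), of _ i0])
    have xi0: "x i0 \<noteq> 0" "v (x i0) < 0" using x[OF i0(1)] by (auto simp: v_def)
    then show "c i0 * x i0 \<noteq> 0" using ck by simp
    have vi0: "v (c i0 * x i0) = int k * v y + v (x i0)" using xi0 ck by (simp add: place_mult[OF v(1)])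
    fix j assume j: "j \<in> {..n}" "j \<noteq> i0"
    then have "v (x j) > 0" using fx[OF i0(1), of j] by (auto simp: v_def)
    then have "vge v (x j) (v (x i0) + 1)" using xi0 by (simp add: vge_def)
    then show "vge v (c j * x j) (v (c i0 * x i0) + 1)"
      using vge_mult[OF v(1) cge[of j]] j by (simp add: vi0 add.assoc)
  qed (use i0 in auto)
  then show False using c(3) by simp
qed

lemma finite_nonunit_places:
  fixes y :: 'k
  shows "finite {v. is_place v \<and> v y \<noteq> 0}"
proof -
  have "{v. is_place v \<and> v y \<noteq> 0} \<subseteq> {v. is_place v \<and> v y > 0} \<union> {v. is_place v \<and> v (inverse y) > 0}"
    by (auto simp: place_inverse)
  moreover have "finite ({v. is_place v \<and> v y > 0} \<union> {v. is_place v \<and> v (inverse y) > 0})"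
    by (intro finite_UnI finite_positive_places)
  ultimately show ?thesis by (rule finite_subset)
qed

section \<open>Residues of powers and approximation of 1 by powers\<close>

text \<open>Modulo the maximal ideal all powers of g lie in the F_p-span of 1, ..., g^(d-1).
  Coefficient functions are extensional so that only finitely many exist, as the pigeonhole argument
  requires.\<close>

lemma residue_power_combination:
  fixes g :: 'k
  assumes v: "is_place v" and g: "v g = 0" "g \<noteq> 0"
    and rel: "\<forall>j<d. \<mu> j \<in> Fp" "vge v (g ^ d - (\<Sum>j<d. \<mu> j * g ^ j)) 1"
  shows "\<exists>l\<in>{..<d} \<rightarrow>\<^sub>E Fp. vge v (g ^ i - (\<Sum>j<d. l j * g ^ j)) 1"
proof -
  note cl = subring_set_closed[OF subring_Fp]
  have "\<exists>l. (\<forall>j<d. l j \<in> Fp) \<and> vge v (g ^ i - (\<Sum>j<d. l j * g ^ j)) 1"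
  proof (induction i)
    case 0
    show ?case
    proof (cases d)
      case 0
      then show ?thesis using rel by auto
    next
      case (Suc d')
      have "(\<Sum>j<d. (if j = 0 then 1 else 0) * g ^ j) = 1"
        unfolding Suc by (subst sum.lessThan_Suc_shift) simp
      then show ?thesis by (intro exI[of _ "\<lambda>j. if j = 0 then 1 else 0"]) (auto intro: cl)
    qed
  next
    case (Suc i)
    then obtain l where l: "\<forall>j<d. l j \<in> Fp" "vge v (g ^ i - (\<Sum>j<d. l j * g ^ j)) 1" by blast
    have g1: "vge v (g * (g ^ i - (\<Sum>j<d. l j * g ^ j))) 1"
      using vge_mult[OF v _ l(2), of g 0] g by (simp add: vge_def)
    show ?case
    proof (cases d)
      case 0
      then show ?thesis using g1 by auto
    next
      case (Suc d')
      \<comment> \<open>Multiplication by g shifts the coefficients; the overflow g^d is rewritten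
        with the relation \<open>\<mu>\<close>.\<close>
      define l' where "l' j = (case j of 0 \<Rightarrow> 0 | Suc j \<Rightarrow> l j) + l d' * \<mu> j" for j
      have shift: "(\<Sum>j<d'. l j * g ^ Suc j) = (\<Sum>j<d. (case j of 0 \<Rightarrow> 0 | Suc i \<Rightarrow> l i) * g ^ j)"
        unfolding Suc by (subst sum.lessThan_Suc_shift) simp
      have "g * (\<Sum>j<d. l j * g ^ j) = (\<Sum>j<d'. l j * g ^ Suc j) + l d' * g ^ d"
        by (simp add: Suc sum_distrib_left algebra_simps)
      moreover have "(\<Sum>j<d. l' j * g ^ j) = (\<Sum>j<d'. l j * g ^ Suc j) + l d' * (\<Sum>j<d. \<mu> j * g ^ j)"
        unfolding shift by (simp add: l'_def distrib_right sum.distrib sum_distrib_left mult.assoc)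
      ultimately have "g ^ Suc i - (\<Sum>j<d. l' j * g ^ j)
          = g * (g ^ i - (\<Sum>j<d. l j * g ^ j)) + l d' * (g ^ d - (\<Sum>j<d. \<mu> j * g ^ j))"
        by (simp add: algebra_simps)
      moreover have "vge v (l d' * (g ^ d - (\<Sum>j<d. \<mu> j * g ^ j))) 1"
        using vge_mult[OF v vge_Fp[OF v] rel(2), of "l d'"] l(1) Suc by simp
      ultimately have "vge v (g ^ Suc i - (\<Sum>j<d. l' j * g ^ j)) 1"
        using g1 by (simp add: vge_add[OF v])
      moreover have "\<forall>j<d. l' j \<in> Fp"
        using l(1) rel(1) Suc unfolding l'_def by (auto intro!: cl split: nat.split)
      ultimately show ?thesis by blast
    qed
  qed
  then obtain l where l: "\<forall>j<d. l j \<in> Fp" "vge v (g ^ i - (\<Sum>j<d. l j * g ^ j)) 1" by blast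
  have "(\<Sum>j<d. restrict l {..<d} j * g ^ j) = (\<Sum>j<d. l j * g ^ j)" by (rule sum.cong) auto
  then show ?thesis using l by (intro bexI[of _ "restrict l {..<d}"]) auto
qed

text \<open>The residue of g is algebraic over F_p: in a relation of a uniformizer over F_p[g] some
  nonzero coefficient must vanish at v, since otherwise the nonzero terms would have distinct
  values. So powers of g have finitely many residues, and two of them agree.\<close>

lemma residue_order_ex:
  fixes g :: 'k
  assumes v: "is_place v" and g: "v g = 0" and tr: "transc g"
  shows "\<exists>k>0. vge v (g ^ k - 1) 1"
proof -
  obtain n where n: "\<And>x :: nat \<Rightarrow> 'k. \<exists>c. (\<forall>i\<le>n. c i \<in> adjoin Fp g) \<and> (\<exists>i\<le>n. c i \<noteq> 0) \<and> (\<Sum>i\<le>n. c i * x i) = 0"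
    using transc_finite_degree[OF tr] by blast
  obtain t where t: "t \<noteq> 0" "v t = 1" using place_uniformizer[OF v] by blast
  obtain c where c: "\<forall>i\<le>n. c i \<in> adjoin Fp g" "\<exists>i\<le>n. c i \<noteq> 0" "(\<Sum>i\<le>n. c i * t ^ i) = 0"
    using n[of "\<lambda>i. t ^ i"] by blast
  have g0: "vge v g 0" using g by (simp add: vge_def)
  have gnz: "g \<noteq> 0"
  proof
    assume "g = 0"
    then have "(\<Sum>i\<le>1. of_nat i * g ^ i) = 0" by simp
    then have "of_nat 1 = (0::'k)"
      by (rule transcD[OF tr, of 1 of_nat, rotated]) (auto simp: Fp_def intro: range_eqI[of _ _ "int _"])
    then show False by simp
  qed
  have "\<exists>i\<le>n. c i \<noteq> 0 \<and> v (c i) > 0"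
  proof (rule ccontr)
    assume H: "\<not> ?thesis"
    have c0: "v (c i) = 0" if "i \<le> n" "c i \<noteq> 0" for i
      using H that adjoin_Fp_nonneg[OF v g0, of "c i"] c(1) by (force simp: vge_def)
    define k where "k = (LEAST i. i \<le> n \<and> c i \<noteq> 0)"
    have k: "k \<le> n" "c k \<noteq> 0" using LeastI_ex[OF c(2)] by (auto simp: k_def)
    have low: "c i = 0" if "i < k" for i
      using not_less_Least[of i "\<lambda>i. i \<le> n \<and> c i \<noteq> 0"] that k by (auto simp: k_def)
    have val: "v (c i * t ^ i) = int i" if "i \<le> n" "c i \<noteq> 0" for i
      using that t by (simp add: place_mult[OF v] place_power[OF v] c0)
    have "(\<Sum>i\<le>n. c i * t ^ i) \<noteq> 0"
    proof (rule place_sum_dominant[OF v, of _ k])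
      fix j assume j: "j \<in> {..n}" "j \<noteq> k"
      show "vge v (c j * t ^ j) (v (c k * t ^ k) + 1)"
      proof (cases "c j = 0")
        case False
        then have "j > k" using low[of j] j by (cases "j < k") auto
        then show ?thesis using val[of j] val[of k] k j False by (simp add: vge_def)
      qed simp
    qed (use k t in auto)
    then show False using c(3) by simp
  qed
  then obtain a where a: "a \<in> adjoin Fp g" "a \<noteq> 0" "v a > 0" using c(1) by blast
  obtain b m where b: "a = (\<Sum>i\<le>m. b i * g ^ i)" "\<forall>i. b i \<in> Fp" using a by (auto simp: adjoin_def)
  have "\<exists>i\<le>m. b i \<noteq> 0"
  proof (rule ccontr)
    assume "\<not> ?thesis"
    then have "a = 0" unfolding b(1) by (intro sum.neutral) auto
    then show False using a by simp
  qed
  define d where "d = (GREATEST j. j \<le> m \<and> b j \<noteq> 0)"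
  have d: "d \<le> m" "b d \<noteq> 0"
    using GreatestI_ex_nat[of "\<lambda>j. j \<le> m \<and> b j \<noteq> 0" m] \<open>\<exists>i\<le>m. b i \<noteq> 0\<close> by (auto simp: d_def)
  have top: "b j = 0" if "d < j" "j \<le> m" for j
    using Greatest_le_nat[of "\<lambda>j. j \<le> m \<and> b j \<noteq> 0" j m] that by (auto simp: d_def)
  have "a = (\<Sum>j\<le>d. b j * g ^ j)"
    unfolding b(1) using d top by (intro sum.mono_neutral_right) auto
  then have ad: "a = (\<Sum>j<d. b j * g ^ j) + b d * g ^ d" by (simp add: lessThan_Suc_atMost[symmetric])
  define \<mu> where "\<mu> j = - (inverse (b d) * b j)" for j
  have binv: "inverse (b d) \<in> Fp" using b(2) subfield_Fp by (simp add: subfield_set_def)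
  have \<mu>: "\<forall>j<d. \<mu> j \<in> Fp"
    unfolding \<mu>_def using b(2) binv by (intro allI impI subring_set_closed(4,5)[OF subring_Fp]) auto
  have "(\<Sum>j<d. \<mu> j * g ^ j) = - (inverse (b d) * (\<Sum>j<d. b j * g ^ j))"
    by (simp add: \<mu>_def sum_negf sum_distrib_left mult.assoc)
  then have "g ^ d - (\<Sum>j<d. \<mu> j * g ^ j) = inverse (b d) * a"
    using d(2) by (simp add: ad distrib_left)
  moreover have "vge v (inverse (b d) * a) 1"
    using vge_mult[OF v vge_Fp[OF v binv], of a 1] a by (simp add: vge_def)
  ultimately have rel: "vge v (g ^ d - (\<Sum>j<d. \<mu> j * g ^ j)) 1" by simp
  obtain l where l: "\<And>i. l i \<in> {..<d} \<rightarrow>\<^sub>E Fp" "\<And>i. vge v (g ^ i - (\<Sum>j<d. l i j * g ^ j)) 1"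
    using residue_power_combination[OF v g gnz \<mu> rel] by metis
  have "finite (range l)"
    using l(1) by (intro finite_subset[OF _ finite_PiE[of "{..<d}" "\<lambda>_. Fp"]]) (auto simp: finite_Fp)
  then have "\<not> inj l" using finite_imageD by blast
  then obtain i j where ij: "i < j" "l i = l j" unfolding inj_def by (metis linorder_neqE_nat)
  have "vge v (g ^ j - g ^ i) 1"
    using vge_diff[OF v l(2)[of j] l(2)[of i]] ij by simp
  moreover have "g ^ j - g ^ i = g ^ i * (g ^ (j - i) - 1)"
    using ij by (simp add: right_diff_distrib flip: power_add)
  ultimately have "vge v (g ^ (j - i) - 1) 1"
    using vge_mult_iff[OF v, of "g ^ i" "g ^ (j - i) - 1" 1] gnz g by (simp add: place_power[OF v])
  then show ?thesis using ij by (intro exI[of _ "j - i"]) auto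
qed

end

lemma vge_power_minus_1:
  assumes v: "is_place v" and h: "vge v h 0" and N: "vge v (h - 1) N"
  shows "vge v (h ^ m - 1) N"
proof -
  have "vge v (\<Sum>i<m. h ^ i) 0" using h by (intro vge_sum[OF v] vge_power[OF v])
  then show ?thesis using vge_mult[OF v N] by (fastforce simp: power_diff_1_eq)
qed

context global_field
begin

text \<open>If k is close to 1, the sum of k^i over i < p has residue p = 0, so each p-th power
  gains at least one order of contact with 1.\<close>

lemma vge_power_p_minus_1:
  fixes h :: 'k
  assumes v: "is_place v" and h: "vge v h 0" and N: "vge v (h - 1) 1"
  shows "vge v (h ^ (p ^ r) - 1) (int r + 1)"
proof (induction r)
  case 0
  then show ?case using N by simp
next
  case (Suc r)
  define k where "k = h ^ (p ^ r)"
  have k: "vge v k 0" using h by (simp add: k_def vge_power[OF v])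
  have k1: "vge v (k - 1) 1" unfolding k_def using vge_power_minus_1[OF v h N] .
  have "(\<Sum>i<p. k ^ i) = (\<Sum>i<p. k ^ i - 1)" by (simp add: sum_subtractf)
  also have "vge v \<dots> 1" using vge_power_minus_1[OF v k k1] by (intro vge_sum[OF v])
  finally have "vge v ((k - 1) * (\<Sum>i<p. k ^ i)) (int r + 1 + 1)"
    by (rule vge_mult[OF v Suc[folded k_def]])
  then have "vge v (k ^ p - 1) (int (Suc r) + 1)" by (simp add: power_diff_1_eq add.commute)
  moreover have "k ^ p = h ^ p ^ Suc r" by (simp add: k_def power_mult[symmetric] mult.commute)
  ultimately show ?case by simp
qed

lemma of_nat_nonzero:
  assumes "\<not> p dvd m"
  shows "of_nat m \<noteq> (0::'k)"
proof
  assume m: "of_nat m = (0::'k)"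
  have "coprime (int p) (int m)" using assms prime_p by (intro prime_imp_coprime) auto
  then obtain u w where "u * int p + w * int m = 1" using bezout_int[of "int p" "int m"] by auto
  then have "of_int (u * int p + w * int m) = (1::'k)" by simp
  then show False using m by simp
qed

text \<open>The geometric sum of m powers of h has residue m, which is nonzero. Consequently only
  the p-part of an exponent can improve the approximation to 1.\<close>

lemma place_power_coprime_minus_1:
  fixes h :: 'k
  assumes v: "is_place v" and h: "vge v h 0" and N: "vge v (h - 1) 1" and m: "\<not> p dvd m" and h1: "h \<noteq> 1"
  shows "h ^ m \<noteq> 1" "v (h ^ m - 1) = v (h - 1)"
proof -
  have "of_nat m \<in> (Fp :: 'k set)" unfolding Fp_def by (rule range_eqI[of _ _ "int m"]) simp
  then have vm: "v (of_nat m :: 'k) = 0" by (rule place_Fp[OF v])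
  have "vge v (\<Sum>i<m. h ^ i - 1) 1" using vge_power_minus_1[OF v h N] by (intro vge_sum[OF v])
  then have "vge v (\<Sum>i<m. h ^ i - 1) (v (of_nat m :: 'k) + 1)" using vm by simp
  from place_add_dominant[OF v of_nat_nonzero[OF m] this]
  have s: "(\<Sum>i<m. h ^ i) \<noteq> 0" "v (\<Sum>i<m. h ^ i) = 0"
    using vm by (simp_all add: sum_subtractf)
  then show "h ^ m \<noteq> 1" "v (h ^ m - 1) = v (h - 1)"
    using h1 power_diff_1_eq[of h m] by (auto simp: place_mult[OF v] dest: sym)
qed

lemma common_residue_order:
  fixes g :: 'k
  assumes "finite V" and "\<And>v. v \<in> V \<Longrightarrow> is_place v \<and> v g = 0" and tr: "transc g"
  shows "\<exists>k>0. \<forall>v\<in>V. vge v (g ^ k - 1) 1"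
  using assms(1,2)
proof (induction V)
  case empty
  then show ?case by auto
next
  case (insert w V)
  then obtain k where k: "k > 0" "\<And>v. v \<in> V \<Longrightarrow> vge v (g ^ k - 1) 1" by auto
  obtain l where l: "l > 0" "vge w (g ^ l - 1) 1" using residue_order_ex[of w, OF _ _ tr] insert.prems[of w] by blast
  have "vge v (g ^ (k * l) - 1) 1" if v: "v \<in> insert w V" for v
  proof -
    have pv: "is_place v" "vge v g 0" using insert.prems[OF v] by (auto simp: vge_def)
    show ?thesis
    proof (cases "v = w")
      case True
      then show ?thesis
        using vge_power_minus_1[OF pv(1) vge_power[OF pv], of l 1 k] l by (simp add: power_mult[symmetric] mult.commute)
    next
      case False
      then show ?thesis
        using vge_power_minus_1[OF pv(1) vge_power[OF pv], of k 1 l] k v by (simp add: power_mult[symmetric])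
    qed
  qed
  then show ?case using k l by (intro exI[of _ "k * l"]) auto
qed

lemma common_power_close_to_1:
  fixes g :: 'k
  assumes V: "finite V" "\<And>v. v \<in> V \<Longrightarrow> is_place v \<and> v g = 0" and tr: "transc g"
  shows "\<exists>Q>0. \<forall>v\<in>V. vge v (g ^ Q - 1) N"
proof -
  obtain k where k: "k > 0" "\<And>v. v \<in> V \<Longrightarrow> vge v (g ^ k - 1) 1"
    using common_residue_order[OF V tr] by auto
  have "vge v (g ^ (k * p ^ nat N) - 1) N" if v: "v \<in> V" for v
  proof -
    have pv: "is_place v" "vge v g 0" using V(2)[OF v] by (auto simp: vge_def)
    show ?thesis
      using vge_power_p_minus_1[OF pv(1) vge_power[OF pv] k(2)[OF v], of "nat N"]
      by (auto simp: power_mult intro: vge_mono)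
  qed
  then show ?thesis using k prime_gt_0_nat[OF prime_p] by (intro exI[of _ "k * p ^ nat N"]) auto
qed

text \<open>A variant of Euclid's argument: if there were finitely many places, one exponent k would
  serve all places where t is a unit. Then 1 + t (t^k - 1) has poles exactly where t has and value 0
  elsewhere, so its inverse has a zero but no pole.\<close>

lemma infinitely_many_places: "infinite (places :: ('k \<Rightarrow> int) set)"
proof
  assume fin: "finite (places :: ('k \<Rightarrow> int) set)"
  have "\<exists>t::'k. transc t" using transc_basis_ex by (elim exE conjE) (rule exI)
  then obtain t :: 'k where t: "transc t" by (rule exE)
  have pl: "is_place v" if "v \<in> places" for v :: "'k \<Rightarrow> int" using that by (simp add: places_def)
  have "\<exists>k>0. \<forall>v\<in>{v \<in> places. v t = 0}. vge v (t ^ k - 1) 1"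
    by (rule common_residue_order[OF _ _ t]) (use fin pl in auto)
  then obtain k where k: "k > 0" "\<And>v. v \<in> {v \<in> places. v t = 0} \<Longrightarrow> vge v (t ^ k - 1) 1"
    by blast
  obtain v0 where v0: "is_place v0" "v0 t < 0" using transc_negative_place[OF t] by blast
  have t0: "t \<noteq> 0" using v0 place_0 by force
  define y where "y = 1 + t * (t ^ k - 1)"
  have neg: "y \<noteq> 0 \<and> v y < 0" if v: "is_place v" and vt: "v t < 0" for v
  proof -
    have lt: "int k * v t < 0" using k vt by (simp add: mult_less_0_iff)
    have "vge v (- 1) (v (t ^ k) + 1)"
      using lt place_minus[OF v, of 1] by (simp add: vge_def place_power[OF v] place_1[OF v])
    from place_add_dominant[OF v _ this]
    have tk: "t ^ k - 1 \<noteq> 0" "v (t ^ k - 1) = int k * v t" using t0 by (simp_all add: place_power[OF v])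
    then have val: "v (t * (t ^ k - 1)) = v t + int k * v t" using t0 by (simp add: place_mult[OF v])
    then have "vge v 1 (v (t * (t ^ k - 1)) + 1)" using vt lt by (simp add: vge_def place_1[OF v])
    from place_add_dominant[OF v _ this] show ?thesis
      using tk t0 val vt lt by (simp add: y_def add.commute)
  qed
  have nonneg: "v y = 0" if v: "is_place v" and vt: "v t \<ge> 0" for v
  proof -
    have vt': "vge v t 0" using vt by (simp add: vge_def)
    have "vge v (t * (t ^ k - 1)) 1"
    proof (cases "v t = 0")
      case True
      then show ?thesis using vge_mult[OF v vt' k(2)[of v]] v by (simp add: places_def)
    next
      case False
      then have "vge v t 1" using vt by (simp add: vge_def)
      moreover have "vge v (t ^ k - 1) 0" using vt' by (intro vge_diff[OF v] vge_power[OF v] vge_1[OF v])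
      ultimately show ?thesis using vge_mult[OF v] by fastforce
    qed
    then show ?thesis
      using place_add_dominant(2)[OF v, of 1] by (simp add: y_def place_1[OF v])
  qed
  have "vge v (inverse y) 0" if "is_place v" for v
    using neg[OF that] nonneg[OF that] by (cases "v t < 0") (auto simp: vge_def place_inverse[OF that])
  then have "v0 (inverse y) = 0" using nonneg_everywhere_imp_constant[OF _ v0(1)] by blast
  then show False using neg[OF v0] by (simp add: place_inverse[OF v0(1)])
qed

section \<open>Pole orders and denominators\<close>

text \<open>The bound \<open>int e * min 0 (v g)\<close> uses one number e for all places: poles are
  allowed only at poles of g, in proportion to the order there. This is the weight in which
  coefficients are measured from here on.\<close>

lemma adjoin_Fp_weight:
  fixes g :: 'k
  assumes "a \<in> adjoin Fp g"
  shows "\<exists>e::nat. \<forall>v. is_place v \<longrightarrow> vge v a (int e * min 0 (v g))"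
proof -
  obtain b n where b: "a = (\<Sum>i\<le>n. b i * g ^ i)" "\<forall>i. b i \<in> Fp" using assms by (auto simp: adjoin_def)
  have "vge v a (int n * min 0 (v g))" if v: "is_place v" for v
    unfolding b(1)
  proof (rule vge_sum[OF v])
    fix i assume i: "i \<in> {..n}"
    have "int n * min 0 (v g) \<le> int i * min 0 (v g)" using i by (intro mult_right_mono_neg) auto
    also have "\<dots> \<le> int i * v g" by (intro mult_left_mono) auto
    finally have "vge v (g ^ i) (int n * min 0 (v g))" by (simp add: vge_def place_power[OF v])
    then show "vge v (b i * g ^ i) (int n * min 0 (v g))"
      using vge_mult[OF v vge_Fp[OF v]] b(2) by fastforce
  qed
  then show ?thesis by blast
qed

text \<open>The leading coefficient of an equation for c over F_p[g] is the denominator: if its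
  product with c had a larger pole than the weight allows, c would have a pole and the leading term
  would dominate the equation.\<close>

lemma denominator_ex:
  fixes g c :: 'k
  assumes g: "transc g"
  shows "\<exists>q e. q \<noteq> 0 \<and> (\<forall>v. is_place v \<longrightarrow> vge v q (int e * min 0 (v g)) \<and> vge v (q * c) (int e * min 0 (v g)))"
proof -
  obtain n where n: "\<And>x :: nat \<Rightarrow> 'k. \<exists>a. (\<forall>i\<le>n. a i \<in> adjoin Fp g) \<and> (\<exists>i\<le>n. a i \<noteq> 0) \<and> (\<Sum>i\<le>n. a i * x i) = 0"
    using transc_finite_degree[OF g] by blast
  obtain a where a: "\<forall>i\<le>n. a i \<in> adjoin Fp g" "\<exists>i\<le>n. a i \<noteq> 0" "(\<Sum>i\<le>n. a i * c ^ i) = 0"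
    using n[of "\<lambda>i. c ^ i"] by blast
  have "\<forall>i. \<exists>e::nat. i \<le> n \<longrightarrow> (\<forall>v. is_place v \<longrightarrow> vge v (a i) (int e * min 0 (v g)))"
    using a(1) adjoin_Fp_weight by blast
  then obtain e where e: "\<And>i v. i \<le> n \<Longrightarrow> is_place v \<Longrightarrow> vge v (a i) (int (e i) * min 0 (v g))" by metis
  define D where "D = (\<Sum>i\<le>n. e i)"
  have D: "vge v (a i) (int D * min 0 (v g))" if "i \<le> n" "is_place v" for i v
  proof -
    have "e i \<le> D" using that unfolding D_def by (intro member_le_sum) auto
    then have "int D * min 0 (v g) \<le> int (e i) * min 0 (v g)" by (intro mult_right_mono_neg) auto
    then show ?thesis using e[OF that] vge_mono by blast
  qed
  define m where "m = (GREATEST j. j \<le> n \<and> a j \<noteq> 0)"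
  have m: "m \<le> n" "a m \<noteq> 0"
    using GreatestI_ex_nat[of "\<lambda>j. j \<le> n \<and> a j \<noteq> 0" n] a(2) by (auto simp: m_def)
  have top: "a j = 0" if "m < j" "j \<le> n" for j
    using Greatest_le_nat[of "\<lambda>j. j \<le> n \<and> a j \<noteq> 0" j n] that by (auto simp: m_def)
  have sum_m: "(\<Sum>i\<le>m. a i * c ^ i) = 0"
  proof -
    have "(\<Sum>i\<le>n. a i * c ^ i) = (\<Sum>i\<le>m. a i * c ^ i)"
      using m top by (intro sum.mono_neutral_right) auto
    then show ?thesis using a(3) by simp
  qed
  have "vge v (a m * c) (int D * min 0 (v g))" if v: "is_place v" for v
  proof (rule ccontr)
    define \<delta> where "\<delta> = int D * min 0 (v g)"
    assume "\<not> ?thesis"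
    then have nz: "c \<noteq> 0" and lt: "v (a m) + v c < \<delta>"
      using m by (auto simp: vge_def \<delta>_def place_mult[OF v] not_le)
    have "\<delta> \<le> v (a m)" using D[OF m(1) v] m by (simp add: vge_def \<delta>_def)
    then have c_neg: "v c < 0" using lt by simp
    have "(\<Sum>i\<le>m. a i * c ^ i) \<noteq> 0"
    proof (rule place_sum_dominant[OF v, of _ m])
      show "a m * c ^ m \<noteq> 0" using m nz by simp
      fix j assume j: "j \<in> {..m}" "j \<noteq> m"
      show "vge v (a j * c ^ j) (v (a m * c ^ m) + 1)"
      proof (cases "a j = 0")
        case False
        have "\<delta> \<le> v (a j)" using D[of j v] j m v False by (simp add: vge_def \<delta>_def)
        moreover have "int m * v c \<le> (int j + 1) * v c" using j c_neg by (intro mult_right_mono_neg) auto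
        ultimately have "v (a m) + int m * v c + 1 \<le> v (a j) + int j * v c"
          using lt by (simp add: algebra_simps)
        then show ?thesis
          using False m nz by (simp add: vge_def place_mult[OF v] place_power[OF v])
      qed simp
    qed auto
    then show False using sum_m by simp
  qed
  then show ?thesis using m D[OF m(1)] by blast
qed

lemma common_denominator_ex:
  fixes g :: 'k and c :: "'i \<Rightarrow> 'k"
  assumes g: "transc g" and "finite I"
  shows "\<exists>q e. q \<noteq> 0 \<and> (\<forall>v. is_place v \<longrightarrow> vge v q (int e * min 0 (v g)) \<and>
      (\<forall>i\<in>I. vge v (q * c i) (int e * min 0 (v g))))"
  using assms(2)
proof (induction I)
  case empty
  then show ?case by (intro exI[of _ 1] exI[of _ 0]) (auto intro: vge_1)
next
  case (insert j I)
  then obtain q e where q: "q \<noteq> 0" "\<And>v. is_place v \<Longrightarrow> vge v q (int e * min 0 (v g))"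
    "\<And>v i. is_place v \<Longrightarrow> i \<in> I \<Longrightarrow> vge v (q * c i) (int e * min 0 (v g))" by blast
  obtain r f where r: "r \<noteq> 0" "\<And>v. is_place v \<Longrightarrow> vge v r (int f * min 0 (v g))"
    "\<And>v. is_place v \<Longrightarrow> vge v (r * c j) (int f * min 0 (v g))" using denominator_ex[OF g, of "c j"] by blast
  have ef: "int (e + f) * min 0 (v g) = int e * min 0 (v g) + int f * min 0 (v g)" for v
    by (simp add: distrib_right)
  show ?case
  proof (intro exI[of _ "q * r"] exI[of _ "e + f"] conjI allI impI ballI)
    show "q * r \<noteq> 0" using q r by simp
    fix v :: "'k \<Rightarrow> int" assume v: "is_place v"
    show "vge v (q * r) (int (e + f) * min 0 (v g))"
      unfolding ef using q r v by (intro vge_mult[OF v]) auto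
    fix i assume i: "i \<in> insert j I"
    show "vge v (q * r * c i) (int (e + f) * min 0 (v g))"
    proof (cases "i = j")
      case True
      then show ?thesis unfolding ef using vge_mult[OF v q(2)[OF v] r(3)[OF v]] by (simp add: mult.assoc)
    next
      case False
      then have "i \<in> I" using i by simp
      then show ?thesis
        unfolding ef using vge_mult[OF v q(3)[OF v] r(2)[OF v], of i] by (simp add: ac_simps)
    qed
  qed
qed

end

section \<open>Vanishing of sums of powers\<close>

lemma place_power_minus_1_pos:
  assumes v: "is_place v" and g: "v g > 0" and n: "n > 0"
  shows "g ^ n - 1 \<noteq> 0" "v (g ^ n - 1) = 0"
proof -
  have "vge v (g ^ n) (v (- 1) + 1)"
    using g n by (auto simp: vge_def place_power[OF v] place_minus[OF v] place_1[OF v] zero_less_mult_iff int_one_le_iff_zero_less)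
  from place_add_dominant[OF v _ this] show "g ^ n - 1 \<noteq> 0" "v (g ^ n - 1) = 0"
    by (simp_all add: place_minus[OF v] place_1[OF v])
qed

lemma place_power_minus_1_neg:
  assumes v: "is_place v" and g: "v g < 0" and n: "n > 0"
  shows "g ^ n - 1 \<noteq> 0" "v (g ^ n - 1) = int n * v g"
proof -
  have g0: "g \<noteq> 0" using g place_0[OF v] by auto
  have "int n * v g < 0" using g n by (simp add: mult_less_0_iff)
  then have "vge v (- 1) (v (g ^ n) + 1)"
    by (simp add: vge_def place_power[OF v] place_minus[OF v] place_1[OF v])
  from place_add_dominant[OF v _ this] show "g ^ n - 1 \<noteq> 0" "v (g ^ n - 1) = int n * v g"
    using g0 by (simp_all add: place_power[OF v])
qed

text \<open>At a place where g is a unit, moving an exponent by a multiple of L changes the power by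
  a multiple of g^L - 1; symmetry reduces this to a >= b.\<close>

lemma vge_powi_diff:
  assumes v: "is_place v" and g: "g \<noteq> 0" "v g = 0" and L: "int L dvd a - b"
  shows "vge v (g powi a - g powi b) (v (g ^ L - 1))"
proof -
  have aux: "vge v (g powi a - g powi b) (v (g ^ L - 1))" if k: "a - b = int L * int k" for a b k
  proof -
    have "a = b + int (L * k)" using k by simp
    then have "g powi a = g powi b * (g ^ L) ^ k"
      using power_int_add[of g b "int (L * k)"] g(1)
      by (simp only: power_int_of_nat power_mult) blast
    then have "g powi a - g powi b = g powi b * ((g ^ L) ^ k - 1)" by (simp add: right_diff_distrib)
    moreover have "vge v ((g ^ L) ^ k - 1) (v (g ^ L - 1))"
      using g by (intro vge_power_minus_1[OF v] vge_self) (simp add: vge_def place_power[OF v])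
    ultimately show ?thesis
      using vge_mult_iff[OF v, of "g powi b"] g by (simp add: place_powi[OF v])
  qed
  obtain m where m: "a - b = int L * m" using L by (auto simp: dvd_def)
  show ?thesis
  proof (cases "m \<ge> 0")
    case True
    then show ?thesis using aux[of a b "nat m"] m by simp
  next
    case False
    have "b - a = int L * int (nat (- m))" using m False by (simp add: algebra_simps)
    then show ?thesis using aux[of b a "nat (- m)"] vge_commute[OF v] by blast
  qed
qed

text \<open>Of B + 1 consecutive blocks of width w one contains no residue, and a rotation moves its
  end to L. Reduction modulo L alone could leave exponents just below L, where the pole orders would
  not stay under that of g^L - 1.\<close>

lemma residues_avoid_block:
  fixes h :: "'i \<Rightarrow> int" and L w B :: nat
  assumes I: "finite I" "card I \<le> B" and w: "w > 0" and L: "(B + 1) * w \<le> L"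
  shows "\<exists>\<rho>. \<forall>i\<in>I. (h i + \<rho>) mod int L < int L - int w"
proof -
  define r where "r i = nat (h i mod int L)" for i
  have Lpos: "L > 0" using L w by (cases L) auto
  have "card ((\<lambda>i. r i div w) ` I) \<le> B" using card_image_le[OF I(1)] I(2) le_trans by blast
  then have "\<not> {..B} \<subseteq> (\<lambda>i. r i div w) ` I"
    using card_mono[OF finite_imageI[OF I(1)], of "{..B}" "\<lambda>i. r i div w"] by auto
  then obtain t where t: "t \<le> B" "\<And>i. i \<in> I \<Longrightarrow> r i div w \<noteq> t" by auto
  \<comment> \<open>The end of the free block. Residues below the block wrap around by L, those
    above it move down by \<open>s\<close>, and both land below L - w.\<close>
  define s where "s = (t + 1) * w"
  have "s \<le> (B + 1) * w" unfolding s_def using t(1) by (intro mult_le_mono1) simp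
  then have sL: "s \<le> L" using L by (rule le_trans)
  have sw: "s = t * w + w" by (simp add: s_def)
  show ?thesis
  proof (intro exI[of _ "- int s"] ballI)
    fix i assume i: "i \<in> I"
    have rL: "r i < L" and hr: "int (r i) = h i mod int L" using Lpos by (auto simp: r_def nat_less_iff)
    have mod_eq: "(h i + - int s) mod int L = (int (r i) - int s) mod int L"
      unfolding hr by (simp add: mod_diff_left_eq)
    show "(h i + - int s) mod int L < int L - int w"
    proof (cases "r i < t * w")
      case True
      then have rs: "r i + w < s" using sw by simp
      have "(int (r i) - int s) mod int L = (int (r i) - int s + int L) mod int L" by simp
      also have "\<dots> = int (r i) - int s + int L"
        using sL rs by (intro mod_pos_pos_trivial) linarith+
      finally show ?thesis unfolding mod_eq using rs by linarith
    next
      case False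
      then have "r i div w \<ge> t" using w by (simp add: less_eq_div_iff_mult_less_eq)
      then have "r i div w \<ge> t + 1" using t(2)[OF i] by simp
      then have rs: "r i \<ge> s" unfolding s_def using w by (simp only: less_eq_div_iff_mult_less_eq)
      then have "(int (r i) - int s) mod int L = int (r i) - int s"
        using rL by (intro mod_pos_pos_trivial) linarith+
      moreover have "s \<ge> w" using sw by simp
      ultimately show ?thesis unfolding mod_eq using rL by linarith
    qed
  qed
qed

context global_field
begin

lemma eq_0_if_positive_at_poles:
  fixes g z :: 'k
  assumes g: "transc g" and nonneg: "\<And>v. is_place v \<Longrightarrow> vge v z 0"
    and pos: "\<And>v. is_place v \<Longrightarrow> v g < 0 \<Longrightarrow> vge v z 1"
  shows "z = 0"
proof -
  obtain v where v: "is_place v" "v g < 0" using transc_negative_place[OF g] by blast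
  have "v z = 0" using nonneg_everywhere_imp_constant[OF nonneg v(1)] .
  then show ?thesis using pos[OF v] by (simp add: vge_def)
qed

lemma transc_nonzero: "transc g \<Longrightarrow> g \<noteq> (0::'k)"
  using transc_negative_place place_0 by fastforce

lemma transc_power_neq_1:
  assumes g: "transc (g::'k)" and n: "n > 0"
  shows "g ^ n \<noteq> 1"
proof -
  obtain v where v: "is_place v" "v g < 0" using transc_negative_place[OF g] by blast
  show ?thesis using place_power_minus_1_neg(1)[OF v n] by simp
qed

text \<open>y g^(-a) has no pole where v(g) >= 0, and because b < a it vanishes at every pole of
  g.\<close>

lemma eq_0_if_exponent_gap:
  fixes g y :: 'k
  assumes g: "transc g" and ba: "b < a"
    and nonneg: "\<And>v. is_place v \<Longrightarrow> v g \<ge> 0 \<Longrightarrow> vge v y (a * v g)"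
    and neg: "\<And>v. is_place v \<Longrightarrow> v g < 0 \<Longrightarrow> vge v y (b * v g)"
  shows "y = 0"
proof -
  have g0: "g \<noteq> 0" using transc_nonzero[OF g] .
  have ge: "vge v (y * g powi (- a)) (N - a * v g)" if v: "is_place v" and "vge v y N" for v N
  proof -
    have "v (g powi (- a)) = - (a * v g)" by (simp add: place_powi[OF v])
    then have "vge v (g powi (- a)) (- (a * v g))" using vge_self by metis
    then show ?thesis using vge_mult[OF v that(2)] by fastforce
  qed
  have pos: "vge v (y * g powi (- a)) 1" if v: "is_place v" and "v g < 0" for v
  proof -
    have "(b - a) * v g > 0" using that ba by (simp add: zero_less_mult_iff)
    then have "b * v g - a * v g \<ge> 1" by (simp add: left_diff_distrib)
    then show ?thesis using ge[OF v neg[OF that]] vge_mono by blast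
  qed
  have "y * g powi (- a) = 0"
  proof (rule eq_0_if_positive_at_poles[OF g _ pos])
    fix v :: "'k \<Rightarrow> int" assume v: "is_place v"
    show "vge v (y * g powi (- a)) 0"
    proof (cases "v g < 0")
      case True
      then show ?thesis using vge_mono[OF pos[OF v]] by simp
    next
      case False
      then show ?thesis using ge[OF v nonneg[OF v]] by simp
    qed
  qed
  then show ?thesis using g0 by simp
qed

text \<open>Split off the cluster of top exponents. Where g has no pole, the cluster itself bounds
  its sum from below; at the poles of g the bound comes from the remaining terms, whose sum is its
  negative and whose exponents are too small even after the coefficient weight E. The gap forces the
  cluster sum to vanish. Inside the cluster \<open>e'\<close> is \<open>e\<close> plus a common
  shift, so the same terms cancel for \<open>e'\<close>, and the rest follows by induction.\<close>

lemma clustered_sum_vanishes: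
  fixes g :: 'k and c :: "'i \<Rightarrow> 'k" and e e' :: "'i \<Rightarrow> int"
  assumes g: "transc g" and "finite I" and D: "D \<ge> 0"
    and c: "\<And>i v. i \<in> I \<Longrightarrow> is_place v \<Longrightarrow> vge v (c i) (int E * min 0 (v g))"
    and cl: "\<And>i j. i \<in> I \<Longrightarrow> j \<in> I \<Longrightarrow>
        \<bar>e i - e j\<bar> \<le> D \<and> e' i - e' j = e i - e j \<or> \<bar>e i - e j\<bar> > D + int E"
    and sum: "(\<Sum>i\<in>I. c i * g powi e i) = 0"
  shows "(\<Sum>i\<in>I. c i * g powi e' i) = 0"
  using assms(2,4-6)
proof (induction I rule: finite_psubset_induct)
  case (psubset I)
  have g0: "g \<noteq> 0" using transc_nonzero[OF g] .
  show ?case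
  proof (cases "I = {}")
    case False
    have "Max (e ` I) \<in> e ` I" using False psubset.hyps(1) by (intro Max_in) auto
    then obtain m where m: "m \<in> I" "e m = Max (e ` I)" by auto
    have mx: "e i \<le> e m" if "i \<in> I" for i using that psubset.hyps(1) by (simp add: m(2))
    \<comment> \<open>Two exponents are within D of each other or more than D + E apart, so
      everything outside this cluster lies more than D + E below the maximum.\<close>
    define C where "C = {i \<in> I. e i \<ge> e m - D}"
    define R where "R = I - C"
    have CR: "C \<subseteq> I" "R \<subseteq> I" "C \<inter> R = {}" "C \<union> R = I" "finite C" "finite R"
      using psubset.hyps(1) by (auto simp: C_def R_def)
    have Rle: "e i \<le> e m - D - int E - 1" if "i \<in> R" for i
      using psubset.prems(2)[of m i] m(1) mx[of i] that by (auto simp: C_def R_def)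
    have Ceq: "e' i - e' m = e i - e m" if "i \<in> C" for i
      using psubset.prems(2)[of i m] m(1) mx[of i] that by (auto simp: C_def)
    have split: "(\<Sum>i\<in>I. c i * g powi f i) = (\<Sum>i\<in>C. c i * g powi f i) + (\<Sum>i\<in>R. c i * g powi f i)" for f
      unfolding CR(4)[symmetric] using CR by (intro sum.union_disjoint) auto
    have weight: "vge v (c i * g powi e i) (int E * min 0 (v g) + e i * v g)" if "i \<in> I" "is_place v" for i v
      using vge_mult[OF that(2) psubset.prems(1)[OF that] vge_self[of v "g powi e i"]] by (simp add: place_powi[OF that(2)])
    define y where "y = (\<Sum>i\<in>C. c i * g powi e i)"
    have y: "y = - (\<Sum>i\<in>R. c i * g powi e i)" using psubset.prems(3) split[of e] by (simp add: y_def eq_neg_iff_add_eq_0)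
    have y0: "y = 0"
    proof (rule eq_0_if_exponent_gap[OF g, of "e m - D - 1" "e m - D"])
      fix v :: "'k \<Rightarrow> int" assume v: "is_place v"
      show "vge v y ((e m - D) * v g)" if vg: "v g \<ge> 0"
        unfolding y_def
      proof (rule vge_sum[OF v])
        fix i assume i: "i \<in> C"
        have "(e m - D) * v g \<le> e i * v g" using i vg by (intro mult_right_mono) (auto simp: C_def)
        then show "vge v (c i * g powi e i) ((e m - D) * v g)"
          using weight[OF _ v, of i] i CR vg by (auto intro: vge_mono)
      qed
      show "vge v y ((e m - D - 1) * v g)" if vg: "v g < 0"
        unfolding y vge_minus[OF v]
      proof (rule vge_sum[OF v])
        fix i assume i: "i \<in> R"
        have "(e m - D - 1) * v g \<le> (int E + e i) * v g" using Rle[OF i] vg by (intro mult_right_mono_neg) auto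
        then show "vge v (c i * g powi e i) ((e m - D - 1) * v g)"
          using weight[OF _ v, of i] i CR vg by (auto intro: vge_mono simp: distrib_right)
      qed
    qed simp
    have "(\<Sum>i\<in>C. c i * g powi e' i) = g powi (e' m - e m) * y"
      unfolding y_def sum_distrib_left
    proof (rule sum.cong[OF refl])
      fix i assume "i \<in> C"
      then have "e' i = (e' m - e m) + e i" using Ceq by fastforce
      then have "g powi e' i = g powi (e' m - e m) * g powi e i" using g0 by (metis power_int_add)
      then show "c i * g powi e' i = g powi (e' m - e m) * (c i * g powi e i)" by simp
    qed
    then have Ce': "(\<Sum>i\<in>C. c i * g powi e' i) = 0" using y0 by simp
    have "m \<in> C" using m(1) D by (simp add: C_def)
    then have "R \<subset> I" using m(1) by (auto simp: R_def)
    moreover have "(\<Sum>i\<in>R. c i * g powi e i) = 0" using y y0 by simp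
    ultimately have "(\<Sum>i\<in>R. c i * g powi e' i) = 0"
      using CR(2) psubset.prems(1,2) by (intro psubset.IH) blast+
    then show ?thesis using split[of e'] Ce' by simp
  qed simp
qed

text \<open>With h = g^(k p^r) one has h^L' = (g^L)^k, and the exponent L' prime to p leaves v(h -
  1) unchanged. So the order of g^L - 1 is bounded through the p-part of L alone.\<close>

lemma place_period_bound:
  fixes g :: 'k
  assumes v: "is_place v" and g: "v g = 0" "transc g" and k: "k > 0" "vge v (g ^ k - 1) 1"
    and L: "L = p ^ r * L'" "\<not> p dvd L'"
  shows "v (g ^ L - 1) \<le> v (g ^ (k * p ^ r) - 1)"
proof -
  have g0: "vge v g 0" using g by (simp add: vge_def)
  define h where "h = g ^ (k * p ^ r)"
  have "k * p ^ r > 0" using k prime_gt_0_nat[OF prime_p] by simp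
  then have h1: "h \<noteq> 1" unfolding h_def by (rule transc_power_neq_1[OF g(2)])
  have Lpos: "L > 0" using L prime_gt_0_nat[OF prime_p] by (cases L') auto
  have h: "vge v h 0" unfolding h_def by (rule vge_power[OF v g0])
  have "vge v (h - 1) 1"
    unfolding h_def power_mult by (intro vge_power_minus_1[OF v] vge_power[OF v] g0 k)
  from place_power_coprime_minus_1[OF v h this L(2) h1]
  have hL: "h ^ L' \<noteq> 1" "v (h ^ L' - 1) = v (h - 1)" .
  have "h ^ L' = (g ^ L) ^ k" by (simp add: h_def L power_mult[symmetric] ac_simps)
  then have "vge v (h ^ L' - 1) (v (g ^ L - 1))"
    using vge_power_minus_1[OF v vge_power[OF v g0] vge_self, of L k] by simp
  then show ?thesis using hL by (simp add: vge_def h_def)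
qed

text \<open>\<open>L\<close>, \<open>V\<close> and \<open>N\<close> precede the sum because they
  dictate how well a point must be approximated. Let x be the reduced sum, G = g^L - 1 and H = g^(k
  p^r) - 1. On \<Sigma> closeness makes x divisible by G, outside \<Sigma> the factor H absorbs the
  zeros of G, and the exponent gap makes H x / G vanish at the poles of g; hence x = 0.\<close>

lemma periodic_vanishing:
  fixes g :: 'k and \<Sigma> :: "('k \<Rightarrow> int) set" and Q E B w0 :: nat
  assumes g: "transc g" and \<Sigma>: "finite (places - \<Sigma>)" and unit': "\<forall>v\<in>\<Sigma>. v g = 0"
    and Q: "Q > 0"
  shows "\<exists>L>0. Q dvd L \<and> (\<exists>V N. finite V \<and> V \<subseteq> \<Sigma> \<and> V \<subseteq> places \<and>
    (\<forall>(I::'i set) c h. finite I \<longrightarrow> card I \<le> B \<longrightarrow>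
      (\<forall>i\<in>I. \<forall>v. is_place v \<longrightarrow> vge v (c i) (int E * min 0 (v g))) \<longrightarrow>
      (\<forall>v\<in>V. vge v (\<Sum>i\<in>I. c i * g powi h i) N) \<longrightarrow>
      (\<exists>\<rho> e. (\<forall>i\<in>I. 0 \<le> e i \<and> e i < int L - int w0 \<and> int L dvd e i - h i - \<rho>) \<and>
        (\<Sum>i\<in>I. c i * g powi e i) = 0)))"
proof -
  note unit = bspec[OF unit']
  have g0: "g \<noteq> 0" using transc_nonzero[OF g] .
  have p2: "p \<ge> 2" using prime_ge_2_nat[OF prime_p] .
  have "\<exists>k>0. \<forall>v\<in>{v \<in> places - \<Sigma>. v g = 0}. vge v (g ^ k - 1) 1"
    by (rule common_residue_order[OF finite_subset[OF _ \<Sigma>] _ g]) (auto simp: places_def)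
  then obtain k where k: "k > 0" "\<And>v. is_place v \<Longrightarrow> v \<notin> \<Sigma> \<Longrightarrow> v g = 0 \<Longrightarrow> vge v (g ^ k - 1) 1"
    by (auto simp: places_def)
  obtain Q' where Q': "Q = p ^ multiplicity p Q * Q'" "\<not> p dvd Q'"
    using multiplicity_decompose'[of Q p] Q p2 by auto
  define r where "r = multiplicity p Q"
  \<comment> \<open>One summand per loss at a pole of g, in units of the pole order: the factor
    \<open>H\<close>, the weight of the coefficients, the slack \<open>w0\<close> of the conclusion,
    and 1 to make the quotient vanish there.\<close>
  define w where "w = k * p ^ r + E + w0 + 1"
  \<comment> \<open>u = 1 modulo p, so Q u has the p-part of Q, which was fixed before; and u is
    large enough for B + 1 blocks of width w.\<close>
  define u where "u = p * ((B + 1) * w) + 1"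
  define L where "L = Q * u"
  define L' where "L' = Q' * u"
  have L: "L = p ^ r * L'" using Q' by (simp add: L_def L'_def r_def)
  have "\<not> p dvd u"
  proof
    assume "p dvd u"
    then have "p dvd 1" unfolding u_def by (subst (asm) dvd_add_right_iff) auto
    then show False using p2 by simp
  qed
  then have L': "\<not> p dvd L'" using Q'(2) prime_dvd_mult_iff[OF prime_p] by (simp add: L'_def)
  have "(B + 1) * w \<le> p * ((B + 1) * w)" using p2 by simp
  also have "\<dots> \<le> u" by (simp add: u_def)
  also have "\<dots> \<le> L" using Q by (simp add: L_def)
  finally have Lw: "(B + 1) * w \<le> L" .
  have wpos: "w > 0" by (simp add: w_def)
  have Lpos: "L > 0" using Q by (simp add: L_def u_def)
  define G where "G = g ^ L - 1"
  have G0: "G \<noteq> 0" using transc_power_neq_1[OF g Lpos] by (simp add: G_def)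
  define H where "H = g ^ (k * p ^ r) - 1"
  have kp: "k * p ^ r > 0" using k p2 by simp
  have H0: "H \<noteq> 0" using transc_power_neq_1[OF g kp] by (simp add: H_def)
  \<comment> \<open>Only at these finitely many places of \<Sigma> does divisibility by G demand
    anything.\<close>
  define V where "V = {v \<in> \<Sigma>. is_place v \<and> v G \<noteq> 0}"
  have V: "finite V" unfolding V_def by (rule finite_subset[OF _ finite_nonunit_places[of G]]) auto
  define N where "N = (\<Sum>v\<in>V. \<bar>v G\<bar>)"
  have N: "v G \<le> N" if "v \<in> V" for v
    using member_le_sum[OF that, of "\<lambda>v. \<bar>v G\<bar>"] V by (simp add: N_def)
  have main: "\<exists>\<rho> e. (\<forall>i\<in>I. 0 \<le> e i \<and> e i < int L - int w0 \<and> int L dvd e i - h i - \<rho>) \<and>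
        (\<Sum>i\<in>I. c i * g powi e i) = 0"
    if I: "finite I" "card I \<le> B" and c: "\<forall>i\<in>I. \<forall>v. is_place v \<longrightarrow> vge v (c i) (int E * min 0 (v g))"
      and close: "\<forall>v\<in>V. vge v (\<Sum>i\<in>I. c i * g powi h i) N"
    for I :: "'i set" and c h
  proof -
    obtain \<rho> where \<rho>: "\<forall>i\<in>I. (h i + \<rho>) mod int L < int L - int w"
      using residues_avoid_block[OF I wpos Lw, of h] by blast
    define e where "e i = (h i + \<rho>) mod int L" for i
    have e: "0 \<le> e i" "e i < int L - int w" if "i \<in> I" for i using \<rho> that Lpos by (auto simp: e_def)
    have dvd: "int L dvd e i - (h i + \<rho>)" for i
      unfolding e_def by (simp add: mod_eq_dvd_iff[symmetric])
    define x where "x = (\<Sum>i\<in>I. c i * g powi e i)"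
    have x_nonneg: "vge v x 0" if v: "is_place v" and vg: "v g \<ge> 0" for v
      unfolding x_def
    proof (rule vge_sum[OF v])
      fix i assume i: "i \<in> I"
      have "vge v (g powi e i) 0" using e[OF i] vg by (simp add: vge_def place_powi[OF v])
      moreover have "vge v (c i) 0" using c i v vg by fastforce
      ultimately show "vge v (c i * g powi e i) 0" using vge_mult[OF v] by fastforce
    qed
    have x_\<Sigma>: "vge v x (v G)" if v: "is_place v" "v \<in> \<Sigma>" for v
    proof (cases "v \<in> V")
      case False
      then have "v G = 0" using v by (simp add: V_def)
      then show ?thesis using x_nonneg[OF v(1)] unit[OF v(2)] by simp
    next
      case True
      have vg: "v g = 0" using unit v by blast
      \<comment> \<open>The rotation by \<rho> multiplies the given sum by a unit at v, and reducing
        each exponent modulo L changes its term by a multiple of G.\<close>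
      have "x = g powi \<rho> * (\<Sum>i\<in>I. c i * g powi h i) + (\<Sum>i\<in>I. c i * (g powi e i - g powi (h i + \<rho>)))"
        using g0 by (simp add: x_def sum_distrib_left sum.distrib[symmetric] power_int_add algebra_simps)
      moreover have "vge v (g powi \<rho> * (\<Sum>i\<in>I. c i * g powi h i)) (v G)"
        using vge_mono[OF bspec[OF close True] N[OF True]] vge_mult_iff[OF v(1), of "g powi \<rho>"] g0 vg
        by (simp add: place_powi[OF v(1)])
      moreover have "vge v (\<Sum>i\<in>I. c i * (g powi e i - g powi (h i + \<rho>))) (v G)"
      proof (rule vge_sum[OF v(1)])
        fix i assume i: "i \<in> I"
        have "vge v (c i) 0" using c i v vg by fastforce
        then show "vge v (c i * (g powi e i - g powi (h i + \<rho>))) (v G)"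
          using vge_mult[OF v(1) _ vge_powi_diff[OF v(1) g0 vg dvd[of i]]] by (fastforce simp: G_def)
      qed
      ultimately show ?thesis by (simp add: vge_add[OF v(1)])
    qed
    have H_nonneg: "vge v H 0" if v: "is_place v" and vg: "v g \<ge> 0" for v
      unfolding H_def using vg by (intro vge_diff[OF v] vge_power[OF v] vge_1[OF v]) (simp add: vge_def)
    have quot: "vge v (H * x / G) N" if v: "is_place v" and "vge v (H * x) (N + v G)" for v N
      using vge_mult_iff[OF v G0, of "H * x / G" "N + v G"] that(2) G0 by simp
    have x_pole: "vge v (H * x / G) 1" if v: "is_place v" and vg: "v g < 0" for v
    proof (rule quot[OF v])
      have vG: "v G = int L * v g" unfolding G_def by (rule place_power_minus_1_neg(2)[OF v vg Lpos])
      have vH: "v H = int (k * p ^ r) * v g" unfolding H_def by (rule place_power_minus_1_neg(2)[OF v vg kp])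
      have "vge v x ((int L - int w + int E) * v g)"
        unfolding x_def
      proof (rule vge_sum[OF v])
        fix i assume i: "i \<in> I"
        have "vge v (c i) (int E * v g)" using c i v vg by (metis min.absorb2 less_imp_le)
        then have "vge v (c i * g powi e i) (int E * v g + e i * v g)"
          using vge_mult[OF v _ vge_self[of v "g powi e i"]] by (simp add: place_powi[OF v])
        moreover have "(int L - int w + int E) * v g \<le> (int E + e i) * v g"
          using e[OF i] vg by (intro mult_right_mono_neg) auto
        then have "(int L - int w + int E) * v g \<le> int E * v g + e i * v g" by (simp only: distrib_right)
        ultimately show "vge v (c i * g powi e i) ((int L - int w + int E) * v g)"
          by (rule vge_mono)
      qed
      then have "vge v (H * x) (int (k * p ^ r) * v g + (int L - int w + int E) * v g)"
        using vge_mult[OF v vge_self[of v H]] by (simp add: vH)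
      moreover have "int (k * p ^ r) * v g + (int L - int w + int E) * v g = v G - (int w0 + 1) * v g"
        by (simp add: vG w_def algebra_simps)
      moreover have "- ((int w0 + 1) * v g) \<ge> 1"
      proof -
        have "(int w0 + 1) * v g < 0" using vg by (simp add: mult_less_0_iff)
        then show ?thesis by simp
      qed
      ultimately show "vge v (H * x) (1 + v G)" by (auto intro: vge_mono)
    qed
    have "H * x / G = 0"
    proof (rule eq_0_if_positive_at_poles[OF g _ x_pole])
      fix v :: "'k \<Rightarrow> int" assume v: "is_place v"
      \<comment> \<open>The third case, outside \<Sigma> with g a unit, is the one for which H was
        chosen; at a zero of g the function G is a unit.\<close>
      consider "v g < 0" | "v \<in> \<Sigma>" "v g = 0" | "v \<notin> \<Sigma>" "v g = 0" | "v g > 0" using unit by fastforce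
      then show "vge v (H * x / G) 0"
      proof cases
        case 1
        then show ?thesis using vge_mono[OF x_pole[OF v]] by simp
      next
        case 2
        show ?thesis
          using vge_mult[OF v H_nonneg[OF v] x_\<Sigma>[OF v 2(1)]] 2 by (intro quot[OF v]) simp
      next
        case 3
        have "v G \<le> v H"
          unfolding G_def H_def
          by (rule place_period_bound[OF v 3(2) g k(1) k(2)[OF v 3] L L'])
        then have "vge v H (v G)" by (simp add: vge_def)
        then show ?thesis using vge_mult[OF v _ x_nonneg[OF v]] 3 by (intro quot[OF v]) fastforce
      next
        case 4
        have "v G = 0" unfolding G_def by (rule place_power_minus_1_pos(2)[OF v 4 Lpos])
        then show ?thesis
          using vge_mult[OF v H_nonneg[OF v] x_nonneg[OF v]] 4 by (intro quot[OF v]) simp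
      qed
    qed
    then have "x = 0" using H0 G0 by simp
    moreover have "w0 \<le> w" by (simp add: w_def)
    then have "e i < int L - int w0" if "i \<in> I" for i using e[OF that] by linarith
    ultimately show ?thesis
      using e dvd by (intro exI[of _ \<rho>] exI[of _ e]) (auto simp: x_def diff_diff_eq)
  qed
  have "Q dvd L" by (simp add: L_def)
  moreover have "V \<subseteq> \<Sigma>" "V \<subseteq> places" by (auto simp: V_def places_def)
  ultimately show ?thesis using Lpos V main by blast
qed

end

section \<open>Profinite integers and their integral specializations\<close>

text \<open>A profinite integer, given by one representative \<open>z L\<close> of its class modulo
  each positive L.\<close>

definition compatible :: "(nat \<Rightarrow> int) \<Rightarrow> bool" where
  "compatible z \<longleftrightarrow> (\<forall>L L'. 0 < L \<longrightarrow> 0 < L' \<longrightarrow> L dvd L' \<longrightarrow> int L dvd z L' - z L)"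

lemma int_eq_0_if_all_dvd:
  fixes b :: int
  assumes "\<And>L::nat. L > 0 \<Longrightarrow> int L dvd b"
  shows "b = 0"
proof (rule ccontr)
  assume b: "b \<noteq> 0"
  have "int (nat \<bar>b\<bar> + 1) dvd b" by (rule assms) simp
  then have "int (nat \<bar>b\<bar> + 1) \<le> \<bar>b\<bar>" using b by (metis dvd_imp_le_int abs_of_nat)
  then show False by simp
qed

text \<open>Profinite integers modulo ordinary integers have no torsion: the relation a z = b, read
  modulo |a| L, can be divided by a.\<close>

lemma compatible_divide:
  assumes z: "compatible z" and a: "a \<noteq> 0" and rel: "\<And>L::nat. L > 0 \<Longrightarrow> int L dvd a * z L - b"
  shows "\<exists>c. b = a * c \<and> (\<forall>L>0. int L dvd z L - c)"
proof -
  define A where "A = nat \<bar>a\<bar>"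
  have A: "A > 0" "int A = \<bar>a\<bar>" using a by (auto simp: A_def)
  have "a dvd a * z A - b" using rel[OF A(1)] A(2) by simp
  then have "a dvd b" by (simp add: dvd_diff_right_iff)
  then obtain c where c: "b = a * c" by (auto simp: dvd_def)
  have "int L dvd z L - c" if L: "L > 0" for L
  proof -
    have "int (A * L) dvd a * z (A * L) - b" using A L by (intro rel) simp
    then have "\<bar>a\<bar> * int L dvd a * (z (A * L) - c)" by (simp add: A c right_diff_distrib)
    then have "a * int L dvd a * (z (A * L) - c)" by (cases "a \<ge> 0") auto
    then have "int L dvd z (A * L) - c" using a by simp
    moreover have "int L dvd z (A * L) - z L" using z A L by (simp add: compatible_def)
    ultimately have "int L dvd (z (A * L) - c) - (z (A * L) - z L)" by (rule dvd_diff)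
    then show ?thesis by simp
  qed
  then show ?thesis using c by blast
qed

text \<open>A single \<open>n\<close> must satisfy all integral affine relations of the
  \<open>z i\<close> simultaneously. A nontrivial relation is simplified by the Euclidean algorithm:
  an invertible change of variables carries all relations along, respects congruences modulo Q and
  shrinks the coefficients of the chosen one. Once it involves one variable only, that variable is
  an ordinary integer and is eliminated. Without nontrivial relations any representatives modulo Q
  will do.\<close>

lemma integral_specialization:
  fixes z :: "'i \<Rightarrow> nat \<Rightarrow> int"
  assumes "finite I" "\<And>i. i \<in> I \<Longrightarrow> compatible (z i)" "Q > 0"
  shows "\<exists>n. (\<forall>i\<in>I. int Q dvd n i - z i Q) \<and>
    (\<forall>a b. (\<forall>L>0. int L dvd (\<Sum>i\<in>I. a i * z i L) - b) \<longrightarrow> (\<Sum>i\<in>I. a i * n i) = b)"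
  using assms(1,2)
proof (induction I arbitrary: z rule: finite_psubset_induct)
  case (psubset I)
  define spec where "spec z \<longleftrightarrow> (\<exists>n. (\<forall>i\<in>I. int Q dvd n i - z i Q) \<and>
    (\<forall>a b. (\<forall>L>0. int L dvd (\<Sum>i\<in>I. a i * z i L) - b) \<longrightarrow> (\<Sum>i\<in>I. a i * n i) = b))"
    for z :: "'i \<Rightarrow> nat \<Rightarrow> int"
  have main: "spec z"
    if "\<exists>i\<in>I. a i \<noteq> 0" "\<forall>L>0. int L dvd (\<Sum>i\<in>I. a i * z i L) - b" "\<forall>i\<in>I. compatible (z i)"
      "(\<Sum>i\<in>I. nat \<bar>a i\<bar>) = m" for a b z m
    using that
  proof (induction m arbitrary: a z rule: less_induct)
    case (less m)
    obtain k0 where k0: "k0 \<in> I" "a k0 \<noteq> 0" using less.prems(1) by blast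
    show ?case
    proof (cases "\<exists>j0\<in>I. j0 \<noteq> k0 \<and> a j0 \<noteq> 0")
      case True
      then obtain j k where jk: "j \<in> I" "k \<in> I" "j \<noteq> k" "a j \<noteq> 0" "a k \<noteq> 0" "\<bar>a k\<bar> \<le> \<bar>a j\<bar>"
        using k0 by (metis linear)
      \<comment> \<open>With this sign |a_j - s a_k| < |a_j|, because 0 < |a_k| <= |a_j|.\<close>
      define s where "s = sgn (a j) * sgn (a k)"
      define shift where "shift \<alpha> = \<alpha>(j := \<alpha> j - s * \<alpha> k)" for \<alpha> :: "'i \<Rightarrow> int"
      define z' where "z' = z(k := (\<lambda>L. z k L + s * z j L))"
      \<comment> \<open>Coefficients transform contragrediently to the variables, so every relation
        keeps its value.\<close>
      have ident: "(\<Sum>i\<in>I. shift \<alpha> i * (x(k := x k + s * x j)) i) = (\<Sum>i\<in>I. \<alpha> i * x i)" for \<alpha> x :: "'i \<Rightarrow> int"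
      proof -
        have split: "(\<Sum>i\<in>I. f i) = f j + f k + (\<Sum>i\<in>I - {j} - {k}. f i)" for f :: "'i \<Rightarrow> int"
          using psubset.hyps(1) jk by (simp add: sum.remove[of I j] sum.remove[of "I - {j}" k])
        have "(\<Sum>i\<in>I - {j} - {k}. shift \<alpha> i * (x(k := x k + s * x j)) i) = (\<Sum>i\<in>I - {j} - {k}. \<alpha> i * x i)"
          by (rule sum.cong) (auto simp: shift_def)
        then show ?thesis
          unfolding split using jk(3) by (simp add: shift_def algebra_simps)
      qed
      have z': "(\<Sum>i\<in>I. shift \<alpha> i * z' i L) = (\<Sum>i\<in>I. \<alpha> i * z i L)" for \<alpha> L
      proof -
        have "z' i L = ((\<lambda>i. z i L)(k := z k L + s * z j L)) i" for i by (simp add: z'_def)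
        then show ?thesis using ident[of \<alpha> "\<lambda>i. z i L"] by simp
      qed
      have lt: "(\<Sum>i\<in>I. nat \<bar>shift a i\<bar>) < m"
      proof -
        have "\<bar>a j - s * a k\<bar> < \<bar>a j\<bar>"
          using jk(4-6) by (auto simp: s_def sgn_if abs_if split: if_splits)
        then have "nat \<bar>shift a j\<bar> < nat \<bar>a j\<bar>" by (simp add: shift_def)
        moreover have "nat \<bar>shift a i\<bar> \<le> nat \<bar>a i\<bar>" if "i \<in> I" for i
          using \<open>\<bar>a j - s * a k\<bar> < \<bar>a j\<bar>\<close> by (auto simp: shift_def)
        ultimately have "(\<Sum>i\<in>I. nat \<bar>shift a i\<bar>) < (\<Sum>i\<in>I. nat \<bar>a i\<bar>)"
          using psubset.hyps(1) jk(1) by (intro sum_strict_mono_ex1) auto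
        then show ?thesis using less.prems(4) by simp
      qed
      have compat': "\<forall>i\<in>I. compatible (z' i)"
      proof
        fix i assume i: "i \<in> I"
        have "int L dvd z k L' + s * z j L' - (z k L + s * z j L)" if "0 < L" "0 < L'" "L dvd L'" for L L'
        proof -
          have "int L dvd (z k L' - z k L) + s * (z j L' - z j L)"
            using less.prems(3) jk that by (intro dvd_add dvd_mult) (auto simp: compatible_def)
          then show ?thesis by (simp add: algebra_simps)
        qed
        then show "compatible (z' i)"
          using less.prems(3) i by (auto simp: z'_def compatible_def)
      qed
      have "shift a k \<noteq> 0" using jk by (simp add: shift_def)
      then have "spec z'"
        using less.prems(2) jk compat' lt by (intro less.IH[of _ "shift a" z', OF lt]) (auto simp: z')
      then obtain n' where n': "\<forall>i\<in>I. int Q dvd n' i - z' i Q"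
        "\<And>\<alpha> \<beta>. (\<forall>L>0. int L dvd (\<Sum>i\<in>I. \<alpha> i * z' i L) - \<beta>) \<Longrightarrow> (\<Sum>i\<in>I. \<alpha> i * n' i) = \<beta>"
        unfolding spec_def by blast
      \<comment> \<open>Undoes the change of variables on the integer solution.\<close>
      define n where "n = n'(k := n' k - s * n' j)"
      have nn': "n' = n(k := n k + s * n j)" using jk(3) by (auto simp: n_def)
      show ?thesis
        unfolding spec_def
      proof (intro exI[of _ n] conjI ballI allI impI)
        fix i assume i: "i \<in> I"
        show "int Q dvd n i - z i Q"
        proof (cases "i = k")
          case True
          have "int Q dvd n' k - z' k Q" "int Q dvd n' j - z' j Q" using n'(1) jk by auto
          then have "int Q dvd (n' k - z' k Q) - s * (n' j - z' j Q)" by (intro dvd_diff[OF _ dvd_mult])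
          then show ?thesis using True jk(3) by (simp add: n_def z'_def algebra_simps)
        next
          case False
          then show ?thesis using n'(1) i by (auto simp: n_def z'_def)
        qed
      next
        fix \<alpha> \<beta> assume "\<forall>L>0. int L dvd (\<Sum>i\<in>I. \<alpha> i * z i L) - \<beta>"
        then have "(\<Sum>i\<in>I. shift \<alpha> i * n' i) = \<beta>" using n'(2)[of "shift \<alpha>" \<beta>] by (simp add: z')
        then show "(\<Sum>i\<in>I. \<alpha> i * n i) = \<beta>" unfolding nn' ident .
      qed
    next
      case False
      have single: "(\<Sum>i\<in>I. a i * x i) = a k0 * x k0" for x :: "'i \<Rightarrow> int"
      proof -
        have "(\<Sum>i\<in>I. a i * x i) = a k0 * x k0 + (\<Sum>i\<in>I - {k0}. a i * x i)"
          using psubset.hyps(1) k0 by (simp add: sum.remove)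
        moreover have "(\<Sum>i\<in>I - {k0}. a i * x i) = 0" using False by (intro sum.neutral) auto
        ultimately show ?thesis by simp
      qed
      \<comment> \<open>A relation in the single variable \<open>k0\<close> makes this profinite
        integer an ordinary one.\<close>
      obtain c where c: "\<forall>L>0. int L dvd z k0 L - c"
        using compatible_divide[of "z k0" "a k0" b] less.prems(2,3) k0 by (auto simp: single)
      have "\<exists>n. (\<forall>i\<in>I - {k0}. int Q dvd n i - z i Q) \<and>
        (\<forall>a b. (\<forall>L>0. int L dvd (\<Sum>i\<in>I - {k0}. a i * z i L) - b) \<longrightarrow> (\<Sum>i\<in>I - {k0}. a i * n i) = b)"
        using k0 less.prems(3) by (intro psubset.IH) auto
      then obtain n' where n': "\<forall>i\<in>I - {k0}. int Q dvd n' i - z i Q"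
        "\<And>\<alpha> \<beta>. (\<forall>L>0. int L dvd (\<Sum>i\<in>I - {k0}. \<alpha> i * z i L) - \<beta>) \<Longrightarrow> (\<Sum>i\<in>I - {k0}. \<alpha> i * n' i) = \<beta>"
        by blast
      have rem: "(\<Sum>i\<in>I. f i) = f k0 + (\<Sum>i\<in>I - {k0}. f i)" for f :: "'i \<Rightarrow> int"
        using psubset.hyps(1) k0 by (simp add: sum.remove)
      show ?thesis
        unfolding spec_def
      proof (intro exI[of _ "n'(k0 := c)"] conjI ballI allI impI)
        fix i assume "i \<in> I"
        then show "int Q dvd (n'(k0 := c)) i - z i Q"
          using n'(1) c assms(3) by (cases "i = k0") (auto simp: dvd_diff_commute)
      next
        fix \<alpha> \<beta> assume rel: "\<forall>L>0. int L dvd (\<Sum>i\<in>I. \<alpha> i * z i L) - \<beta>"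
        have "int L dvd (\<Sum>i\<in>I - {k0}. \<alpha> i * z i L) - (\<beta> - \<alpha> k0 * c)" if "L > 0" for L
        proof -
          have "int L dvd (\<Sum>i\<in>I. \<alpha> i * z i L) - \<beta>" using rel that by blast
          moreover have "int L dvd \<alpha> k0 * (z k0 L - c)" using c that by simp
          ultimately have "int L dvd ((\<Sum>i\<in>I. \<alpha> i * z i L) - \<beta>) - \<alpha> k0 * (z k0 L - c)" by (rule dvd_diff)
          then show ?thesis by (simp add: rem[of "\<lambda>i. \<alpha> i * z i L"] algebra_simps)
        qed
        then have "(\<Sum>i\<in>I - {k0}. \<alpha> i * n' i) = \<beta> - \<alpha> k0 * c" using n'(2) by blast
        moreover have "(\<Sum>i\<in>I - {k0}. \<alpha> i * (n'(k0 := c)) i) = (\<Sum>i\<in>I - {k0}. \<alpha> i * n' i)"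
          by (rule sum.cong) auto
        ultimately show "(\<Sum>i\<in>I. \<alpha> i * (n'(k0 := c)) i) = \<beta>"
          unfolding rem[of "\<lambda>i. \<alpha> i * (n'(k0 := c)) i"] by (simp only: fun_upd_same)
      qed
    qed
  qed
  show ?case
  proof (cases "\<exists>a b. (\<exists>i\<in>I. a i \<noteq> 0) \<and> (\<forall>L>0. int L dvd (\<Sum>i\<in>I. a i * z i L) - b)")
    case True
    then have "spec z" using main psubset.prems by blast
    then show ?thesis unfolding spec_def .
  next
    case False
    show ?thesis
    proof (intro exI[of _ "\<lambda>i. z i Q"] conjI ballI allI impI)
      fix a b assume rel: "\<forall>L>0. int L dvd (\<Sum>i\<in>I. a i * z i L) - b"
      then have a: "\<forall>i\<in>I. a i = 0" using False by blast
      then have "b = 0" using rel by (intro int_eq_0_if_all_dvd) simp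
      then show "(\<Sum>i\<in>I. a i * z i Q) = b" using a by simp
    qed simp
  qed
qed

section \<open>Exponents of adelic limits\<close>

lemma mult_subgroup_closed:
  assumes G: "mult_subgroup G"
  shows "1 \<in> G" "x \<in> G \<Longrightarrow> y \<in> G \<Longrightarrow> x * y \<in> G" "x \<in> G \<Longrightarrow> inverse x \<in> G" "x \<in> G \<Longrightarrow> x \<noteq> 0"
    "x \<in> G \<Longrightarrow> y \<in> G \<Longrightarrow> x / y \<in> G"
  using G by (auto simp: mult_subgroup_def divide_inverse)

lemma mult_subgroup_powi:
  assumes G: "mult_subgroup G" and x: "x \<in> G"
  shows "x powi n \<in> G"
proof -
  have "y ^ k \<in> G" if "y \<in> G" for y and k :: nat
    using that by (induction k) (auto intro: mult_subgroup_closed[OF G])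
  then show ?thesis using x mult_subgroup_closed(3)[OF G x] by (simp add: power_int_def)
qed

lemma place_powi_inject:
  assumes v: "is_place v" "v g \<noteq> 0" and eq: "g powi m = g powi n"
  shows "m = n"
proof -
  have "m * v g = n * v g" using place_powi[OF v(1), of g] eq by metis
  then show ?thesis using v(2) by simp
qed

context global_field
begin

text \<open>Periodic vanishing for the two-term sum t g^d - 1, indexed by \<open>bool\<close>, with
  weight and slack 0. When the reduced sum is exactly zero, a pole of g shows that its two exponents
  agree; so t = 1 and L divides d. Finitely many places thus recover both the constant and the
  exponent modulo Q.\<close>

lemma constant_times_power_near_1:
  fixes g :: 'k
  assumes g: "transc g" and \<Sigma>: "finite (places - \<Sigma>)" and unit: "\<forall>v\<in>\<Sigma>. v g = 0"
    and Q: "Q > 0"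
  shows "\<exists>V N. finite V \<and> V \<subseteq> \<Sigma> \<and> (\<forall>t d. t \<noteq> 0 \<longrightarrow> (\<forall>v. is_place v \<longrightarrow> v t = 0) \<longrightarrow>
     (\<forall>v\<in>V. vge v (t * g powi d - 1) N) \<longrightarrow> int Q dvd d \<and> t = 1)"
proof -
  obtain v0 where v0: "is_place v0" "v0 g < 0" using transc_negative_place[OF g] by blast
  have "\<exists>L>0. Q dvd L \<and> (\<exists>V N. finite V \<and> V \<subseteq> \<Sigma> \<and> V \<subseteq> places \<and>
    (\<forall>(I::bool set) c h. finite I \<longrightarrow> card I \<le> 2 \<longrightarrow>
      (\<forall>i\<in>I. \<forall>v. is_place v \<longrightarrow> vge v (c i) (int 0 * min 0 (v g))) \<longrightarrow>
      (\<forall>v\<in>V. vge v (\<Sum>i\<in>I. c i * g powi h i) N) \<longrightarrow>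
      (\<exists>\<rho> e. (\<forall>i\<in>I. 0 \<le> e i \<and> e i < int L - int 0 \<and> int L dvd e i - h i - \<rho>) \<and>
        (\<Sum>i\<in>I. c i * g powi e i) = 0)))"
    by (rule periodic_vanishing[OF g \<Sigma> unit Q])
  then obtain L V N where L: "L > 0" "Q dvd L" and V: "finite V" "V \<subseteq> \<Sigma>"
    and main: "\<forall>(I::bool set) c h. finite I \<longrightarrow> card I \<le> 2 \<longrightarrow>
      (\<forall>i\<in>I. \<forall>v. is_place v \<longrightarrow> vge v (c i) (int 0 * min 0 (v g))) \<longrightarrow>
      (\<forall>v\<in>V. vge v (\<Sum>i\<in>I. c i * g powi h i) N) \<longrightarrow>
      (\<exists>\<rho> e. (\<forall>i\<in>I. 0 \<le> e i \<and> e i < int L - int 0 \<and> int L dvd e i - h i - \<rho>) \<and>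
        (\<Sum>i\<in>I. c i * g powi e i) = 0)"
    by (elim exE conjE) (rule that; assumption)
  have "int Q dvd d \<and> t = 1"
    if t: "t \<noteq> 0" "\<forall>v. is_place v \<longrightarrow> v t = 0" and near: "\<forall>v\<in>V. vge v (t * g powi d - 1) N" for t d
  proof -
    define c where "c b = (if b then t else - 1)" for b
    define h where "h b = (if b then d else 0)" for b
    have c: "\<forall>i\<in>UNIV. \<forall>v. is_place v \<longrightarrow> vge v (c i) (int 0 * min 0 (v g))"
      using t by (auto simp: c_def vge_def place_minus place_1)
    have "(\<Sum>i\<in>UNIV. c i * g powi h i) = t * g powi d - 1"
      by (simp add: UNIV_bool c_def h_def)
    then have "\<exists>\<rho> e. (\<forall>i\<in>UNIV. 0 \<le> e i \<and> e i < int L - int 0 \<and> int L dvd e i - h i - \<rho>) \<and>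
        (\<Sum>i\<in>UNIV. c i * g powi e i) = 0"
      using near
      by (intro main[THEN spec, THEN spec, THEN spec, THEN mp, THEN mp, THEN mp, THEN mp] c)
        (auto simp: card_UNIV_bool)
    then obtain \<rho> e where e: "\<And>i. int L dvd e i - h i - \<rho>" "(\<Sum>i\<in>UNIV. c i * g powi e i) = 0"
      by blast
    have eq: "t * g powi e True = g powi e False" using e(2) by (simp add: UNIV_bool c_def)
    have g0: "g \<noteq> 0" using transc_nonzero[OF g] .
    have "v0 (t * g powi e True) = e True * v0 g"
      using t v0 g0 by (simp add: place_mult[OF v0(1)] place_powi[OF v0(1)])
    then have ee: "e True = e False" using eq v0 by (simp add: place_powi[OF v0(1)])
    then have "t = 1" using eq g0 by simp
    have "int L dvd (e False - h False - \<rho>) - (e True - h True - \<rho>)" using e(1) e(1) by (rule dvd_diff)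
    then have "int L dvd d" using ee by (simp add: h_def)
    then show ?thesis using L(2) \<open>t = 1\<close> by (meson dvd_trans of_nat_dvd_iff)
  qed
  then show ?thesis using V by blast
qed

text \<open>t - 1 has no pole, so it can vanish at v only by being zero.\<close>

lemma constant_near_1:
  fixes t :: 'k
  assumes v: "is_place v" and t: "t \<noteq> 0" "\<forall>w. is_place w \<longrightarrow> w t = 0" and near: "vge v (t - 1) 1"
  shows "t = 1"
proof -
  have "vge w (t - 1) 0" if "is_place w" for w
    using t(2) that by (intro vge_diff[OF that]) (auto simp: vge_def place_1[OF that])
  then have "v (t - 1) = 0" by (rule nonneg_everywhere_imp_constant[OF _ v])
  then show ?thesis using near by (simp add: vge_def)
qed

end

text \<open>An adelic point near which one approximates is only accessible through a predicate:
  \<^term>\<open>near v N a\<close> says that \<^term>\<open>a\<close> agrees with its component at \<^term>\<open>v\<close> up to order \<^term>\<open>N\<close>.\<close>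

locale adelic_limit = global_field K p for K :: "'k::field itself" and p +
  fixes \<Sigma> S0 :: "('k \<Rightarrow> int) set" and \<Gamma> :: "'k set" and near :: "('k \<Rightarrow> int) \<Rightarrow> int \<Rightarrow> 'k \<Rightarrow> bool"
  assumes \<Sigma>_places: "\<Sigma> \<subseteq> places" and cofinite: "finite (places - \<Sigma>)"
    and \<Gamma>: "mult_subgroup \<Gamma>" and S0: "finite S0" "\<Gamma> \<subseteq> S_units S0"
    and near_ex: "\<And>V N. finite V \<Longrightarrow> V \<subseteq> \<Sigma> \<Longrightarrow> \<exists>\<gamma>\<in>\<Gamma>. \<forall>v\<in>V. near v N \<gamma>"
    and near_diff: "\<And>v N a b. v \<in> \<Sigma> \<Longrightarrow> near v N a \<Longrightarrow> near v N b \<Longrightarrow> vge v (a - b) N"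
    and near_move: "\<And>v N a b. v \<in> \<Sigma> \<Longrightarrow> near v N a \<Longrightarrow> vge v (a - b) N \<Longrightarrow> near v N b"
    and near_mono: "\<And>v N M a. v \<in> \<Sigma> \<Longrightarrow> near v N a \<Longrightarrow> M \<le> N \<Longrightarrow> near v M a"
    and near_value: "\<And>v. v \<in> \<Sigma> \<Longrightarrow> \<exists>C. \<forall>N>C. \<forall>a. near v N a \<longrightarrow> v a = C"
begin

lemma place_\<Sigma>: "v \<in> \<Sigma> \<Longrightarrow> is_place v"
  using \<Sigma>_places by (auto simp: places_def)

text \<open>Outside \<open>S0\<close> all elements of \<Gamma> are units, and at the finitely many
  places of \<open>S0\<close> in \<Sigma> closeness to the point fixes the value. So two elements
  near the point differ by a unit on \<Sigma> that is close to 1.\<close>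

lemma close_quotients:
  assumes V1: "finite V1" "V1 \<subseteq> \<Sigma>"
  obtains V N where "finite V" "V \<subseteq> \<Sigma>"
    "\<And>\<gamma> \<gamma>'. \<gamma> \<in> \<Gamma> \<Longrightarrow> \<gamma>' \<in> \<Gamma> \<Longrightarrow> \<forall>v\<in>V. near v N \<gamma> \<and> near v N \<gamma>' \<Longrightarrow>
      (\<forall>v\<in>\<Sigma>. v (\<gamma> / \<gamma>') = 0) \<and> (\<forall>v\<in>V1. vge v (\<gamma> / \<gamma>' - 1) N1)"
proof -
  obtain C where C: "\<And>v N a. v \<in> \<Sigma> \<Longrightarrow> N > C v \<Longrightarrow> near v N a \<Longrightarrow> v a = C v"
    using near_value by metis
  define V where "V = V1 \<union> (\<Sigma> \<inter> S0)"
  have V: "finite V" "V \<subseteq> \<Sigma>" using V1 S0 by (auto simp: V_def)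
  \<comment> \<open>Passing from a difference to a quotient costs the value \<open>C v\<close> of
    the point at v, and reading off that value needs a precision above it.\<close>
  define N where "N = \<bar>N1\<bar> + (\<Sum>v\<in>V. \<bar>C v\<bar>) + 1"
  have CN: "C v < N" "N1 \<le> N - C v" if "v \<in> V" for v
  proof -
    have "\<bar>C v\<bar> \<le> (\<Sum>v\<in>V. \<bar>C v\<bar>)" using V(1) that by (intro member_le_sum) auto
    then show "C v < N" "N1 \<le> N - C v" by (auto simp: N_def)
  qed
  have main: "(\<forall>v\<in>\<Sigma>. v (\<gamma> / \<gamma>') = 0) \<and> (\<forall>v\<in>V1. vge v (\<gamma> / \<gamma>' - 1) N1)"
    if \<gamma>: "\<gamma> \<in> \<Gamma>" "\<gamma>' \<in> \<Gamma>" and close: "\<forall>v\<in>V. near v N \<gamma> \<and> near v N \<gamma>'" for \<gamma> \<gamma>'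
  proof (intro conjI ballI)
    have nz: "\<gamma> \<noteq> 0" "\<gamma>' \<noteq> 0" using \<gamma> \<Gamma> by (auto simp: mult_subgroup_def)
    fix v assume v: "v \<in> \<Sigma>"
    have "v \<gamma> = v \<gamma>'"
    proof (cases "v \<in> S0")
      case True
      then have vV: "v \<in> V" using v by (simp add: V_def)
      then have "v \<gamma> = C v" "v \<gamma>' = C v" using close v CN(1)[OF vV] by (auto intro!: C)
      then show ?thesis by simp
    next
      case False
      have "v \<delta> = 0" if "\<delta> \<in> \<Gamma>" for \<delta>
        using that S0(2) v \<Sigma>_places False unfolding S_units_def by blast
      then show ?thesis using \<gamma> by simp
    qed
    then show "v (\<gamma> / \<gamma>') = 0" using nz by (simp add: place_divide[OF place_\<Sigma>[OF v]])
  next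
    have nz: "\<gamma> \<noteq> 0" "\<gamma>' \<noteq> 0" using \<gamma> \<Gamma> by (auto simp: mult_subgroup_def)
    fix v assume v1: "v \<in> V1"
    then have v: "v \<in> \<Sigma>" "v \<in> V" using V1 by (auto simp: V_def)
    have C': "v \<gamma>' = C v" using close v CN(1)[OF v(2)] by (auto intro!: C)
    have "vge v (\<gamma> - \<gamma>') N" using close v by (auto intro: near_diff)
    moreover have "\<gamma> - \<gamma>' = \<gamma>' * (\<gamma> / \<gamma>' - 1)" using nz by (simp add: right_diff_distrib)
    ultimately have "vge v (\<gamma> / \<gamma>' - 1) (N - C v)"
      using vge_mult_iff[OF place_\<Sigma>[OF v(1)] nz(2)] C' by metis
    then show "vge v (\<gamma> / \<gamma>' - 1) N1" using CN(2)[OF v(2)] vge_mono by blast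
  qed
  from V main show thesis by (rule that)
qed

text \<open>Here sufficiently close elements of \<Gamma> coincide, their quotient being a constant
  close to 1. The approximations stabilize, so the point itself comes from \<Gamma>.\<close>

lemma limit_constant:
  assumes const: "\<And>\<gamma>. \<gamma> \<in> \<Gamma> \<Longrightarrow> \<forall>v\<in>\<Sigma>. v \<gamma> = 0 \<Longrightarrow> \<forall>v. is_place v \<longrightarrow> v \<gamma> = 0"
  shows "\<exists>\<alpha>\<in>\<Gamma>. \<forall>V N. finite V \<longrightarrow> V \<subseteq> \<Sigma> \<longrightarrow> (\<forall>v\<in>V. near v N \<alpha>)"
proof -
  have "\<Sigma> \<noteq> {}" using infinitely_many_places cofinite by auto
  then obtain v1 where v1: "v1 \<in> \<Sigma>" by blast
  then have fin: "finite {v1}" "{v1} \<subseteq> \<Sigma>" by auto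
  obtain V N where V: "finite V" "V \<subseteq> \<Sigma>" and close: "\<And>\<gamma> \<gamma>'. \<gamma> \<in> \<Gamma> \<Longrightarrow> \<gamma>' \<in> \<Gamma> \<Longrightarrow> \<forall>v\<in>V. near v N \<gamma> \<and> near v N \<gamma>' \<Longrightarrow>
    (\<forall>v\<in>\<Sigma>. v (\<gamma> / \<gamma>') = 0) \<and> (\<forall>v\<in>{v1}. vge v (\<gamma> / \<gamma>' - 1) 1)"
    by (rule close_quotients[OF fin, of 1]) (rule that)
  obtain \<alpha> where \<alpha>: "\<alpha> \<in> \<Gamma>" "\<forall>v\<in>V. near v N \<alpha>" using near_ex[OF V] by blast
  have "near v N' \<alpha>" if V': "finite V'" "V' \<subseteq> \<Sigma>" "v \<in> V'" for V' N' v
  proof -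
    obtain \<gamma> where \<gamma>: "\<gamma> \<in> \<Gamma>" "\<forall>v\<in>V \<union> V'. near v (max N N') \<gamma>"
      using near_ex[of "V \<union> V'" "max N N'"] V V' by blast
    have "\<forall>v\<in>V. near v N \<gamma>" using \<gamma>(2) V near_mono by (metis UnI1 max.cobounded1 subsetD)
    then have q: "\<forall>v\<in>\<Sigma>. v (\<gamma> / \<alpha>) = 0" "vge v1 (\<gamma> / \<alpha> - 1) 1" using close[OF \<gamma>(1) \<alpha>(1)] \<alpha>(2) by auto
    have "\<gamma> / \<alpha> \<in> \<Gamma>" by (rule mult_subgroup_closed(5)[OF \<Gamma> \<gamma>(1) \<alpha>(1)])
    then have "\<gamma> / \<alpha> = 1"
      using q const mult_subgroup_closed(4)[OF \<Gamma>] by (intro constant_near_1[OF place_\<Sigma>[OF v1]]) blast+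
    then have "\<gamma> = \<alpha>" by simp
    then show ?thesis using \<gamma>(2) V' near_mono[of v "max N N'" \<alpha> N'] by auto
  qed
  then show ?thesis using \<alpha>(1) by blast
qed

text \<open>By \<open>cyc\<close>, close elements of \<Gamma> differ by a constant times a power of
  g; closeness makes the constant 1 and determines the exponent modulo every L. The point is
  therefore \<alpha> times g to a profinite power \<nu>.\<close>

lemma limit_exponents:
  fixes g :: 'k
  assumes g: "transc g" "g \<in> \<Gamma>" and unit: "\<forall>v\<in>\<Sigma>. v g = 0"
    and cyc: "\<And>\<gamma>. \<gamma> \<in> \<Gamma> \<Longrightarrow> \<forall>v\<in>\<Sigma>. v \<gamma> = 0 \<Longrightarrow> \<exists>n. \<forall>v. is_place v \<longrightarrow> v (\<gamma> * g powi n) = 0"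
  shows "\<exists>\<alpha>\<in>\<Gamma>. \<exists>\<nu>. \<forall>L>0. \<exists>V N. finite V \<and> V \<subseteq> \<Sigma> \<and>
    (\<forall>\<gamma>\<in>\<Gamma>. (\<forall>v\<in>V. near v N \<gamma>) \<longrightarrow> (\<exists>n. \<gamma> = \<alpha> * g powi n \<and> int L dvd n - \<nu> L))"
proof -
  have g0: "g \<noteq> 0" using transc_nonzero[OF g(1)] .
  have nb: "\<exists>V N. finite V \<and> V \<subseteq> \<Sigma> \<and> (\<forall>\<gamma>\<in>\<Gamma>. \<forall>\<gamma>'\<in>\<Gamma>. (\<forall>v\<in>V. near v N \<gamma> \<and> near v N \<gamma>') \<longrightarrow>
      (\<exists>n. \<gamma> = \<gamma>' * g powi n \<and> int L dvd n))" if L: "L > 0" for L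
  proof -
    obtain V1 N1 where VN1: "finite V1 \<and> V1 \<subseteq> \<Sigma> \<and> (\<forall>t d. t \<noteq> 0 \<longrightarrow> (\<forall>v. is_place v \<longrightarrow> v t = 0) \<longrightarrow>
       (\<forall>v\<in>V1. vge v (t * g powi d - 1) N1) \<longrightarrow> int L dvd d \<and> t = 1)"
      using constant_times_power_near_1[OF g(1) cofinite unit L] by (elim exE)
    note V1 = VN1[THEN conjunct1] VN1[THEN conjunct2, THEN conjunct1]
    note one = VN1[THEN conjunct2, THEN conjunct2, THEN spec, THEN spec, THEN mp, THEN mp, THEN mp]
    obtain V N where V: "finite V" "V \<subseteq> \<Sigma>" and close: "\<And>\<gamma> \<gamma>'. \<gamma> \<in> \<Gamma> \<Longrightarrow> \<gamma>' \<in> \<Gamma> \<Longrightarrow> \<forall>v\<in>V. near v N \<gamma> \<and> near v N \<gamma>' \<Longrightarrow>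
      (\<forall>v\<in>\<Sigma>. v (\<gamma> / \<gamma>') = 0) \<and> (\<forall>v\<in>V1. vge v (\<gamma> / \<gamma>' - 1) N1)"
      by (rule close_quotients[OF V1, of N1]) (rule that)
    have "\<exists>n. \<gamma> = \<gamma>' * g powi n \<and> int L dvd n"
      if \<gamma>: "\<gamma> \<in> \<Gamma>" "\<gamma>' \<in> \<Gamma>" and near: "\<forall>v\<in>V. near v N \<gamma> \<and> near v N \<gamma>'" for \<gamma> \<gamma>'
    proof -
      have q: "\<gamma> / \<gamma>' \<in> \<Gamma>" by (rule mult_subgroup_closed(5)[OF \<Gamma> \<gamma>])
      have nz: "\<gamma> / \<gamma>' \<noteq> 0" "\<gamma>' \<noteq> 0" using mult_subgroup_closed(4)[OF \<Gamma>] q \<gamma> by blast+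
      note cl = close[OF \<gamma> near, THEN conjunct1] close[OF \<gamma> near, THEN conjunct2]
      obtain n where n: "\<forall>v. is_place v \<longrightarrow> v (\<gamma> / \<gamma>' * g powi n) = 0" using cyc[OF q] cl(1) by blast
      define t where "t = \<gamma> / \<gamma>' * g powi n"
      have t0: "t \<noteq> 0" using nz g0 by (simp add: t_def)
      have tq: "t * g powi (- n) = \<gamma> / \<gamma>'" using g0 by (simp add: t_def power_int_minus)
      have "\<forall>v. is_place v \<longrightarrow> v t = 0" using n unfolding t_def .
      moreover have "\<forall>v\<in>V1. vge v (t * g powi (- n) - 1) N1" using cl(2) unfolding tq .
      ultimately have "int L dvd - n \<and> t = 1" by (rule one[OF t0])
      then show ?thesis using tq nz(2) by (intro exI[of _ "- n"]) (auto simp: field_simps)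
    qed
    then show ?thesis using V by blast
  qed
  \<comment> \<open>Level 1 carries no congruence; it forces the constant to be 1 and so fixes one
    base \<alpha> for all levels.\<close>
  obtain V1 N1 where VN1: "finite V1 \<and> V1 \<subseteq> \<Sigma> \<and> (\<forall>\<gamma>\<in>\<Gamma>. \<forall>\<gamma>'\<in>\<Gamma>. (\<forall>v\<in>V1. near v N1 \<gamma> \<and> near v N1 \<gamma>') \<longrightarrow>
      (\<exists>n. \<gamma> = \<gamma>' * g powi n \<and> int 1 dvd n))"
    using nb[OF zero_less_one] by (elim exE)
  note V1 = VN1[THEN conjunct1] VN1[THEN conjunct2, THEN conjunct1]
  note near1 = VN1[THEN conjunct2, THEN conjunct2, THEN bspec, THEN bspec, THEN mp]
  obtain \<alpha> where \<alpha>: "\<alpha> \<in> \<Gamma>" "\<forall>v\<in>V1. near v N1 \<alpha>" using near_ex[OF V1] by blast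
  have "\<exists>\<nu> V N. finite V \<and> V \<subseteq> \<Sigma> \<and>
    (\<forall>\<gamma>\<in>\<Gamma>. (\<forall>v\<in>V. near v N \<gamma>) \<longrightarrow> (\<exists>n. \<gamma> = \<alpha> * g powi n \<and> int L dvd n - \<nu>))" if L: "L > 0" for L
  proof -
    obtain V N where VN: "finite V \<and> V \<subseteq> \<Sigma> \<and> (\<forall>\<gamma>\<in>\<Gamma>. \<forall>\<gamma>'\<in>\<Gamma>. (\<forall>v\<in>V. near v N \<gamma> \<and> near v N \<gamma>') \<longrightarrow>
      (\<exists>n. \<gamma> = \<gamma>' * g powi n \<and> int L dvd n))"
      using nb[OF L] by (elim exE)
    note V = VN[THEN conjunct1] VN[THEN conjunct2, THEN conjunct1]
    note nearL = VN[THEN conjunct2, THEN conjunct2, THEN bspec, THEN bspec, THEN mp]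
    define W where "W = V \<union> V1"
    define M where "M = max N N1"
    have W: "finite W" "W \<subseteq> \<Sigma>" using V V1 by (auto simp: W_def)
    have down: "(\<forall>v\<in>V. near v N \<gamma>) \<and> (\<forall>v\<in>V1. near v N1 \<gamma>)" if "\<forall>v\<in>W. near v M \<gamma>" for \<gamma>
      using that W near_mono[of _ M \<gamma>] by (auto simp: W_def M_def)
    obtain \<gamma>0 where \<gamma>0: "\<gamma>0 \<in> \<Gamma>" "\<forall>v\<in>W. near v M \<gamma>0" using near_ex[OF W] by blast
    obtain \<nu> where \<nu>: "\<gamma>0 = \<alpha> * g powi \<nu>" using near1[OF \<gamma>0(1) \<alpha>(1)] down[OF \<gamma>0(2)] \<alpha>(2) by blast
    have "\<exists>n. \<gamma> = \<alpha> * g powi n \<and> int L dvd n - \<nu>" if \<gamma>: "\<gamma> \<in> \<Gamma>" "\<forall>v\<in>W. near v M \<gamma>" for \<gamma>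
    proof -
      obtain n where n: "\<gamma> = \<gamma>0 * g powi n" "int L dvd n"
        using nearL[OF \<gamma>(1) \<gamma>0(1)] down[OF \<gamma>0(2)] down[OF \<gamma>(2)] by blast
      then have "\<gamma> = \<alpha> * g powi (\<nu> + n)" using g0 by (simp add: \<nu> power_int_add)
      then show ?thesis using n(2) by (intro exI[of _ "\<nu> + n"]) simp
    qed
    then show ?thesis using W by blast
  qed
  then have "\<exists>\<nu>. \<forall>L>0. \<exists>V N. finite V \<and> V \<subseteq> \<Sigma> \<and>
    (\<forall>\<gamma>\<in>\<Gamma>. (\<forall>v\<in>V. near v N \<gamma>) \<longrightarrow> (\<exists>n. \<gamma> = \<alpha> * g powi n \<and> int L dvd n - \<nu> L))"
    by (intro choice allI) (meson)
  then show ?thesis using \<alpha>(1) by blast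
qed

end

section \<open>Exact points near adelic points\<close>

lemma powi_sum:
  fixes g :: "'k::field"
  assumes "g \<noteq> 0"
  shows "g powi (\<Sum>i\<in>I. e i) = (\<Prod>i\<in>I. g powi e i)"
  by (induction I rule: infinite_finite_induct) (auto simp: power_int_add assms)

lemma peval_powi:
  fixes g :: "'k::field"
  assumes g: "g \<noteq> 0"
  shows "peval M f (\<lambda>i. \<alpha> i * g powi n i) =
    (\<Sum>m\<in>{m. f m \<noteq> 0}. (f m * (\<Prod>i<M. \<alpha> i ^ m i)) * g powi (\<Sum>i<M. int (m i) * n i))"
  unfolding peval_def
proof (rule sum.cong[OF refl])
  fix m
  have "(\<Prod>i<M. (\<alpha> i * g powi n i) ^ m i) = (\<Prod>i<M. \<alpha> i ^ m i * g powi (int (m i) * n i))"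
  proof (rule prod.cong[OF refl])
    fix i
    have "(g powi n i) ^ m i = g powi (n i * int (m i))" by (simp only: power_int_mult power_int_of_nat)
    then show "(\<alpha> i * g powi n i) ^ m i = \<alpha> i ^ m i * g powi (int (m i) * n i)"
      by (simp add: power_mult_distrib mult.commute)
  qed
  then show "f m * (\<Prod>i<M. (\<alpha> i * g powi n i) ^ m i) =
      f m * (\<Prod>i<M. \<alpha> i ^ m i) * g powi (\<Sum>i<M. int (m i) * n i)"
    using g by (simp add: prod.distrib powi_sum mult.assoc)
qed

context global_field
begin

text \<open>Pairs of monomials are sorted by whether h_m(\<nu>) - h_m'(\<nu>) is an ordinary
  integer. If it is, the reduced exponents differ by exactly this integer, and \<open>n'\<close>
  reproduces it by \<open>special\<close>. If it is not, every small difference is refuted at a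
  level dividing L. This is the dichotomy that \<open>clustered_sum_vanishes\<close>
  requires.\<close>

lemma vanishing_specialization:
  fixes g :: 'k
  assumes g: "transc g" and cofinite: "finite (places - \<Sigma>)" and unit: "\<forall>v\<in>\<Sigma>. v g = 0"
    and fin: "finite {m. f m \<noteq> 0}"
    and \<nu>: "\<And>i. i < M \<Longrightarrow> compatible (\<nu> i)"
    and approx: "\<And>L V N. L > 0 \<Longrightarrow> finite V \<Longrightarrow> V \<subseteq> \<Sigma> \<Longrightarrow>
      \<exists>n. (\<forall>i<M. int L dvd n i - \<nu> i L) \<and> (\<forall>v\<in>V. vge v (peval M f (\<lambda>i. \<alpha> i * g powi n i)) N)"
    and special: "\<And>a b. \<forall>L>0. int L dvd (\<Sum>i<M. a i * \<nu> i L) - b \<Longrightarrow> (\<Sum>i<M. a i * n' i) = b"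
  shows "peval M f (\<lambda>i. \<alpha> i * g powi n' i) = 0"
proof -
  have g0: "g \<noteq> 0" using transc_nonzero[OF g] .
  define I where "I = {m. f m \<noteq> 0}"
  define c where "c m = f m * (\<Prod>i<M. \<alpha> i ^ m i)" for m
  define h where "h m n = (\<Sum>i<M. int (m i) * n i)" for m :: "nat \<Rightarrow> nat" and n :: "nat \<Rightarrow> int"
  have I: "finite I" using fin by (simp add: I_def)
  have ev: "peval M f (\<lambda>i. \<alpha> i * g powi n i) = (\<Sum>m\<in>I. c m * g powi h m n)" for n
    unfolding peval_powi[OF g0] I_def c_def h_def ..
  obtain q E where q: "q \<noteq> 0" and qE: "\<forall>v. is_place v \<longrightarrow> vge v q (int E * min 0 (v g)) \<and>
      (\<forall>i\<in>I. vge v (q * c i) (int E * min 0 (v g)))"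
    using common_denominator_ex[OF g I, of c] by (elim exE conjE)
  \<comment> \<open>The identity h_m(\<nu>) - h_m'(\<nu>) = d in the profinite integers.\<close>
  define rel where "rel m m' d \<longleftrightarrow> (\<forall>L>0. int L dvd h m (\<lambda>i. \<nu> i L) - h m' (\<lambda>i. \<nu> i L) - d)" for m m' d
  \<comment> \<open>If no d satisfies \<open>rel\<close>, the choice is arbitrary and merely
    enlarges D.\<close>
  define dd where "dd m m' = (SOME d. rel m m' d)" for m m'
  define D where "D = (\<Sum>m\<in>I. \<Sum>m'\<in>I. \<bar>dd m m'\<bar>)"
  have D0: "D \<ge> 0" unfolding D_def by (intro sum_nonneg) auto
  have ddD: "\<bar>dd m m'\<bar> \<le> D" if "m \<in> I" "m' \<in> I" for m m'
  proof -
    have "\<bar>dd m m'\<bar> \<le> (\<Sum>m'\<in>I. \<bar>dd m m'\<bar>)"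
      using that I member_le_sum[of m' I "\<lambda>m'. \<bar>dd m m'\<bar>"] by simp
    also have "\<dots> \<le> D"
      unfolding D_def using that I member_le_sum[of m I "\<lambda>m. \<Sum>m'\<in>I. \<bar>dd m m'\<bar>"] by (simp add: sum_nonneg)
    finally show ?thesis .
  qed
  have "\<forall>m m' d. \<exists>L::nat. L > 0 \<and> (\<not> rel m m' d \<longrightarrow> \<not> int L dvd h m (\<lambda>i. \<nu> i L) - h m' (\<lambda>i. \<nu> i L) - d)"
    unfolding rel_def by (auto intro: exI[of _ 1])
  \<comment> \<open>\<open>W m m' d\<close> is a level at which a false identity already
    fails.\<close>
  then obtain W where W: "\<And>m m' d. W m m' d > (0::nat)"
    "\<And>m m' d. \<not> rel m m' d \<Longrightarrow>
      \<not> int (W m m' d) dvd h m (\<lambda>i. \<nu> i (W m m' d)) - h m' (\<lambda>i. \<nu> i (W m m' d)) - d"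
    by metis
  \<comment> \<open>Only the differences with |d| <= D + E have to be refuted, so one modulus can
    contain all the levels.\<close>
  define Q where "Q = (\<Prod>m\<in>I. \<Prod>m'\<in>I. \<Prod>d\<in>{- (D + int E)..D + int E}. W m m' d)"
  have Q: "Q > 0" unfolding Q_def using W(1) by (auto intro!: prod_pos)
  have WQ: "W m m' d dvd Q" if "m \<in> I" "m' \<in> I" "\<bar>d\<bar> \<le> D + int E" for m m' d
  proof -
    have "W m m' d dvd (\<Prod>d\<in>{- (D + int E)..D + int E}. W m m' d)"
      using that by (intro dvd_prodI) auto
    also have "\<dots> dvd (\<Prod>m'\<in>I. \<Prod>d\<in>{- (D + int E)..D + int E}. W m m' d)"
      using that I by (intro dvd_prodI) auto
    also have "\<dots> dvd Q"
      unfolding Q_def using that I by (intro dvd_prodI[of I m "\<lambda>m. \<Prod>m'\<in>I. \<Prod>d\<in>{- (D + int E)..D + int E}. W m m' d"]) auto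
    finally show ?thesis .
  qed
  \<comment> \<open>The slack D + 1 keeps the exponents so far below L that a difference congruent
    to \<open>dd m m'\<close> modulo L must equal it.\<close>
  have "\<exists>L>0. Q dvd L \<and> (\<exists>V N. finite V \<and> V \<subseteq> \<Sigma> \<and> V \<subseteq> places \<and>
    (\<forall>(I::(nat \<Rightarrow> nat) set) c h. finite I \<longrightarrow> card I \<le> card {m. f m \<noteq> 0} \<longrightarrow>
      (\<forall>i\<in>I. \<forall>v. is_place v \<longrightarrow> vge v (c i) (int E * min 0 (v g))) \<longrightarrow>
      (\<forall>v\<in>V. vge v (\<Sum>i\<in>I. c i * g powi h i) N) \<longrightarrow>
      (\<exists>\<rho> e. (\<forall>i\<in>I. 0 \<le> e i \<and> e i < int L - int (nat D + 1) \<and> int L dvd e i - h i - \<rho>) \<and>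
        (\<Sum>i\<in>I. c i * g powi e i) = 0)))"
    by (rule periodic_vanishing[OF g cofinite unit Q])
  then obtain L V N where L: "L > 0" "Q dvd L" and V: "finite V" "V \<subseteq> \<Sigma>" "V \<subseteq> places"
    and main: "\<forall>(I::(nat \<Rightarrow> nat) set) c h. finite I \<longrightarrow> card I \<le> card {m. f m \<noteq> 0} \<longrightarrow>
      (\<forall>i\<in>I. \<forall>v. is_place v \<longrightarrow> vge v (c i) (int E * min 0 (v g))) \<longrightarrow>
      (\<forall>v\<in>V. vge v (\<Sum>i\<in>I. c i * g powi h i) N) \<longrightarrow>
      (\<exists>\<rho> e. (\<forall>i\<in>I. 0 \<le> e i \<and> e i < int L - int (nat D + 1) \<and> int L dvd e i - h i - \<rho>) \<and>
        (\<Sum>i\<in>I. c i * g powi e i) = 0)"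
    by (elim exE conjE) (rule that; assumption)
  obtain n where n: "\<forall>i<M. int L dvd n i - \<nu> i L"
    and close: "\<forall>v\<in>V. vge v (peval M f (\<lambda>i. \<alpha> i * g powi n i)) N"
    using approx[OF L(1) V(1,2), of N] by (elim exE conjE)
  have qsum: "(\<Sum>m\<in>I. q * c m * g powi k m) = q * (\<Sum>m\<in>I. c m * g powi k m)" for k
    by (simp add: sum_distrib_left mult.assoc)
  have "\<exists>\<rho> e. (\<forall>m\<in>I. 0 \<le> e m \<and> e m < int L - int (nat D + 1) \<and> int L dvd e m - h m n - \<rho>) \<and>
      (\<Sum>m\<in>I. q * c m * g powi e m) = 0"
  proof (intro main[THEN spec, THEN spec, THEN spec, THEN mp, THEN mp, THEN mp, THEN mp] ballI)
    show "finite I" by (rule I)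
    show "card I \<le> card {m. f m \<noteq> 0}" by (simp add: I_def)
    show "\<forall>v. is_place v \<longrightarrow> vge v (q * c m) (int E * min 0 (v g))" if "m \<in> I" for m
      using qE that by blast
    show "vge v (\<Sum>m\<in>I. q * c m * g powi h m n) N" if "v \<in> V" for v
    proof -
      have v: "is_place v" "v g = 0" using that V unit by (auto simp: places_def)
      have "vge v q 0" using qE v by fastforce
      moreover have "vge v (peval M f (\<lambda>i. \<alpha> i * g powi n i)) N" using close that by blast
      ultimately show ?thesis unfolding qsum ev[symmetric] using vge_mult[OF v(1)] by fastforce
    qed
  qed
  then obtain \<rho> e where e: "\<forall>m\<in>I. 0 \<le> e m \<and> e m < int L - int (nat D + 1) \<and> int L dvd e m - h m n - \<rho>"
    "(\<Sum>m\<in>I. q * c m * g powi e m) = 0" by (elim exE conjE)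
  have h_cong: "int K dvd h m n1 - h m n2" if "\<forall>i<M. int K dvd n1 i - n2 i" for K m n1 n2
  proof -
    have "h m n1 - h m n2 = (\<Sum>i<M. int (m i) * (n1 i - n2 i))"
      by (simp add: h_def sum_subtractf right_diff_distrib)
    also have "int K dvd \<dots>" using that by (intro dvd_sum dvd_mult) auto
    finally show ?thesis .
  qed
  have e_diff: "int L dvd (e m - e m') - (h m (\<lambda>i. \<nu> i L) - h m' (\<lambda>i. \<nu> i L))" if m: "m \<in> I" "m' \<in> I" for m m'
  proof -
    have "int L dvd (e m - h m n - \<rho>) - (e m' - h m' n - \<rho>)" using e(1) m by (intro dvd_diff[of "int L" "_ - \<rho>" "_ - \<rho>"]) blast+
    moreover have "int L dvd (h m n - h m (\<lambda>i. \<nu> i L)) - (h m' n - h m' (\<lambda>i. \<nu> i L))"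
      by (rule dvd_diff[OF h_cong[OF n] h_cong[OF n]])
    ultimately have "int L dvd ((e m - h m n - \<rho>) - (e m' - h m' n - \<rho>)) +
       ((h m n - h m (\<lambda>i. \<nu> i L)) - (h m' n - h m' (\<lambda>i. \<nu> i L)))" by (rule dvd_add)
    then show ?thesis by (simp add: algebra_simps)
  qed
  have "(\<Sum>m\<in>I. q * c m * g powi h m n') = 0"
  proof (rule clustered_sum_vanishes[OF g I D0 _ _ e(2)])
    show "vge v (q * c m) (int E * min 0 (v g))" if "m \<in> I" "is_place v" for m and v :: "'k \<Rightarrow> int"
      using qE that by blast
    fix m m' assume m: "m \<in> I" "m' \<in> I"
    show "\<bar>e m - e m'\<bar> \<le> D \<and> h m n' - h m' n' = e m - e m' \<or> D + int E < \<bar>e m - e m'\<bar>"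
    proof (cases "\<exists>d. rel m m' d")
      case True
      then have r: "rel m m' (dd m m')" unfolding dd_def by (rule someI_ex)
      then have "int L dvd h m (\<lambda>i. \<nu> i L) - h m' (\<lambda>i. \<nu> i L) - dd m m'" using L(1) by (simp add: rel_def)
      from dvd_add[OF e_diff[OF m] this]
      have "int L dvd ((e m - e m') - (h m (\<lambda>i. \<nu> i L) - h m' (\<lambda>i. \<nu> i L))) +
        (h m (\<lambda>i. \<nu> i L) - h m' (\<lambda>i. \<nu> i L) - dd m m')" .
      also have "\<dots> = e m - e m' - dd m m'" by simp
      finally have "int L dvd e m - e m' - dd m m'" .
      moreover have "\<bar>e m - e m' - dd m m'\<bar> < int L"
      proof -
        have "0 \<le> e m" "e m < int L - int (nat D + 1)" "0 \<le> e m'" "e m' < int L - int (nat D + 1)"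
          using e(1) m by auto
        then show ?thesis using ddD[OF m] D0 by linarith
      qed
      ultimately have eq: "e m - e m' = dd m m'" 
        using dvd_imp_le_int[of "e m - e m' - dd m m'" "int L"] by linarith
      have "(\<Sum>i<M. (int (m i) - int (m' i)) * n' i) = dd m m'"
      proof (rule special)
        show "\<forall>L>0. int L dvd (\<Sum>i<M. (int (m i) - int (m' i)) * \<nu> i L) - dd m m'"
          using r by (simp add: rel_def h_def left_diff_distrib sum_subtractf)
      qed
      then have "h m n' - h m' n' = dd m m'" by (simp add: h_def left_diff_distrib sum_subtractf)
      then show ?thesis using eq ddD[OF m] by simp
    next
      case False
      \<comment> \<open>A small difference would be congruent to h_m(\<nu>) - h_m'(\<nu>) modulo the
        very level that refutes it, since that level divides Q and hence L.\<close>
      have "\<not> \<bar>e m - e m'\<bar> \<le> D + int E"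
      proof
        assume le: "\<bar>e m - e m'\<bar> \<le> D + int E"
        define w where "w = W m m' (e m - e m')"
        have w: "w > 0" "\<not> int w dvd h m (\<lambda>i. \<nu> i w) - h m' (\<lambda>i. \<nu> i w) - (e m - e m')"
          using W False by (auto simp: w_def)
        have wL: "w dvd L" using WQ[OF m le] L(2) unfolding w_def by (rule dvd_trans)
        have "\<forall>i<M. int w dvd \<nu> i L - \<nu> i w" using \<nu> w(1) L(1) wL by (auto simp: compatible_def)
        then have "int w dvd (h m (\<lambda>i. \<nu> i L) - h m (\<lambda>i. \<nu> i w)) - (h m' (\<lambda>i. \<nu> i L) - h m' (\<lambda>i. \<nu> i w))"
          by (intro dvd_diff[OF h_cong h_cong])
        moreover have "int w dvd (e m - e m') - (h m (\<lambda>i. \<nu> i L) - h m' (\<lambda>i. \<nu> i L))"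
          using e_diff[OF m] wL by (meson dvd_trans of_nat_dvd_iff)
        ultimately have "int w dvd ((e m - e m') - (h m (\<lambda>i. \<nu> i L) - h m' (\<lambda>i. \<nu> i L))) +
          ((h m (\<lambda>i. \<nu> i L) - h m (\<lambda>i. \<nu> i w)) - (h m' (\<lambda>i. \<nu> i L) - h m' (\<lambda>i. \<nu> i w)))" by (intro dvd_add)
        then have "int w dvd - (h m (\<lambda>i. \<nu> i w) - h m' (\<lambda>i. \<nu> i w) - (e m - e m'))"
          by (simp add: algebra_simps)
        then show False using w(2) by (simp only: dvd_minus_iff)
      qed
      then show ?thesis by simp
    qed
  qed
  then show ?thesis unfolding qsum ev[symmetric] using q by simp
qed

text \<open>The hypothesis \<open>cont\<close> expresses that the approximated adelic point lies on the variety.\<close>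

theorem exact_points:
  fixes near :: "nat \<Rightarrow> ('k \<Rightarrow> int) \<Rightarrow> int \<Rightarrow> 'k \<Rightarrow> bool"
  assumes near: "\<And>i. i < M \<Longrightarrow> adelic_limit K p \<Sigma> S0 \<Gamma> (near i)"
    and \<Sigma>_places: "\<Sigma> \<subseteq> places" and cofinite: "finite (places - \<Sigma>)" and \<Gamma>: "mult_subgroup \<Gamma>"
    and rank: "rank_le (\<Gamma> \<inter> S_units (places - \<Sigma>)) 1"
    and F: "\<And>f. f \<in> F \<Longrightarrow> is_poly M f"
    and cont: "\<And>f v N. f \<in> F \<Longrightarrow> v \<in> \<Sigma> \<Longrightarrow>
      \<exists>N'. \<forall>a. (\<forall>i<M. near i v N' (a i)) \<longrightarrow> vge v (peval M f a) N"
    and V0: "finite V0" "V0 \<subseteq> \<Sigma>"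
  shows "\<exists>a\<in>{..<M} \<rightarrow>\<^sub>E \<Gamma>. (\<forall>f\<in>F. peval M f a = 0) \<and> (\<forall>i<M. \<forall>v\<in>V0. near i v N0 (a i))"
proof (cases "\<forall>\<gamma>\<in>\<Gamma>. (\<forall>v\<in>\<Sigma>. v \<gamma> = 0) \<longrightarrow> (\<forall>v. is_place v \<longrightarrow> v \<gamma> = 0)")
  case True
  \<comment> \<open>All units on \<Sigma> in \<Gamma> are constants here, so every coordinate of the
    point comes from \<Gamma>.\<close>
  have "\<exists>\<alpha>\<in>\<Gamma>. \<forall>V N. finite V \<longrightarrow> V \<subseteq> \<Sigma> \<longrightarrow> (\<forall>v\<in>V. near i v N \<alpha>)" if "i < M" for i
    using True by (intro adelic_limit.limit_constant[OF near[OF that]]) blast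
  then obtain \<alpha> where \<alpha>: "\<And>i. i < M \<Longrightarrow> \<alpha> i \<in> \<Gamma> \<and> (\<forall>V N. finite V \<longrightarrow> V \<subseteq> \<Sigma> \<longrightarrow> (\<forall>v\<in>V. near i v N (\<alpha> i)))"
    by metis
  have \<alpha>': "near i v N (\<alpha> i)" if "i < M" "v \<in> \<Sigma>" for i v N
  proof -
    have "finite {v}" "{v} \<subseteq> \<Sigma>" using that by auto
    then show ?thesis using \<alpha>[OF that(1)] by blast
  qed
  define a where "a = restrict \<alpha> {..<M}"
  have "\<Sigma> \<noteq> {}" using infinitely_many_places cofinite by auto
  then obtain v1 where v1: "v1 \<in> \<Sigma>" by blast
  have "peval M f a = 0" if f: "f \<in> F" for f
  proof (rule ccontr)
    assume nz: "peval M f a \<noteq> 0"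
    \<comment> \<open>Asking for a precision one above the order of the value itself leaves no room
      for a nonzero value.\<close>
    obtain N' where "\<forall>b. (\<forall>i<M. near i v1 N' (b i)) \<longrightarrow> vge v1 (peval M f b) (v1 (peval M f a) + 1)"
      using cont[OF f v1] by blast
    then have "vge v1 (peval M f a) (v1 (peval M f a) + 1)" using \<alpha>' v1 by (simp add: a_def)
    then show False using nz by (simp add: vge_def)
  qed
  moreover have "a \<in> {..<M} \<rightarrow>\<^sub>E \<Gamma>" using \<alpha> by (auto simp: a_def)
  moreover have "\<forall>i<M. \<forall>v\<in>V0. near i v N0 (a i)" using \<alpha>' V0 by (auto simp: a_def)
  ultimately show ?thesis by blast
next
  case False
  then obtain g0 v0 where g0: "g0 \<in> \<Gamma>" "\<forall>v\<in>\<Sigma>. v g0 = 0" and v0: "is_place v0" "v0 g0 \<noteq> 0" by blast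
  have \<Gamma>_unit: "\<gamma> \<in> \<Gamma> \<inter> S_units (places - \<Sigma>)" if "\<gamma> \<in> \<Gamma>" "\<forall>v\<in>\<Sigma>. v \<gamma> = 0" for \<gamma>
    using that mult_subgroup_closed(4)[OF \<Gamma>] by (auto simp: S_units_def)
  have plS: "is_place v" if "v \<in> \<Sigma>" for v using that \<Sigma>_places by (auto simp: places_def)
  text \<open>Rank at most one: the valuation \<^term>\<open>v0\<close> detects everything but constants.\<close>
  have kernel: "\<forall>v. is_place v \<longrightarrow> v h = 0" if h: "h \<in> \<Gamma>" "\<forall>v\<in>\<Sigma>. v h = 0" "v0 h = 0" for h
  proof -
    have ne: "h \<noteq> g0" using h v0 by auto
    have h0: "h \<noteq> 0" and g00: "g0 \<noteq> 0" using h g0 mult_subgroup_closed(4)[OF \<Gamma>] by auto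
    have "\<not> mult_independent {h, g0}"
    proof
      assume "mult_independent {h, g0}"
      moreover have "{h, g0} \<subseteq> \<Gamma> \<inter> S_units (places - \<Sigma>)"
        using \<Gamma>_unit[OF h(1,2)] \<Gamma>_unit[OF g0] by simp
      ultimately have "card {h, g0} \<le> 1"
        by (intro rank[unfolded rank_le_def, THEN HOL.spec, THEN mp]) simp
      then show False using ne by simp
    qed
    then obtain e where e: "(\<Prod>a\<in>{h, g0}. a powi e a) = 1" "e h \<noteq> 0 \<or> e g0 \<noteq> 0"
      unfolding mult_independent_def by auto
    have prod: "h powi e h * g0 powi e g0 = 1" using e(1) ne by simp
    then have "v0 (h powi e h * g0 powi e g0) = 0" by (simp add: place_1[OF v0(1)])
    then have "e g0 * v0 g0 = 0"
      using h0 g00 h(3) by (simp add: place_mult[OF v0(1)] place_powi[OF v0(1)])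
    then have eg: "e g0 = 0" using v0 by simp
    then have eh: "e h \<noteq> 0" and hp: "h powi e h = 1" using e(2) prod by auto
    show ?thesis
    proof (intro allI impI)
      fix v :: "'k \<Rightarrow> int" assume v: "is_place v"
      have "e h * v h = 0" using place_powi[OF v, of h "e h"] hp by (simp add: place_1[OF v])
      then show "v h = 0" using eh by simp
    qed
  qed
  \<comment> \<open>The least positive value of \<open>v0\<close> on the units on \<Sigma> in
    \<Gamma>; division with remainder turns an element attaining it into a generator modulo
    constants.\<close>
  define P where "P d \<longleftrightarrow> d > 0 \<and> (\<exists>\<gamma>\<in>\<Gamma>. (\<forall>v\<in>\<Sigma>. v \<gamma> = 0) \<and> v0 \<gamma> = int d)" for d :: nat
  have "P (nat \<bar>v0 g0\<bar>)"
  proof (cases "v0 g0 > 0")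
    case True
    then show ?thesis unfolding P_def using g0 by (intro conjI bexI[of _ g0]) auto
  next
    case False
    have "inverse g0 \<in> \<Gamma>" using g0 mult_subgroup_closed(3)[OF \<Gamma>] by blast
    then show ?thesis unfolding P_def using g0 v0 False
      by (intro conjI bexI[of _ "inverse g0"]) (auto simp: place_inverse[OF v0(1)] place_inverse[OF plS])
  qed
  define d where "d = (LEAST d. P d)"
  have "P d" unfolding d_def using \<open>P (nat \<bar>v0 g0\<bar>)\<close> by (rule LeastI)
  then obtain g where d: "d > 0" and g: "g \<in> \<Gamma>" "\<forall>v\<in>\<Sigma>. v g = 0" "v0 g = int d" by (auto simp: P_def)
  have gtr: "transc g" using g d by (intro transc_if_place[OF v0(1)]) simp
  have gnz: "g \<noteq> 0" using transc_nonzero[OF gtr] .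
  have cyc: "\<exists>n. \<forall>v. is_place v \<longrightarrow> v (\<gamma> * g powi n) = 0" if \<gamma>: "\<gamma> \<in> \<Gamma>" "\<forall>v\<in>\<Sigma>. v \<gamma> = 0" for \<gamma>
  proof -
    define n where "n = - (v0 \<gamma> div int d)"
    define y where "y = \<gamma> * g powi n"
    have nz: "\<gamma> \<noteq> 0" using \<gamma> mult_subgroup_closed(4)[OF \<Gamma>] by blast
    have y: "y \<in> \<Gamma>" unfolding y_def using \<gamma> g by (intro mult_subgroup_closed(2)[OF \<Gamma>] mult_subgroup_powi[OF \<Gamma>])
    have val: "v y = v \<gamma> + n * v g" if "is_place v" for v
      using nz gnz by (simp add: y_def place_mult[OF that] place_powi[OF that])
    have y\<Sigma>: "\<forall>v\<in>\<Sigma>. v y = 0" 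
    proof
      fix v assume v: "v \<in> \<Sigma>"
      have "v \<gamma> = 0" "v g = 0" using \<gamma>(2) g(2) v by blast+
      then show "v y = 0" using val[OF plS[OF v]] by simp
    qed
    have v0y: "v0 y = v0 \<gamma> mod int d"
      using val[OF v0(1)] g(3) minus_div_mult_eq_mod[of "v0 \<gamma>" "int d"] by (simp add: n_def)
    have "v0 y < int d" "0 \<le> v0 y" unfolding v0y using d by simp_all
    have "\<not> P (nat (v0 y))"
      using not_less_Least[of "nat (v0 y)" P] \<open>v0 y < int d\<close> d unfolding d_def[symmetric] by (simp add: nat_less_iff)
    then have "v0 y = 0" using y y\<Sigma> \<open>0 \<le> v0 y\<close> unfolding P_def by auto
    then show ?thesis using kernel[OF y y\<Sigma>] unfolding y_def by blast
  qed
  define PN where "PN i \<alpha> z L V N \<longleftrightarrow> finite V \<and> V \<subseteq> \<Sigma> \<and>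
    (\<forall>\<gamma>\<in>\<Gamma>. (\<forall>v\<in>V. near i v N \<gamma>) \<longrightarrow> (\<exists>n. \<gamma> = \<alpha> * g powi n \<and> int L dvd n - z L))"
    for i and \<alpha> :: 'k and z :: "nat \<Rightarrow> int" and L V N
  define PE where "PE i \<alpha> z \<longleftrightarrow> (\<forall>L>0. \<exists>V N. PN i \<alpha> z L V N)" for i \<alpha> z
  have "\<exists>\<alpha>\<in>\<Gamma>. \<exists>z. PE i \<alpha> z" if "i < M" for i
    unfolding PE_def PN_def
  proof (rule adelic_limit.limit_exponents[OF near[OF that] gtr g(1,2)])
    show "\<exists>n. \<forall>v. is_place v \<longrightarrow> v (\<gamma> * g powi n) = 0" if "\<gamma> \<in> \<Gamma>" "\<forall>v\<in>\<Sigma>. v \<gamma> = 0" for \<gamma>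
      using that by (rule cyc)
  qed
  then obtain \<alpha> \<nu> where \<alpha>\<nu>: "\<And>i. i < M \<Longrightarrow> \<alpha> i \<in> \<Gamma> \<and> PE i (\<alpha> i) (\<nu> i)" by metis
  then have "\<exists>V N. PN i (\<alpha> i) (\<nu> i) L V N" if "i < M" "L > 0" for i L using that unfolding PE_def by blast
  then obtain NV NN where nb: "\<And>i L. i < M \<Longrightarrow> L > 0 \<Longrightarrow> PN i (\<alpha> i) (\<nu> i) L (NV i L) (NN i L)" by metis
  have nbV: "finite (NV i L)" "NV i L \<subseteq> \<Sigma>" if "i < M" "L > 0" for i L
    using nb[OF that] unfolding PN_def by blast+
  have nbn: "\<exists>n. \<gamma> = \<alpha> i * g powi n \<and> int L dvd n - \<nu> i L"
    if "i < M" "L > 0" "\<gamma> \<in> \<Gamma>" "\<forall>v\<in>NV i L. near i v (NN i L) \<gamma>" for i L \<gamma>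
    using nb[OF that(1,2)] that(3,4) unfolding PN_def by blast
  have \<alpha>: "\<alpha> i \<in> \<Gamma>" if "i < M" for i using \<alpha>\<nu> that by blast
  have \<alpha>nz: "\<alpha> i \<noteq> 0" if "i < M" for i using \<alpha>[OF that] mult_subgroup_closed(4)[OF \<Gamma>] by blast
  have mono: "near i v M' a" if "i < M" "v \<in> \<Sigma>" "near i v N a" "M' \<le> N" for i v N M' a
    using adelic_limit.near_mono[OF near[OF that(1)] that(2-4)] .
  have find: "\<exists>\<gamma>\<in>\<Gamma>. (\<forall>v\<in>V. near i v N \<gamma>) \<and> (\<forall>v\<in>V'. near i v N' \<gamma>)"
    if i: "i < M" and V: "finite V" "V \<subseteq> \<Sigma>" "finite V'" "V' \<subseteq> \<Sigma>" for i V V' N N'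
  proof -
    have VV: "finite (V \<union> V')" "V \<union> V' \<subseteq> \<Sigma>" using V by auto
    have "\<exists>\<gamma>\<in>\<Gamma>. \<forall>v\<in>V \<union> V'. near i v (max N N') \<gamma>"
      by (rule adelic_limit.near_ex[OF near[OF i] VV])
    then obtain \<gamma> where \<gamma>: "\<gamma> \<in> \<Gamma>" "\<forall>v\<in>V \<union> V'. near i v (max N N') \<gamma>" by (rule bexE)
    have "near i v N \<gamma>" if "v \<in> V" for v
    proof (rule mono[OF i])
      show "v \<in> \<Sigma>" using that V by blast
      show "near i v (max N N') \<gamma>" using \<gamma>(2) that by blast
    qed simp
    moreover have "near i v N' \<gamma>" if "v \<in> V'" for v
    proof (rule mono[OF i])
      show "v \<in> \<Sigma>" using that V by blast
      show "near i v (max N N') \<gamma>" using \<gamma>(2) that by blast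
    qed simp
    ultimately show ?thesis using \<gamma>(1) by blast
  qed
  have compat: "compatible (\<nu> i)" if i: "i < M" for i
    unfolding compatible_def
  proof (intro allI impI)
    fix L L' :: nat assume L: "0 < L" "0 < L'" "L dvd L'"
    \<comment> \<open>One element close enough for both levels; its exponent is unique because g has
      nonzero value at \<open>v0\<close>.\<close>
    obtain \<gamma> where \<gamma>: "\<gamma> \<in> \<Gamma>" "\<forall>v\<in>NV i L. near i v (NN i L) \<gamma>" "\<forall>v\<in>NV i L'. near i v (NN i L') \<gamma>"
      using find[OF i nbV[OF i L(1)] nbV[OF i L(2)]] by blast
    obtain n where n: "\<gamma> = \<alpha> i * g powi n" "int L dvd n - \<nu> i L" using nbn[OF i L(1) \<gamma>(1,2)] by blast
    obtain n' where n': "\<gamma> = \<alpha> i * g powi n'" "int L' dvd n' - \<nu> i L'" using nbn[OF i L(2) \<gamma>(1,3)] by blast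
    have "g powi n = g powi n'" using n n' \<alpha>nz[OF i] by simp
    then have nn: "n = n'" using g d by (intro place_powi_inject[OF v0(1)]) auto
    have "int L dvd n' - \<nu> i L'" using n'(2) L(3) by (meson dvd_trans of_nat_dvd_iff)
    from dvd_diff[OF n(2) this] show "int L dvd \<nu> i L' - \<nu> i L" by (simp add: nn)
  qed
  have approx: "\<exists>n. (\<forall>i<M. int L dvd n i - \<nu> i L) \<and> (\<forall>i<M. \<forall>v\<in>V. near i v N (\<alpha> i * g powi n i))"
    if L: "L > 0" and V: "finite V" "V \<subseteq> \<Sigma>" for L V N
  proof -
    have "\<forall>i. \<exists>n. i < M \<longrightarrow> int L dvd n - \<nu> i L \<and> (\<forall>v\<in>V. near i v N (\<alpha> i * g powi n))"
    proof (intro allI)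
      fix i
      show "\<exists>n. i < M \<longrightarrow> int L dvd n - \<nu> i L \<and> (\<forall>v\<in>V. near i v N (\<alpha> i * g powi n))"
      proof (cases "i < M")
        case True
        obtain \<gamma> where \<gamma>: "\<gamma> \<in> \<Gamma>" "\<forall>v\<in>V. near i v N \<gamma>" "\<forall>v\<in>NV i L. near i v (NN i L) \<gamma>"
          using find[OF True V nbV[OF True L]] by blast
        then show ?thesis using nbn[OF True L \<gamma>(1,3)] by blast
      qed simp
    qed
    from choice[OF this] obtain n where "\<forall>i. i < M \<longrightarrow> int L dvd n i - \<nu> i L \<and> (\<forall>v\<in>V. near i v N (\<alpha> i * g powi n i))"
      by (rule exE)
    then show ?thesis by blast
  qed
  \<comment> \<open>Precision for powers of g that survives multiplication by each
    \<open>\<alpha> i\<close>.\<close>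
  define R where "R = \<bar>N0\<bar> + (\<Sum>i<M. \<Sum>v\<in>V0. \<bar>v (\<alpha> i)\<bar>)"
  have R: "N0 - v (\<alpha> i) \<le> R" if "i < M" "v \<in> V0" for i v
  proof -
    have "\<bar>v (\<alpha> i)\<bar> \<le> (\<Sum>v\<in>V0. \<bar>v (\<alpha> i)\<bar>)" using that V0(1) by (intro member_le_sum) auto
    also have "\<dots> \<le> (\<Sum>i<M. \<Sum>v\<in>V0. \<bar>v (\<alpha> i)\<bar>)"
      using that member_le_sum[of i "{..<M}" "\<lambda>i. \<Sum>v\<in>V0. \<bar>v (\<alpha> i)\<bar>"] by (simp add: sum_nonneg)
    finally show ?thesis unfolding R_def by linarith
  qed
  \<comment> \<open>With g^Q this close to 1, exponents congruent modulo Q give powers that agree to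
    precision R on \<open>V0\<close>.\<close>
  have "\<exists>Q>0. \<forall>v\<in>V0. vge v (g ^ Q - 1) R"
    using V0 plS g(2) by (intro common_power_close_to_1[OF V0(1) _ gtr]) blast
  then obtain Q where Q: "Q > 0" "\<forall>v\<in>V0. vge v (g ^ Q - 1) R" by blast
  have "\<exists>n. (\<forall>i\<in>{..<M}. int Q dvd n i - \<nu> i Q) \<and>
    (\<forall>a b. (\<forall>L>0. int L dvd (\<Sum>i\<in>{..<M}. a i * \<nu> i L) - b) \<longrightarrow> (\<Sum>i\<in>{..<M}. a i * n i) = b)"
    using compat Q(1) by (intro integral_specialization) auto
  then obtain n' where n': "\<forall>i\<in>{..<M}. int Q dvd n' i - \<nu> i Q"
    and special: "\<And>a b. \<forall>L>0. int L dvd (\<Sum>i<M. a i * \<nu> i L) - b \<Longrightarrow> (\<Sum>i<M. a i * n' i) = b"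
    by blast
  define a where "a = restrict (\<lambda>i. \<alpha> i * g powi n' i) {..<M}"
  have pa: "peval M f a = peval M f (\<lambda>i. \<alpha> i * g powi n' i)" for f
    unfolding peval_def a_def by (intro sum.cong refl arg_cong2[of _ _ _ _ "(*)"] prod.cong) auto
  have a\<Gamma>: "a \<in> {..<M} \<rightarrow>\<^sub>E \<Gamma>"
    using \<alpha> mult_subgroup_powi[OF \<Gamma> g(1)] mult_subgroup_closed(2)[OF \<Gamma>] by (auto simp: a_def)
  have zero: "peval M f a = 0" if f: "f \<in> F" for f
    unfolding pa
  proof (rule vanishing_specialization[OF gtr cofinite g(2)])
    show "compatible (\<nu> i)" if "i < M" for i using that by (rule compat)
    show "(\<Sum>i<M. a i * n' i) = b" if "\<forall>L>0. int L dvd (\<Sum>i<M. a i * \<nu> i L) - b" for a b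
      using that by (rule special)
    show "finite {m. f m \<noteq> 0}" using F[OF f] by (simp add: is_poly_def)
    fix L :: nat and V :: "('k \<Rightarrow> int) set" and N assume L: "0 < L" and V: "finite V" "V \<subseteq> \<Sigma>"
    have "\<forall>v. \<exists>N'. v \<in> V \<longrightarrow> (\<forall>b. (\<forall>i<M. near i v N' (b i)) \<longrightarrow> vge v (peval M f b) N)"
      using cont[OF f] V by blast
    from choice[OF this] obtain N' where N': "\<forall>v. v \<in> V \<longrightarrow> (\<forall>b. (\<forall>i<M. near i v (N' v) (b i)) \<longrightarrow> vge v (peval M f b) N)"
      by (rule exE)
    define N'' where "N'' = (\<Sum>v\<in>V. \<bar>N' v\<bar>)"
    have le: "N' v \<le> N''" if "v \<in> V" for v
      using member_le_sum[OF that, of "\<lambda>v. \<bar>N' v\<bar>"] V(1) by (simp add: N''_def)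
    obtain n where n: "\<forall>i<M. int L dvd n i - \<nu> i L" "\<forall>i<M. \<forall>v\<in>V. near i v N'' (\<alpha> i * g powi n i)"
      using approx[OF L V] by blast
    have "vge v (peval M f (\<lambda>i. \<alpha> i * g powi n i)) N" if v: "v \<in> V" for v
    proof -
      have "near i v (N' v) (\<alpha> i * g powi n i)" if i: "i < M" for i
      proof (rule mono[OF i _ _ le[OF v]])
        show "v \<in> \<Sigma>" using v V by blast
        show "near i v N'' (\<alpha> i * g powi n i)" using n(2) v i by blast
      qed
      then have "\<forall>i<M. near i v (N' v) (\<alpha> i * g powi n i)" by blast
      then show ?thesis by (rule N'[THEN HOL.spec, THEN mp, OF v, THEN HOL.spec, THEN mp])
    qed
    then show "\<exists>n. (\<forall>i<M. int L dvd n i - \<nu> i L) \<and> (\<forall>v\<in>V. vge v (peval M f (\<lambda>i. \<alpha> i * g powi n i)) N)"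
      using n(1) by blast
  qed
  \<comment> \<open>An inexact approximation with exponents n is the intermediary: it is near the
    point by construction, and n and n' agree modulo Q.\<close>
  have close: "near i v N0 (a i)" if i: "i < M" and v: "v \<in> V0" for i v
  proof -
    have v\<Sigma>: "v \<in> \<Sigma>" and pv: "is_place v" and vg: "v g = 0" using v V0 plS g(2) by auto
    obtain n where n: "\<forall>i<M. int Q dvd n i - \<nu> i Q" "\<forall>i<M. \<forall>v\<in>V0. near i v N0 (\<alpha> i * g powi n i)"
      using approx[OF Q(1) V0] by blast
    have "int Q dvd (n i - \<nu> i Q) - (n' i - \<nu> i Q)" using n(1) n' i by (intro dvd_diff[of "int Q" "_ - \<nu> i Q" "_ - \<nu> i Q"]) auto
    then have "int Q dvd n i - n' i" by simp
    from vge_powi_diff[OF pv gnz vg this] have "vge v (g powi n i - g powi n' i) (v (g ^ Q - 1))" .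
    moreover have "R \<le> v (g ^ Q - 1)"
      using Q v transc_power_neq_1[OF gtr Q(1)] by (auto simp: vge_def)
    ultimately have "vge v (g powi n i - g powi n' i) (N0 - v (\<alpha> i))"
      using R[OF i v] by (auto intro: vge_mono)
    then have "vge v (\<alpha> i * (g powi n i - g powi n' i)) N0"
      using vge_mult_iff[OF pv \<alpha>nz[OF i]] by blast
    then have "vge v (\<alpha> i * g powi n i - \<alpha> i * g powi n' i) N0" by (simp add: right_diff_distrib)
    moreover have "near i v N0 (\<alpha> i * g powi n i)" using n(2) i v by blast
    ultimately have "near i v N0 (\<alpha> i * g powi n' i)"
      using adelic_limit.near_move[OF near[OF i] v\<Sigma>] by blast
    then show ?thesis using i by (simp add: a_def)
  qed
  show ?thesis using a\<Gamma> zero close by blast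
qed

end

section \<open>Topology\<close>

lemma vnull_eventually: "vnull v X \<longleftrightarrow> (\<forall>N. eventually (\<lambda>n. vge v (X n) N) sequentially)"
  by (simp add: vnull_def eventually_sequentially)

lemma vball_eventually:
  "vball v N \<xi> = {\<eta> \<in> compl v. \<exists>X\<in>\<xi>. \<exists>Y\<in>\<eta>. eventually (\<lambda>n. vge v (X n - Y n) N) sequentially}"
  by (simp add: vball_def eventually_sequentially)

lemma eventually_vge_trans:
  assumes v: "is_place v" and "eventually (\<lambda>n. vge v (X n - Y n) N) sequentially"
    "eventually (\<lambda>n. vge v (Y n - Z n) N) sequentially"
  shows "eventually (\<lambda>n. vge v (X n - Z n) N) sequentially"
  using assms(2,3)
proof eventually_elim
  case (elim n)
  then show ?case using vge_add[OF v elim] by simp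
qed

lemma eventually_vge_commute:
  assumes v: "is_place v" and "eventually (\<lambda>n. vge v (X n - Y n) N) sequentially"
  shows "eventually (\<lambda>n. vge v (Y n - X n) N) sequentially"
  using assms(2) by (simp add: vge_commute[OF v])

lemma vcauchy_const: "vcauchy v (\<lambda>_. a)"
  by (simp add: vcauchy_def)

lemma in_vclass: "vcauchy v X \<Longrightarrow> X \<in> vclass v X"
  by (simp add: vclass_def vnull_def)

lemma compl_units_subset: "compl_units v \<subseteq> compl v"
  by (auto simp: compl_units_def compl_def)

lemma compl_rep_ex: "\<xi> \<in> compl v \<Longrightarrow> \<exists>X. X \<in> \<xi>"
  using in_vclass by (auto simp: compl_def)

lemma compl_rep_cauchy: "\<xi> \<in> compl v \<Longrightarrow> X \<in> \<xi> \<Longrightarrow> vcauchy v X"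
  by (auto simp: compl_def vclass_def)

lemma compl_rep_diff:
  assumes v: "is_place v" and \<xi>: "\<xi> \<in> compl v" "X \<in> \<xi>" "Y \<in> \<xi>"
  shows "eventually (\<lambda>n. vge v (X n - Y n) N) sequentially"
proof -
  obtain Z where Z: "\<xi> = vclass v Z" using \<xi>(1) by (auto simp: compl_def)
  have "eventually (\<lambda>n. vge v (Z n - X n) N) sequentially" "eventually (\<lambda>n. vge v (Z n - Y n) N) sequentially"
    using \<xi>(2,3) by (auto simp: Z vclass_def vnull_eventually)
  then show ?thesis using eventually_vge_trans[OF v] eventually_vge_commute[OF v] by blast
qed

text \<open>\<open>vball\<close> asks for one pair of representatives; as representatives of a class
  differ by null sequences, every pair works.\<close>

lemma vball_rep:
  assumes v: "is_place v" and \<xi>: "\<xi> \<in> compl v" and \<eta>: "\<eta> \<in> vball v N \<xi>" and XY: "X \<in> \<xi>" "Y \<in> \<eta>"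
  shows "eventually (\<lambda>n. vge v (X n - Y n) N) sequentially"
proof -
  obtain X' Y' where X'Y': "X' \<in> \<xi>" "Y' \<in> \<eta>" "eventually (\<lambda>n. vge v (X' n - Y' n) N) sequentially"
    and \<eta>c: "\<eta> \<in> compl v"
    using \<eta> by (auto simp: vball_eventually)
  show ?thesis
    by (rule eventually_vge_trans[OF v compl_rep_diff[OF v \<xi> XY(1) X'Y'(1)]
        eventually_vge_trans[OF v X'Y'(3) compl_rep_diff[OF v \<eta>c X'Y'(2) XY(2)]]])
qed

lemma vball_self: "is_place v \<Longrightarrow> \<xi> \<in> compl v \<Longrightarrow> \<xi> \<in> vball v N \<xi>"
  using compl_rep_ex compl_rep_diff unfolding vball_eventually by blast

lemma vball_trans:
  assumes v: "is_place v" and \<xi>: "\<xi> \<in> compl v" and \<eta>: "\<eta> \<in> vball v N \<xi>" and \<zeta>: "\<zeta> \<in> vball v N \<eta>"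
  shows "\<zeta> \<in> vball v N \<xi>"
proof -
  have c: "\<eta> \<in> compl v" "\<zeta> \<in> compl v" using \<eta> \<zeta> by (auto simp: vball_eventually)
  obtain X Y Z where "X \<in> \<xi>" "Y \<in> \<eta>" "Z \<in> \<zeta>" using compl_rep_ex \<xi> c by metis
  then have "eventually (\<lambda>n. vge v (X n - Z n) N) sequentially"
    using eventually_vge_trans[OF v vball_rep[OF v \<xi> \<eta>] vball_rep[OF v c(1) \<zeta>]] by blast
  then show ?thesis using c \<open>X \<in> \<xi>\<close> \<open>Z \<in> \<zeta>\<close> by (auto simp: vball_eventually)
qed

lemma vball_mono:
  assumes "\<eta> \<in> vball v N \<xi>" "M \<le> N"
  shows "\<eta> \<in> vball v M \<xi>"
proof -
  obtain X Y where XY: "X \<in> \<xi>" "Y \<in> \<eta>" "eventually (\<lambda>n. vge v (X n - Y n) N) sequentially" "\<eta> \<in> compl v"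
    using assms(1) by (auto simp: vball_eventually)
  from XY(3) have "eventually (\<lambda>n. vge v (X n - Y n) M) sequentially"
    by eventually_elim (rule vge_mono[OF _ assms(2)])
  then show ?thesis using XY by (auto simp: vball_eventually)
qed

lemma const_in_vemb: "(\<lambda>_. a) \<in> vemb v a"
  unfolding vemb_def by (rule in_vclass[OF vcauchy_const])

lemma vemb_in_compl: "vemb v a \<in> compl v"
  unfolding vemb_def compl_def using vcauchy_const by blast

lemma vemb_in_compl_units: "a \<noteq> 0 \<Longrightarrow> vemb v a \<in> compl_units v"
proof -
  assume a: "a \<noteq> 0"
  have "\<not> vnull v (\<lambda>_. a)"
  proof
    assume "vnull v (\<lambda>_. a)"
    then have "vge v a (v a + 1)" by (auto simp: vnull_def)
    then show False using a by (simp add: vge_def)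
  qed
  then show ?thesis unfolding vemb_def compl_units_def using vcauchy_const by blast
qed

lemma vemb_in_vball_iff:
  assumes v: "is_place v" and \<xi>: "\<xi> \<in> compl v" "X \<in> \<xi>"
  shows "vemb v a \<in> vball v N \<xi> \<longleftrightarrow> eventually (\<lambda>n. vge v (X n - a) N) sequentially"
proof
  assume "vemb v a \<in> vball v N \<xi>"
  then show "eventually (\<lambda>n. vge v (X n - a) N) sequentially"
    by (rule vball_rep[OF v \<xi>(1) _ \<xi>(2) const_in_vemb])
next
  assume H: "eventually (\<lambda>n. vge v (X n - a) N) sequentially"
  show "vemb v a \<in> vball v N \<xi>"
    unfolding vball_eventually
    by (intro CollectI conjI vemb_in_compl bexI[OF _ \<xi>(2)] bexI[OF _ const_in_vemb] H)
qed

text \<open>For a non-null Cauchy sequence there is an N such that terms of value below N occur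
  arbitrarily late, when all differences already have value at least N. The strict triangle
  inequality then freezes the value.\<close>

lemma compl_unit_value:
  assumes v: "is_place v" and \<xi>: "\<xi> \<in> compl_units v" "X \<in> \<xi>"
  shows "\<exists>C. eventually (\<lambda>n. X n \<noteq> 0 \<and> v (X n) = C) sequentially"
proof -
  obtain Z where Z: "\<xi> = vclass v Z" "vcauchy v Z" "\<not> vnull v Z" using \<xi>(1) by (auto simp: compl_units_def)
  have \<xi>c: "\<xi> \<in> compl v" using \<xi>(1) compl_units_subset by blast
  have nn: "\<not> vnull v X"
  proof
    assume X: "vnull v X"
    have "eventually (\<lambda>n. vge v (Z n) N) sequentially" for N
    proof -
      have "eventually (\<lambda>n. vge v (X n) N) sequentially" using X by (simp add: vnull_eventually)
      moreover have "eventually (\<lambda>n. vge v (Z n - X n) N) sequentially"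
        using compl_rep_diff[OF v \<xi>c _ \<xi>(2)] in_vclass[OF Z(2)] Z(1) by simp
      ultimately show ?thesis
      proof eventually_elim
        case (elim n)
        then show ?case using vge_add[OF v elim] by simp
      qed
    qed
    then show False using Z(3) by (simp add: vnull_eventually)
  qed
  then obtain N where N: "\<forall>n0. \<exists>n\<ge>n0. \<not> vge v (X n) N" by (auto simp: vnull_def)
  obtain n0 where n0: "\<forall>m\<ge>n0. \<forall>n\<ge>n0. vge v (X m - X n) N"
    using compl_rep_cauchy[OF \<xi>c \<xi>(2)] unfolding vcauchy_def by blast
  obtain m where m: "m \<ge> n0" "\<not> vge v (X m) N" using N by blast
  have X0: "X m \<noteq> 0" and lt: "v (X m) < N" using m(2) by (auto simp: vge_def)
  have "X n \<noteq> 0 \<and> v (X n) = v (X m)" if n: "n \<ge> n0" for n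
  proof -
    have "vge v (X n - X m) N" using n0 n m(1) by blast
    then have "vge v (X n - X m) (v (X m) + 1)" by (rule vge_mono) (use lt in simp)
    from place_add_dominant[OF v X0 this] show ?thesis by simp
  qed
  then show ?thesis unfolding eventually_sequentially by blast
qed

lemma vcauchy_bounded:
  assumes v: "is_place v" and X: "vcauchy v X"
  shows "\<exists>C\<le>0. eventually (\<lambda>n. vge v (X n) C) sequentially"
proof -
  obtain n0 where n0: "\<forall>m\<ge>n0. \<forall>n\<ge>n0. vge v (X m - X n) 0" using X unfolding vcauchy_def by blast
  have "vge v (X n) (min 0 (v (X n0)))" if "n \<ge> n0" for n
  proof -
    have "vge v (X n - X n0) 0" using n0 that by blast
    then have "vge v (X n - X n0) (min 0 (v (X n0)))" by (rule vge_mono) simp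
    moreover have "vge v (X n0) (min 0 (v (X n0)))" by (intro vge_mono[OF vge_self]) auto
    ultimately show ?thesis using vge_add[OF v] by fastforce
  qed
  then show ?thesis unfolding eventually_sequentially
    by (intro exI[of _ "min 0 (v (X n0))"]) auto
qed

section \<open>Continuity of polynomial evaluation\<close>

text \<open>Rests on x^(k+1) - y^(k+1) = x (x^k - y^k) + (x - y) y^k; each factor costs at most the
  common pole bound C.\<close>

lemma vge_power_diff:
  assumes v: "is_place v" and C: "C \<le> 0" and x: "vge v x C" and y: "vge v y C" and xy: "vge v (x - y) N"
  shows "vge v (x ^ k) (int k * C)" "vge v (x ^ k - y ^ k) (N + int k * C)"
proof -
  have pw: "vge v (z ^ k) (int k * C)" if "vge v z C" for z and k :: nat
  proof (induction k)
    case (Suc k)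
    then show ?case using vge_mult[OF v that Suc] by (simp add: distrib_right)
  qed (simp add: vge_1[OF v])
  show "vge v (x ^ k) (int k * C)" by (rule pw[OF x])
  show "vge v (x ^ k - y ^ k) (N + int k * C)"
  proof (induction k)
    case (Suc k)
    have "vge v (x * (x ^ k - y ^ k)) (N + int (Suc k) * C)"
      using vge_mult[OF v x Suc] by (simp add: algebra_simps)
    moreover have "vge v ((x - y) * y ^ k) (N + int (Suc k) * C)"
      using vge_mult[OF v xy pw[OF y, of k]] C by (rule_tac vge_mono) (auto simp: distrib_right)
    ultimately have "vge v (x * (x ^ k - y ^ k) + (x - y) * y ^ k) (N + int (Suc k) * C)"
      by (rule vge_add[OF v])
    then show ?case by (simp add: algebra_simps)
  qed simp
qed

lemma vge_monomial_diff:
  fixes M :: nat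
  assumes v: "is_place v" and C: "C \<le> 0"
    and xy: "\<And>i. i < M \<Longrightarrow> vge v (x i) C \<and> vge v (y i) C \<and> vge v (x i - y i) N"
  shows "vge v ((\<Prod>i<M. x i ^ m i) - (\<Prod>i<M. y i ^ m i)) (N + int (\<Sum>i<M. m i) * C)"
proof -
  have "k \<le> M \<Longrightarrow> vge v (\<Prod>i<k. x i ^ m i) (int (\<Sum>i<k. m i) * C) \<and>
      vge v ((\<Prod>i<k. x i ^ m i) - (\<Prod>i<k. y i ^ m i)) (N + int (\<Sum>i<k. m i) * C)" for k
  proof (induction k)
    case 0
    then show ?case by (simp add: vge_1[OF v])
  next
    case (Suc k)
    define X Y where "X = (\<Prod>i<k. x i ^ m i)" and "Y = (\<Prod>i<k. y i ^ m i)"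
    have IH: "vge v X (int (\<Sum>i<k. m i) * C)" "vge v (X - Y) (N + int (\<Sum>i<k. m i) * C)"
      using Suc by (auto simp: X_def Y_def)
    have k: "vge v (x k) C" "vge v (y k) C" "vge v (x k - y k) N" using xy[of k] Suc.prems by auto
    have pk: "vge v (x k ^ m k) (int (m k) * C)" "vge v (x k ^ m k - y k ^ m k) (N + int (m k) * C)"
      by (rule vge_power_diff[OF v C k])+
    have "vge v (y k - x k) N" using k(3) vge_commute[OF v] by blast
    from vge_power_diff(1)[OF v C k(2,1) this] have pyk: "vge v (y k ^ m k) (int (m k) * C)" .
    have e: "int (\<Sum>i<Suc k. m i) * C = int (\<Sum>i<k. m i) * C + int (m k) * C" by (simp add: distrib_right)
    have "vge v (X * (x k ^ m k - y k ^ m k)) (N + int (\<Sum>i<Suc k. m i) * C)"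
      unfolding e using vge_mult[OF v IH(1) pk(2)] by (simp only: ac_simps)
    moreover have "vge v ((X - Y) * y k ^ m k) (N + int (\<Sum>i<Suc k. m i) * C)"
      unfolding e using vge_mult[OF v IH(2) pyk] by (simp only: ac_simps)
    ultimately have "vge v (X * (x k ^ m k - y k ^ m k) + (X - Y) * y k ^ m k) (N + int (\<Sum>i<Suc k. m i) * C)"
      by (rule vge_add[OF v])
    moreover have "X * (x k ^ m k - y k ^ m k) + (X - Y) * y k ^ m k = X * x k ^ m k - Y * y k ^ m k"
      by (simp add: algebra_simps)
    moreover have "vge v (X * x k ^ m k) (int (\<Sum>i<Suc k. m i) * C)"
      using vge_mult[OF v IH(1) pk(1)] by (simp only: e)
    ultimately show ?case by (simp only: X_def Y_def prod.lessThan_Suc)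
  qed
  then show ?thesis by blast
qed

text \<open>Uniformity over points of value at least C lets one precision serve a whole tail of
  Cauchy sequences.\<close>

lemma peval_uniformly_continuous:
  assumes v: "is_place v" and f: "is_poly M f" and C: "C \<le> 0"
  shows "\<exists>N1. \<forall>x y. (\<forall>i<M. vge v (x i) C \<and> vge v (x i - y i) N1) \<longrightarrow> vge v (peval M f x - peval M f y) N"
proof -
  define I where "I = {m. f m \<noteq> 0}"
  define b where "b m = v (f m) + int (\<Sum>i<M. m i) * C" for m
  \<comment> \<open>The summand |C| makes y inherit the bound C from x; the rest pays for
    coefficients and degrees.\<close>
  define N1 where "N1 = \<bar>N\<bar> + \<bar>C\<bar> + (\<Sum>m\<in>I. \<bar>b m\<bar>)"
  have I: "finite I" using f by (simp add: is_poly_def I_def)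
  have b: "N \<le> N1 + b m" if "m \<in> I" for m
    using member_le_sum[OF that, of "\<lambda>m. \<bar>b m\<bar>"] I unfolding N1_def by simp
  have "(\<Sum>m\<in>I. \<bar>b m\<bar>) \<ge> 0" by (intro sum_nonneg) auto
  then have N1C: "C \<le> N1" unfolding N1_def by linarith
  have "vge v (peval M f x - peval M f y) N"
    if xy: "\<forall>i<M. vge v (x i) C \<and> vge v (x i - y i) N1" for x y
  proof -
    have y: "vge v (y i) C" if "i < M" for i
    proof -
      have "vge v (x i) C" "vge v (x i - y i) C" using xy that N1C vge_mono by blast+
      from vge_diff[OF v this] show ?thesis by simp
    qed
    have "peval M f x - peval M f y = (\<Sum>m\<in>I. f m * ((\<Prod>i<M. x i ^ m i) - (\<Prod>i<M. y i ^ m i)))"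
      by (simp add: peval_def I_def sum_subtractf right_diff_distrib)
    also have "vge v \<dots> N"
    proof (rule vge_sum[OF v])
      fix m assume m: "m \<in> I"
      have "vge v ((\<Prod>i<M. x i ^ m i) - (\<Prod>i<M. y i ^ m i)) (N1 + int (\<Sum>i<M. m i) * C)"
        by (rule vge_monomial_diff[OF v C]) (use xy y in blast)
      from vge_mult[OF v vge_self this, of "f m"]
      show "vge v (f m * ((\<Prod>i<M. x i ^ m i) - (\<Prod>i<M. y i ^ m i))) N"
        by (rule vge_mono) (use b[OF m] in \<open>simp add: b_def\<close>)
    qed
    finally show ?thesis .
  qed
  then show ?thesis by blast
qed

text \<open>The precision N1 does not depend on a, so an approximating point can be chosen after
  it.\<close>

lemma peval_at_cauchy:
  assumes v: "is_place v" and f: "is_poly M f" and X: "\<And>i. i < M \<Longrightarrow> vcauchy v (X i)"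
  shows "\<exists>N1. \<forall>a. (\<forall>i<M. eventually (\<lambda>n. vge v (X i n - a i) N1) sequentially) \<longrightarrow>
    eventually (\<lambda>n. vge v (peval M f (\<lambda>i. X i n) - peval M f a) N) sequentially"
proof -
  have "\<forall>i. \<exists>C. i < M \<longrightarrow> C \<le> 0 \<and> eventually (\<lambda>n. vge v (X i n) C) sequentially"
    using vcauchy_bounded[OF v X] by blast
  from choice[OF this] obtain C where C: "\<And>i. i < M \<Longrightarrow> C i \<le> 0 \<and> eventually (\<lambda>n. vge v (X i n) (C i)) sequentially"
    by blast
  \<comment> \<open>All \<open>C i\<close> are non-positive, so their sum lies below each of them,
    and the empty case M = 0 needs no separate treatment.\<close>
  define C' where "C' = (\<Sum>i<M. C i)"
  have C': "C' \<le> 0" unfolding C'_def using C by (intro sum_nonpos) auto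
  have C'C: "C' \<le> C i" if "i < M" for i
  proof -
    have "C' = C i + (\<Sum>i\<in>{..<M} - {i}. C i)" unfolding C'_def using that by (simp add: sum.remove)
    moreover have "(\<Sum>i\<in>{..<M} - {i}. C i) \<le> 0" using C by (intro sum_nonpos) auto
    ultimately show ?thesis by simp
  qed
  have bd: "eventually (\<lambda>n. \<forall>i\<in>{..<M}. vge v (X i n) C') sequentially"
  proof (rule eventually_ball_finite)
    show "\<forall>i\<in>{..<M}. eventually (\<lambda>n. vge v (X i n) C') sequentially"
    proof
      fix i assume "i \<in> {..<M}"
      then have i: "i < M" by simp
      from C[OF i] have "eventually (\<lambda>n. vge v (X i n) (C i)) sequentially" by blast
      then show "eventually (\<lambda>n. vge v (X i n) C') sequentially"
        by eventually_elim (rule vge_mono[OF _ C'C[OF i]])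
    qed
  qed simp
  obtain N1 where N1: "\<And>x y. (\<forall>i<M. vge v (x i) C' \<and> vge v (x i - y i) N1) \<Longrightarrow>
      vge v (peval M f x - peval M f y) N"
    using peval_uniformly_continuous[OF v f C'] by blast
  have "eventually (\<lambda>n. vge v (peval M f (\<lambda>i. X i n) - peval M f a) N) sequentially"
    if a: "\<forall>i<M. eventually (\<lambda>n. vge v (X i n - a i) N1) sequentially" for a
  proof -
    have "eventually (\<lambda>n. \<forall>i\<in>{..<M}. vge v (X i n - a i) N1) sequentially"
      using a by (intro eventually_ball_finite) auto
    with bd show ?thesis by eventually_elim (rule N1, simp)
  qed
  then show ?thesis by blast
qed

lemma vzero_near:
  assumes v: "is_place v" and f: "is_poly M f" and \<xi>: "\<And>i. i < M \<Longrightarrow> \<xi> i \<in> compl v"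
    and zero: "vzero v M f \<xi>"
  shows "\<exists>N'. \<forall>a. (\<forall>i<M. vemb v (a i) \<in> vball v N' (\<xi> i)) \<longrightarrow> vge v (peval M f a) N"
proof -
  obtain X where X: "\<And>i. i < M \<Longrightarrow> X i \<in> \<xi> i" using compl_rep_ex[OF \<xi>] by metis
  have cauchy: "vcauchy v (X i)" if "i < M" for i by (rule compl_rep_cauchy[OF \<xi>[OF that] X[OF that]])
  obtain N1 where N1: "\<forall>a. (\<forall>i<M. eventually (\<lambda>n. vge v (X i n - a i) N1) sequentially) \<longrightarrow>
    eventually (\<lambda>n. vge v (peval M f (\<lambda>i. X i n) - peval M f a) N) sequentially"
    using peval_at_cauchy[OF v f cauchy] by (rule exE)
  have "vge v (peval M f a) N" if a: "\<forall>i<M. vemb v (a i) \<in> vball v N1 (\<xi> i)" for a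
  proof -
    have "\<forall>i<M. eventually (\<lambda>n. vge v (X i n - a i) N1) sequentially"
      using a vemb_in_vball_iff[OF v \<xi> X] by blast
    from mp[OF spec[OF N1] this] have "eventually (\<lambda>n. vge v (peval M f (\<lambda>i. X i n) - peval M f a) N) sequentially" .
    moreover have "eventually (\<lambda>n. vge v (peval M f (\<lambda>i. X i n)) N) sequentially"
      using zero X by (auto simp: vzero_def vnull_eventually)
    ultimately have "eventually (\<lambda>n. vge v (peval M f a) N) sequentially"
    proof eventually_elim
      case (elim n)
      then show ?case using vge_diff[OF v elim(2,1)] by simp
    qed
    then show ?thesis by simp
  qed
  then show ?thesis by blast
qed

lemma vzero_if_approximable:
  assumes v: "is_place v" and f: "is_poly M f" and \<xi>: "\<And>i. i < M \<Longrightarrow> \<xi> i \<in> compl v"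
    and ex: "\<And>N. \<exists>a. peval M f a = 0 \<and> (\<forall>i<M. vemb v (a i) \<in> vball v N (\<xi> i))"
  shows "vzero v M f \<xi>"
  unfolding vzero_def vnull_eventually
proof (intro allI impI)
  fix X N assume X: "\<forall>i<M. X i \<in> \<xi> i"
  have cauchy: "vcauchy v (X i)" if "i < M" for i using compl_rep_cauchy[OF \<xi>[OF that]] X that by blast
  obtain N1 where N1: "\<forall>a. (\<forall>i<M. eventually (\<lambda>n. vge v (X i n - a i) N1) sequentially) \<longrightarrow>
    eventually (\<lambda>n. vge v (peval M f (\<lambda>i. X i n) - peval M f a) N) sequentially"
    using peval_at_cauchy[OF v f cauchy] by (rule exE)
  obtain a where a: "peval M f a = 0" "\<forall>i<M. vemb v (a i) \<in> vball v N1 (\<xi> i)" using ex by blast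
  have "\<forall>i<M. eventually (\<lambda>n. vge v (X i n - a i) N1) sequentially"
    using a(2) vemb_in_vball_iff[OF v \<xi>] X by blast
  from mp[OF spec[OF N1] this] show "eventually (\<lambda>n. vge v (peval M f (\<lambda>i. X i n)) N) sequentially"
    by (simp add: a(1))
qed

section \<open>Neighbourhood bases and closures in the product topologies\<close>

lemma topspace_Kv:
  assumes v: "is_place v"
  shows "topspace (Kv_star_top v) = compl_units v"
  unfolding Kv_star_top_def topology_generated_by_topspace
  using vball_self[OF v] compl_units_subset[of v] by blast

lemma openin_Kv_vball:
  assumes "\<xi> \<in> compl_units v"
  shows "openin (Kv_star_top v) (vball v N \<xi> \<inter> compl_units v)"
  unfolding Kv_star_top_def by (rule topology_generated_by_Basis) (use assms in blast)

text \<open>Every point of an ultrametric ball is a centre of it, so a basic set around another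
  centre contains the ball of the same radius; intersections take the larger precision.\<close>

lemma Kv_open_contains_vball:
  assumes v: "is_place v" and U: "openin (Kv_star_top v) U" and \<xi>: "\<xi> \<in> U"
  shows "\<exists>N. vball v N \<xi> \<inter> compl_units v \<subseteq> U"
proof -
  have "generate_topology_on {vball v N \<xi> \<inter> compl_units v | N \<xi>. \<xi> \<in> compl_units v} U"
    using U unfolding Kv_star_top_def openin_topology_generated_by_iff .
  then show ?thesis using \<xi>
  proof (induction arbitrary: \<xi>)
    case (Int a b)
    obtain N1 N2 where N: "vball v N1 \<xi> \<inter> compl_units v \<subseteq> a" "vball v N2 \<xi> \<inter> compl_units v \<subseteq> b"
      using Int.IH Int.prems by blast
    have "vball v (max N1 N2) \<xi> \<subseteq> vball v N1 \<xi>" "vball v (max N1 N2) \<xi> \<subseteq> vball v N2 \<xi>"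
      using vball_mono by (metis max.cobounded1 max.cobounded2 subsetI)+
    then show ?case using N by (intro exI[of _ "max N1 N2"]) blast
  next
    case (UN K)
    then show ?case by blast
  next
    case (Basis s)
    then obtain N \<xi>0 where s: "s = vball v N \<xi>0 \<inter> compl_units v" "\<xi>0 \<in> compl_units v" by blast
    have "vball v N \<xi> \<subseteq> vball v N \<xi>0"
      using vball_trans[OF v, of \<xi>0 \<xi> N] Basis.prems s compl_units_subset by blast
    then show ?case using s(1) by blast
  qed simp
qed

context
  fixes \<Sigma> :: "('k::field \<Rightarrow> int) set"
  assumes \<Sigma>: "\<Sigma> \<subseteq> places"
begin

lemma place_in: "v \<in> \<Sigma> \<Longrightarrow> is_place v"
  using \<Sigma> by (auto simp: places_def)

lemma topspace_ideles: "topspace (ideles_top \<Sigma>) = (\<Pi>\<^sub>E v\<in>\<Sigma>. compl_units v)"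
  unfolding ideles_top_def topspace_product_topology by (intro PiE_cong topspace_Kv place_in)

text \<open>One precision N is used for all constrained places: finitely many precisions always have
  a common upper bound.\<close>

definition nbhd :: "('k \<Rightarrow> int) set \<Rightarrow> int \<Rightarrow> (('k \<Rightarrow> int) \<Rightarrow> (nat \<Rightarrow> 'k) set)
    \<Rightarrow> (('k \<Rightarrow> int) \<Rightarrow> (nat \<Rightarrow> 'k) set) set" where
  "nbhd V N P = {Q \<in> topspace (ideles_top \<Sigma>). \<forall>v\<in>V. Q v \<in> vball v N (P v)}"

lemma ideles_component: "P \<in> topspace (ideles_top \<Sigma>) \<Longrightarrow> v \<in> \<Sigma> \<Longrightarrow> P v \<in> compl_units v"
  by (auto simp: topspace_ideles)

lemma nbhd_self:
  assumes "P \<in> topspace (ideles_top \<Sigma>)" "V \<subseteq> \<Sigma>"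
  shows "P \<in> nbhd V N P"
  using assms vball_self[OF place_in] ideles_component compl_units_subset unfolding nbhd_def by blast

lemma openin_nbhd:
  assumes P: "P \<in> topspace (ideles_top \<Sigma>)" and V: "finite V" "V \<subseteq> \<Sigma>"
  shows "openin (ideles_top \<Sigma>) (nbhd V N P)"
proof -
  define X where "X v = (if v \<in> V then vball v N (P v) \<inter> compl_units v else topspace (Kv_star_top v))" for v
  have X_iff: "Q \<in> X v \<longleftrightarrow> Q \<in> compl_units v \<and> (v \<in> V \<longrightarrow> Q \<in> vball v N (P v))" if "v \<in> \<Sigma>" for Q v
    using topspace_Kv[OF place_in[OF that]] by (simp add: X_def conj_commute)
  have "nbhd V N P = (\<Pi>\<^sub>E v\<in>\<Sigma>. X v)"
  proof (rule set_eqI)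
    fix Q
    have "(\<forall>v\<in>\<Sigma>. Q v \<in> X v) \<longleftrightarrow> (\<forall>v\<in>\<Sigma>. Q v \<in> compl_units v) \<and> (\<forall>v\<in>V. Q v \<in> vball v N (P v))"
      using V(2) X_iff by blast
    then show "Q \<in> nbhd V N P \<longleftrightarrow> Q \<in> (\<Pi>\<^sub>E v\<in>\<Sigma>. X v)"
      unfolding nbhd_def topspace_ideles mem_Collect_eq PiE_iff by blast
  qed
  moreover have "openin (product_topology Kv_star_top \<Sigma>) (\<Pi>\<^sub>E v\<in>\<Sigma>. X v)"
  proof (rule product_topology_basis)
    show "openin (Kv_star_top v) (X v)" for v
      unfolding X_def using openin_Kv_vball[OF ideles_component[OF P]] V(2) by auto
    show "finite {v. X v \<noteq> topspace (Kv_star_top v)}"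
      by (rule finite_subset[OF _ V(1)]) (auto simp: X_def)
  qed
  ultimately show ?thesis by (simp add: ideles_top_def)
qed

lemma ideles_open_contains_nbhd:
  assumes U: "openin (ideles_top \<Sigma>) U" and P: "P \<in> U"
  shows "\<exists>V N. finite V \<and> V \<subseteq> \<Sigma> \<and> nbhd V N P \<subseteq> U"
proof -
  obtain X where X: "P \<in> (\<Pi>\<^sub>E v\<in>\<Sigma>. X v)" "\<forall>v. openin (Kv_star_top v) (X v)"
    "finite {v. X v \<noteq> topspace (Kv_star_top v)}" "(\<Pi>\<^sub>E v\<in>\<Sigma>. X v) \<subseteq> U"
    using product_topology_open_contains_basis[OF U[unfolded ideles_top_def] P] by (elim exE conjE)
  define V where "V = \<Sigma> \<inter> {v. X v \<noteq> topspace (Kv_star_top v)}"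
  have V: "finite V" "V \<subseteq> \<Sigma>" using X(3) by (auto simp: V_def)
  have "\<exists>N. vball v N (P v) \<inter> compl_units v \<subseteq> X v" if "v \<in> V" for v
    using that V X(1,2) by (intro Kv_open_contains_vball[OF place_in]) auto
  then obtain n where n: "\<And>v. v \<in> V \<Longrightarrow> vball v (n v) (P v) \<inter> compl_units v \<subseteq> X v" by metis
  define N where "N = (\<Sum>v\<in>V. \<bar>n v\<bar>)"
  have N: "n v \<le> N" if "v \<in> V" for v
    using member_le_sum[OF that, of "\<lambda>v. \<bar>n v\<bar>"] V(1) by (simp add: N_def)
  have "nbhd V N P \<subseteq> (\<Pi>\<^sub>E v\<in>\<Sigma>. X v)"
  proof
    fix Q assume Q: "Q \<in> nbhd V N P"
    have top: "Q \<in> (\<Pi>\<^sub>E v\<in>\<Sigma>. compl_units v)" using Q by (simp add: nbhd_def topspace_ideles)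
    have "Q v \<in> X v" if v: "v \<in> \<Sigma>" for v
    proof (cases "v \<in> V")
      case True
      then have "Q v \<in> vball v (n v) (P v)" using Q vball_mono[OF _ N[OF True]] by (auto simp: nbhd_def)
      then show ?thesis using n[OF True] top v by auto
    next
      case False
      then have "X v = compl_units v" using v topspace_Kv[OF place_in[OF v]] by (simp add: V_def)
      then show ?thesis using top v by auto
    qed
    then show "Q \<in> (\<Pi>\<^sub>E v\<in>\<Sigma>. X v)" using top by (auto simp: PiE_iff)
  qed
  then have "nbhd V N P \<subseteq> U" using X(4) by (rule subset_trans)
  then show ?thesis using V by (intro exI conjI)
qed

lemma diag_in_topspace:
  assumes "a \<noteq> 0"
  shows "diag \<Sigma> a \<in> topspace (ideles_top \<Sigma>)"
  unfolding topspace_ideles diag_def using vemb_in_compl_units[OF assms] by auto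

lemma diag_in_nbhd:
  assumes "a \<noteq> 0" "V \<subseteq> \<Sigma>"
  shows "diag \<Sigma> a \<in> nbhd V N P \<longleftrightarrow> (\<forall>v\<in>V. vemb v a \<in> vball v N (P v))"
proof -
  have "diag \<Sigma> a v = vemb v a" if "v \<in> V" for v using that assms by (auto simp: diag_def)
  then show ?thesis using diag_in_topspace[OF assms(1)] by (simp add: nbhd_def)
qed

text \<open>Removes the topology: closure becomes approximation at finitely many places, the form in
  which the arithmetic argument uses it.\<close>

lemma ideles_closure_iff:
  assumes A: "0 \<notin> A"
  shows "P \<in> ideles_top \<Sigma> closure_of (diag \<Sigma> ` A) \<longleftrightarrow> P \<in> topspace (ideles_top \<Sigma>) \<and>
    (\<forall>V N. finite V \<longrightarrow> V \<subseteq> \<Sigma> \<longrightarrow> (\<exists>a\<in>A. \<forall>v\<in>V. vemb v a \<in> vball v N (P v)))"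
proof (intro iffI conjI allI impI)
  assume cl: "P \<in> ideles_top \<Sigma> closure_of (diag \<Sigma> ` A)"
  then show P: "P \<in> topspace (ideles_top \<Sigma>)" by (simp add: in_closure_of)
  fix V N assume V: "finite V" "V \<subseteq> \<Sigma>"
  have "\<exists>y. y \<in> diag \<Sigma> ` A \<and> y \<in> nbhd V N P"
    using cl nbhd_self[OF P V(2)] openin_nbhd[OF P V] unfolding in_closure_of by blast
  then obtain a where "a \<in> A" "diag \<Sigma> a \<in> nbhd V N P" by blast
  then show "\<exists>a\<in>A. \<forall>v\<in>V. vemb v a \<in> vball v N (P v)"
    using diag_in_nbhd[OF _ V(2)] A by metis
next
  assume R: "P \<in> topspace (ideles_top \<Sigma>) \<and>
    (\<forall>V N. finite V \<longrightarrow> V \<subseteq> \<Sigma> \<longrightarrow> (\<exists>a\<in>A. \<forall>v\<in>V. vemb v a \<in> vball v N (P v)))"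
  show "P \<in> ideles_top \<Sigma> closure_of (diag \<Sigma> ` A)"
    unfolding in_closure_of
  proof (intro conjI allI impI)
    show "P \<in> topspace (ideles_top \<Sigma>)" using R by blast
    fix U assume U: "P \<in> U \<and> openin (ideles_top \<Sigma>) U"
    obtain V N where V: "finite V" "V \<subseteq> \<Sigma>" "nbhd V N P \<subseteq> U" 
      using ideles_open_contains_nbhd[OF conjunct2[OF U] conjunct1[OF U]] by (elim exE conjE)
    obtain a where a: "a \<in> A" "\<forall>v\<in>V. vemb v a \<in> vball v N (P v)" using R V by blast
    have "a \<noteq> 0" using A a by blast
    then have "diag \<Sigma> a \<in> nbhd V N P" using diag_in_nbhd[OF _ V(2)] a(2) by blast
    then show "\<exists>y. y \<in> diag \<Sigma> ` A \<and> y \<in> U" using V(3) a(1) by blast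
  qed
qed

lemma topspace_ideles_pow: "topspace (ideles_pow_top \<Sigma> M) = (\<Pi>\<^sub>E i\<in>{..<M}. topspace (ideles_top \<Sigma>))"
  by (simp add: ideles_pow_top_def)

definition nbhd_pow :: "nat \<Rightarrow> ('k \<Rightarrow> int) set \<Rightarrow> int \<Rightarrow> (nat \<Rightarrow> ('k \<Rightarrow> int) \<Rightarrow> (nat \<Rightarrow> 'k) set)
    \<Rightarrow> (nat \<Rightarrow> ('k \<Rightarrow> int) \<Rightarrow> (nat \<Rightarrow> 'k) set) set" where
  "nbhd_pow M V N P = (\<Pi>\<^sub>E i\<in>{..<M}. nbhd V N (P i))"

lemma openin_nbhd_pow:
  assumes P: "P \<in> topspace (ideles_pow_top \<Sigma> M)" and V: "finite V" "V \<subseteq> \<Sigma>"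
  shows "openin (ideles_pow_top \<Sigma> M) (nbhd_pow M V N P)" "P \<in> nbhd_pow M V N P"
proof -
  have Pi: "P i \<in> topspace (ideles_top \<Sigma>)" if "i < M" for i using P that by (auto simp: topspace_ideles_pow)
  define X where "X i = (if i < M then nbhd V N (P i) else topspace (ideles_top \<Sigma>))" for i
  have "openin (product_topology (\<lambda>_. ideles_top \<Sigma>) {..<M}) (\<Pi>\<^sub>E i\<in>{..<M}. X i)"
  proof (rule product_topology_basis)
    show "openin (ideles_top \<Sigma>) (X i)" for i
      unfolding X_def using openin_nbhd[OF Pi V] by auto
    show "finite {i. X i \<noteq> topspace (ideles_top \<Sigma>)}"
      by (rule finite_subset[of _ "{..<M}"]) (auto simp: X_def split: if_splits)
  qed
  moreover have "(\<Pi>\<^sub>E i\<in>{..<M}. X i) = nbhd_pow M V N P"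
    unfolding nbhd_pow_def by (rule PiE_cong) (simp add: X_def)
  ultimately show "openin (ideles_pow_top \<Sigma> M) (nbhd_pow M V N P)" by (simp add: ideles_pow_top_def)
  show "P \<in> nbhd_pow M V N P"
    unfolding nbhd_pow_def using P nbhd_self[OF Pi V(2)] by (auto simp: topspace_ideles_pow PiE_iff)
qed

lemma ideles_pow_open_contains_nbhd_pow:
  assumes U: "openin (ideles_pow_top \<Sigma> M) U" and P: "P \<in> U"
  shows "\<exists>V N. finite V \<and> V \<subseteq> \<Sigma> \<and> nbhd_pow M V N P \<subseteq> U"
proof -
  obtain X where X: "P \<in> (\<Pi>\<^sub>E i\<in>{..<M}. X i)" "\<forall>i. openin (ideles_top \<Sigma>) (X i)"
    "(\<Pi>\<^sub>E i\<in>{..<M}. X i) \<subseteq> U"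
    using product_topology_open_contains_basis[OF U[unfolded ideles_pow_top_def] P] by (elim exE conjE)
  have "\<exists>V N. finite V \<and> V \<subseteq> \<Sigma> \<and> nbhd V N (P i) \<subseteq> X i" if "i < M" for i
    using X(1,2) that by (intro ideles_open_contains_nbhd) auto
  then obtain W n where W: "\<And>i. i < M \<Longrightarrow> finite (W i) \<and> W i \<subseteq> \<Sigma> \<and> nbhd (W i) (n i) (P i) \<subseteq> X i" by metis
  define V where "V = (\<Union>i<M. W i)"
  define N where "N = (\<Sum>i<M. \<bar>n i\<bar>)"
  have V: "finite V" "V \<subseteq> \<Sigma>" using W by (auto simp: V_def)
  have "nbhd V N (P i) \<subseteq> X i" if i: "i < M" for i
  proof -
    have "n i \<le> N" using i member_le_sum[of i "{..<M}" "\<lambda>i. \<bar>n i\<bar>"] by (simp add: N_def)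
    then have "nbhd V N (P i) \<subseteq> nbhd (W i) (n i) (P i)"
      using i vball_mono unfolding nbhd_def V_def by blast
    then show ?thesis using W[OF i] by blast
  qed
  then have "nbhd_pow M V N P \<subseteq> (\<Pi>\<^sub>E i\<in>{..<M}. X i)" unfolding nbhd_pow_def by (intro PiE_mono) auto
  then have "nbhd_pow M V N P \<subseteq> U" using X(3) by (rule subset_trans)
  then show ?thesis using V by (intro exI conjI)
qed

lemma diag_pt_in_nbhd_pow:
  assumes "\<forall>i<M. a i \<noteq> 0" "V \<subseteq> \<Sigma>"
  shows "diag_pt \<Sigma> M a \<in> nbhd_pow M V N P \<longleftrightarrow> (\<forall>i<M. \<forall>v\<in>V. vemb v (a i) \<in> vball v N (P i v))"
  unfolding nbhd_pow_def diag_pt_def using diag_in_nbhd[OF _ assms(2)] assms(1) by (auto simp: PiE_iff)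

text \<open>A single tuple from \<open>A\<close> has to approximate all coordinates at once;
  approximating each coordinate separately within \<Gamma> would not keep the tuple on the
  variety.\<close>

lemma ideles_pow_closure_iff:
  assumes A: "\<forall>a\<in>A. \<forall>i<M. a i \<noteq> 0"
  shows "P \<in> ideles_pow_top \<Sigma> M closure_of (diag_pt \<Sigma> M ` A) \<longleftrightarrow> P \<in> topspace (ideles_pow_top \<Sigma> M) \<and>
    (\<forall>V N. finite V \<longrightarrow> V \<subseteq> \<Sigma> \<longrightarrow> (\<exists>a\<in>A. \<forall>i<M. \<forall>v\<in>V. vemb v (a i) \<in> vball v N (P i v)))"
proof (intro iffI conjI allI impI)
  assume cl: "P \<in> ideles_pow_top \<Sigma> M closure_of (diag_pt \<Sigma> M ` A)"
  then show P: "P \<in> topspace (ideles_pow_top \<Sigma> M)" by (simp add: in_closure_of)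
  fix V N assume V: "finite V" "V \<subseteq> \<Sigma>"
  have "\<exists>y. y \<in> diag_pt \<Sigma> M ` A \<and> y \<in> nbhd_pow M V N P"
    using cl openin_nbhd_pow[OF P V] unfolding in_closure_of by blast
  then obtain a where a: "a \<in> A" "diag_pt \<Sigma> M a \<in> nbhd_pow M V N P" by blast
  then show "\<exists>a\<in>A. \<forall>i<M. \<forall>v\<in>V. vemb v (a i) \<in> vball v N (P i v)"
    using diag_pt_in_nbhd_pow[OF bspec[OF A a(1)] V(2)] by blast
next
  assume R: "P \<in> topspace (ideles_pow_top \<Sigma> M) \<and>
    (\<forall>V N. finite V \<longrightarrow> V \<subseteq> \<Sigma> \<longrightarrow> (\<exists>a\<in>A. \<forall>i<M. \<forall>v\<in>V. vemb v (a i) \<in> vball v N (P i v)))"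
  show "P \<in> ideles_pow_top \<Sigma> M closure_of (diag_pt \<Sigma> M ` A)"
    unfolding in_closure_of
  proof (intro conjI allI impI)
    show "P \<in> topspace (ideles_pow_top \<Sigma> M)" using R by blast
    fix U assume U: "P \<in> U \<and> openin (ideles_pow_top \<Sigma> M) U"
    obtain V N where V: "finite V" "V \<subseteq> \<Sigma>" "nbhd_pow M V N P \<subseteq> U"
      using ideles_pow_open_contains_nbhd_pow[OF conjunct2[OF U] conjunct1[OF U]] by (elim exE conjE)
    obtain a where a: "a \<in> A" "\<forall>i<M. \<forall>v\<in>V. vemb v (a i) \<in> vball v N (P i v)" using R V by blast
    have "diag_pt \<Sigma> M a \<in> nbhd_pow M V N P" using diag_pt_in_nbhd_pow[OF bspec[OF A a(1)] V(2)] a(2) by blast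
    then show "\<exists>y. y \<in> diag_pt \<Sigma> M ` A \<and> y \<in> U" using V(3) a(1) by blast
  qed
qed

end

text \<open>The value in the last condition exists because the components of the point are nonzero
  elements of K_v, whose representing sequences have eventually constant value.\<close>

lemma adelic_limit_of_closure_point:
  fixes K :: "'k::field itself"
  assumes K: "global_function_field K p"
    and \<Sigma>: "\<Sigma> \<subseteq> places" "finite (places - \<Sigma>)" and \<Gamma>: "mult_subgroup \<Gamma>"
    and S0: "finite S0" "\<Gamma> \<subseteq> S_units S0"
    and P: "P \<in> ideles_top \<Sigma> closure_of (diag \<Sigma> ` \<Gamma>)"
  shows "adelic_limit K p \<Sigma> S0 \<Gamma> (\<lambda>v N a. vemb v a \<in> vball v N (P v))"
proof
  show "global_function_field K p" by (rule K)
  have "0 \<notin> \<Gamma>" using \<Gamma> by (auto simp: mult_subgroup_def)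
  note cl = P[unfolded ideles_closure_iff[OF \<Sigma>(1) this]]
  have pl: "is_place v" if "v \<in> \<Sigma>" for v using that \<Sigma> by (auto simp: places_def)
  have unit: "P v \<in> compl_units v" if "v \<in> \<Sigma>" for v
    using ideles_component[OF \<Sigma>(1)] cl that by blast
  then have compl: "P v \<in> compl v" if "v \<in> \<Sigma>" for v using that compl_units_subset by blast
  show "\<Sigma> \<subseteq> places" "finite (places - \<Sigma>)" "mult_subgroup \<Gamma>" "finite S0" "\<Gamma> \<subseteq> S_units S0"
    by (fact \<Sigma> \<Gamma> S0)+
  show "\<exists>\<gamma>\<in>\<Gamma>. \<forall>v\<in>V. vemb v \<gamma> \<in> vball v N (P v)" if "finite V" "V \<subseteq> \<Sigma>" for V N
    using cl that by blast
  show "vge v (a - b) N"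
    if v: "v \<in> \<Sigma>" and a: "vemb v a \<in> vball v N (P v)" and b: "vemb v b \<in> vball v N (P v)" for v N a b
  proof -
    obtain X where X: "X \<in> P v" using compl_rep_ex[OF compl[OF v]] by blast
    note iff = vemb_in_vball_iff[OF pl[OF v] compl[OF v] X]
    have "eventually (\<lambda>n. vge v (a - b) N) sequentially"
      using a[unfolded iff] b[unfolded iff]
    proof eventually_elim
      case (elim n)
      then show ?case using vge_diff[OF pl[OF v] elim(2,1)] by simp
    qed
    then show ?thesis by simp
  qed
  show "vemb v b \<in> vball v N (P v)"
    if v: "v \<in> \<Sigma>" and a: "vemb v a \<in> vball v N (P v)" and ab: "vge v (a - b) N" for v N a b
  proof -
    obtain X where X: "X \<in> P v" using compl_rep_ex[OF compl[OF v]] by blast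
    note iff = vemb_in_vball_iff[OF pl[OF v] compl[OF v] X]
    show ?thesis
      unfolding iff using a[unfolded iff]
    proof eventually_elim
      case (elim n)
      then show ?case using vge_add[OF pl[OF v] elim ab] by simp
    qed
  qed
  show "vemb v a \<in> vball v M (P v)" if "v \<in> \<Sigma>" "vemb v a \<in> vball v N (P v)" "M \<le> N" for v N M a
    using vball_mono that by blast
  show "\<exists>C. \<forall>N>C. \<forall>a. vemb v a \<in> vball v N (P v) \<longrightarrow> v a = C" if v: "v \<in> \<Sigma>" for v
  proof -
    obtain X where X: "X \<in> P v" using compl_rep_ex[OF compl[OF v]] by blast
    note iff = vemb_in_vball_iff[OF pl[OF v] compl[OF v] X]
    obtain C where C: "eventually (\<lambda>n. X n \<noteq> 0 \<and> v (X n) = C) sequentially"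
      using compl_unit_value[OF pl[OF v] unit[OF v] X] by blast
    have "v a = C" if N: "N > C" and a: "vemb v a \<in> vball v N (P v)" for N a
    proof -
      have "eventually (\<lambda>n. v a = C) sequentially"
        using C a[unfolded iff]
      proof eventually_elim
        case (elim n)
        have "vge v (a - X n) N" using elim(2) vge_commute[OF pl[OF v]] by blast
        then have "vge v (a - X n) (v (X n) + 1)" by (rule vge_mono) (use elim(1) N in simp)
        from place_add_dominant(2)[OF pl[OF v] _ this] elim show ?case by simp
      qed
      then show ?thesis by simp
    qed
    then show ?thesis by blast
  qed
qed

theorem theorem2:
  fixes p :: nat
    and \<Sigma> S S0 :: "('k::field \<Rightarrow> int) set"
    and \<Gamma> :: "'k set"
  assumes "global_function_field TYPE('k) p"
    and "\<Sigma> \<subseteq> places" and "finite (places - \<Sigma>)" and "S = places - \<Sigma>"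
    and "mult_subgroup \<Gamma>"
    and "S0 \<subseteq> places" and "finite S0" and "\<Gamma> \<subseteq> S_units S0"
    and "rank_le (\<Gamma> \<inter> S_units S) 1"
  shows "\<forall>(M::nat) F. (\<forall>f\<in>F. is_poly M f) \<longrightarrow>
           var_points_ad \<Sigma> M F (ideles_top \<Sigma> closure_of (diag \<Sigma> ` \<Gamma>))
           = ideles_pow_top \<Sigma> M closure_of (diag_pt \<Sigma> M ` var_points_K M F \<Gamma>)"
proof (intro allI impI)
  fix M :: nat and F :: "((nat \<Rightarrow> nat) \<Rightarrow> 'k) set"
  assume F: "\<forall>f\<in>F. is_poly M f"
  interpret global_field "TYPE('k)" p by unfold_locales (rule assms(1))
  define B where "B = var_points_K M F \<Gamma>"
  define cl\<Gamma> where "cl\<Gamma> = ideles_top \<Sigma> closure_of (diag \<Sigma> ` \<Gamma>)"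
  have zero: "0 \<notin> \<Gamma>" using assms(5) by (auto simp: mult_subgroup_def)
  have B\<Gamma>: "a i \<in> \<Gamma>" if "a \<in> B" "i < M" for a i using that by (auto simp: B_def var_points_K_def)
  have Bnz: "\<forall>a\<in>B. \<forall>i<M. a i \<noteq> 0" using B\<Gamma> zero by metis
  have pl: "is_place v" if "v \<in> \<Sigma>" for v using that assms(2) by (auto simp: places_def)
  have compl: "P v \<in> compl v" if "P \<in> topspace (ideles_top \<Sigma>)" "v \<in> \<Sigma>" for P v
    using ideles_component[OF assms(2) that] compl_units_subset by blast
  have cl_top: "cl\<Gamma> \<subseteq> topspace (ideles_top \<Sigma>)" unfolding cl\<Gamma>_def by (rule closure_of_subset_topspace)
  show "var_points_ad \<Sigma> M F cl\<Gamma> = ideles_pow_top \<Sigma> M closure_of (diag_pt \<Sigma> M ` B)"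
  proof (intro equalityI subsetI)
    \<comment> \<open>The arithmetic inclusion: \<open>exact_points\<close> turns approximations of
      the separate coordinates into one exact zero.\<close>
    fix P assume "P \<in> var_points_ad \<Sigma> M F cl\<Gamma>"
    then have P: "P \<in> {..<M} \<rightarrow>\<^sub>E cl\<Gamma>" and van: "\<And>f v. f \<in> F \<Longrightarrow> v \<in> \<Sigma> \<Longrightarrow> vzero v M f (\<lambda>i. P i v)"
      by (auto simp: var_points_ad_def)
    have Pi: "P i \<in> cl\<Gamma>" if "i < M" for i using P that by auto
    show "P \<in> ideles_pow_top \<Sigma> M closure_of (diag_pt \<Sigma> M ` B)"
      unfolding ideles_pow_closure_iff[OF assms(2) Bnz]
    proof (intro conjI allI impI)
      show "P \<in> topspace (ideles_pow_top \<Sigma> M)"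
        unfolding topspace_ideles_pow[OF assms(2)] using P cl_top by (auto simp: PiE_iff)
      fix V N assume V: "finite V" "V \<subseteq> \<Sigma>"
      have "\<exists>a\<in>{..<M} \<rightarrow>\<^sub>E \<Gamma>. (\<forall>f\<in>F. peval M f a = 0) \<and>
        (\<forall>i<M. \<forall>v\<in>V. vemb v (a i) \<in> vball v N (P i v))"
      proof (rule exact_points[OF _ assms(2,3,5) _ _ _ V])
        show "adelic_limit TYPE('k) p \<Sigma> S0 \<Gamma> (\<lambda>v N a. vemb v a \<in> vball v N (P i v))" if "i < M" for i
          using Pi[OF that] unfolding cl\<Gamma>_def
          by (rule adelic_limit_of_closure_point[OF assms(1,2,3,5,7,8)])
        show "rank_le (\<Gamma> \<inter> S_units (places - \<Sigma>)) 1" using assms(4,9) by simp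
        show "is_poly M f" if "f \<in> F" for f using F that by blast
        show "\<exists>N'. \<forall>a. (\<forall>i<M. vemb v (a i) \<in> vball v N' (P i v)) \<longrightarrow> vge v (peval M f a) N"
          if f: "f \<in> F" and v: "v \<in> \<Sigma>" for f v N
        proof (rule vzero_near[OF pl[OF v] _ _ van[OF f v]])
          show "is_poly M f" using F f by blast
          show "P i v \<in> compl v" if "i < M" for i using compl Pi[OF that] cl_top v by blast
        qed
      qed
      then show "\<exists>a\<in>B. \<forall>i<M. \<forall>v\<in>V. vemb v (a i) \<in> vball v N (P i v)"
        by (auto simp: B_def var_points_K_def)
    qed
  next
    \<comment> \<open>The continuity inclusion: lying in the closure of \<Gamma> and being a zero of
      f both pass to limits.\<close>
    fix P assume "P \<in> ideles_pow_top \<Sigma> M closure_of (diag_pt \<Sigma> M ` B)"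
    then have top: "P \<in> topspace (ideles_pow_top \<Sigma> M)"
      and near: "\<And>V N. finite V \<Longrightarrow> V \<subseteq> \<Sigma> \<Longrightarrow> \<exists>a\<in>B. \<forall>i<M. \<forall>v\<in>V. vemb v (a i) \<in> vball v N (P i v)"
      unfolding ideles_pow_closure_iff[OF assms(2) Bnz] by blast+
    have Pi: "P i \<in> topspace (ideles_top \<Sigma>)" if "i < M" for i
      using top that unfolding topspace_ideles_pow[OF assms(2)] by auto
    have "P i \<in> cl\<Gamma>" if i: "i < M" for i
      unfolding cl\<Gamma>_def ideles_closure_iff[OF assms(2) zero]
    proof (intro conjI allI impI Pi[OF i])
      fix V N assume "finite V" "V \<subseteq> \<Sigma>"
      then obtain a where "a \<in> B" "\<forall>i<M. \<forall>v\<in>V. vemb v (a i) \<in> vball v N (P i v)" using near by blast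
      then show "\<exists>a\<in>\<Gamma>. \<forall>v\<in>V. vemb v a \<in> vball v N (P i v)" using B\<Gamma> i by blast
    qed
    then have "P \<in> {..<M} \<rightarrow>\<^sub>E cl\<Gamma>"
      using top unfolding topspace_ideles_pow[OF assms(2)] by (auto simp: PiE_iff)
    moreover have "vzero v M f (\<lambda>i. P i v)" if f: "f \<in> F" and v: "v \<in> \<Sigma>" for f v
    proof (rule vzero_if_approximable[OF pl[OF v]])
      show "is_poly M f" using F f by blast
      show "P i v \<in> compl v" if "i < M" for i using compl Pi[OF that] v by blast
      fix N
      have "finite {v}" "{v} \<subseteq> \<Sigma>" using v by auto
      then obtain a where "a \<in> B" "\<forall>i<M. \<forall>v\<in>{v}. vemb v (a i) \<in> vball v N (P i v)" using near by blast
      then show "\<exists>a. peval M f a = 0 \<and> (\<forall>i<M. vemb v (a i) \<in> vball v N (P i v))"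
        using f by (auto simp: B_def var_points_K_def)
    qed
    ultimately show "P \<in> var_points_ad \<Sigma> M F cl\<Gamma>" by (auto simp: var_points_ad_def)
  qed
qed

end
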